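(* Assume that $a$ satisfies hypothesis (A) of the context. There exist a constant $C=C(C_2,\|a_1\|_\infty,\|a_2\|_\infty,\|b_1\|_\infty,\|b_2\|_\infty,\mu_1,\mu_2,T)>0$ and a positive weight function $\kappa=\kappa(t)$ such that, for every $\rho^T\in L^2(\Omega)$, the solution $(\rho,\psi^1,\psi^2)$ of $$\begin{cases}-\rho_t-(a(x)\rho_x)_x+a_1\rho-(\beta(x)a_2\rho)_x=\alpha_1\psi^1\chi_{\omega_d}+\alpha_2\psi^2\chi_{\omega_d}&\text{in }Q,\\ \rho(t,0)=\rho(t,1)=0&\text{on }(0,T),\\ \rho(T,\cdot)=\rho^T&\text{in }\Omega,\end{cases}$$ $$\begin{cases}\psi^i_t-(a(x)\psi^i_x)_x+b_1\psi^i+\beta(x)b_2\psi^i_x=-\frac1{\mu_i}\rho\chi_{\omega_i}&\text{in }Q,\\ \psi^i(t,0)=\psi^i(t,1)=0&\text{on }(0,T),\\ \psi^i(0,\cdot)=0&\text{in }\Omega,\end{cases}\qquad i=1,2,$$ satisfies $$\|\rho(0,\cdot)\|^2_{L^2(\Omega)}+\sum_{i=1}^2\int_Q\kappa^2|\psi^i|^2\,dx\,dt\le C\int_0^T\int_\omega|\rho|^2\,dx\,dt .$$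
   Context: Setting. $\Omega=(0,1)$, $T>0$, $Q=(0,T)\times\Omega$; $\omega,\omega_1,\omega_2,\omega_d\subset\Omega$ are nonempty open sets with $\omega_i\cap\omega=\emptyset$ ($i=1,2$) and $\omega_d\cap\omega\ne\emptyset$; $\alpha_1,\alpha_2,\mu_1,\mu_2>0$ are constants; $a_1,a_2,b_1,b_2\in L^\infty(Q)$; $\|\cdot\|_\infty$ is the norm of $L^\infty(Q)$. Hypothesis (A) on $a$: $a\in C([0,1])\cap C^1((0,1])$, $a>0$ in $(0,1]$, $a(0)=0$, and there is $\tau\in[0,1)$ with $xa'(x)\le\tau a(x)$ for $x\in[0,1]$. $\beta$ is a function on $\Omega$ with $\beta(x)/x\in L^\infty(\Omega)$. Solutions are weak solutions in $\mathbb H=L^2((0,T);H^1_a(\Omega))\cap C([0,T];L^2(\Omega))$, where $H^1_a(\Omega)=\{u\in L^2(\Omega): u$ absolutely continuous on $[0,1]$, $\sqrt a u_x\in L^2(\Omega)$, $u(0)=u(1)=0\}$. The constant $C_2$. $C_2>0$ is the constant such that, with $\varrho=\alpha_1\psi^1+\alpha_2\psi^2$, every solution satisfies, for $s$ large enough, $\mathcal I(\rho)+\mathcal I(\varrho)\le C_2s^7\int_0^T\int_\omega|\rho|^2dxdt$, where $\mathcal I(z)=\int_Q\big(s^3\Theta^3\frac{x^2}{a(x)}z^2+s\Theta a(x)z_x^2\big)e^{2s\varphi}dxdt$, $\Theta(t)=(t(T-t))^{-4}$, $\varphi(t,x)=\Theta(t)\lambda\big(\int_0^x\frac y{a(y)}dy-d\big)$.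 Here $d\ge\frac5{a(1)(2-\tau)}$ and $\lambda\in\left[\frac{a(1)(2-\tau)(e^{2r\|\sigma\|_\infty}-1)}{d\,a(1)(2-\tau)-1},\frac{4(e^{2r\|\sigma\|_\infty}-e^{r\|\sigma\|_\infty})}{3d}\right]$ are fixed, with $r\ge\frac{4\ln 2}{\|\sigma\|_\infty}$ and $\sigma\in C^2([0,1])$ such that $\sigma>0$ in $(0,1)$, $\sigma(0)=\sigma(1)=0$, $\sigma_x\neq0$ in $[0,1]\setminus\mathcal O_0$, for nonempty open sets $\mathcal O_0\Subset\mathcal O_1\Subset\omega_d\cap\omega$. *)

theory Defs
  imports "HOL-Analysis.Analysis" "HOL-Probability.Essential_Supremum"
begin

section \<open>Function spaces\<close>

abbreviation Omega :: "real set" where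
  "Omega \<equiv> {0<..<1}"

definition cyl :: "real \<Rightarrow> (real \<times> real) set" where
  "cyl T = {0<..<T} \<times> Omega"

text \<open>Elements of \<open>L\<^sup>2\<close> and \<open>L\<^sup>\<infinity>\<close> are represented by (Lebesgue measurable) functions.\<close>

definition L2_on :: "'a::euclidean_space set \<Rightarrow> ('a \<Rightarrow> real) \<Rightarrow> bool" where
  "L2_on S f \<longleftrightarrow>
     f \<in> borel_measurable (lebesgue_on S) \<and> integrable (lebesgue_on S) (\<lambda>z. (f z)\<^sup>2)"

definition Linf_on :: "'a::euclidean_space set \<Rightarrow> ('a \<Rightarrow> real) \<Rightarrow> bool" where
  "Linf_on S f \<longleftrightarrow>
     f \<in> borel_measurable (lebesgue_on S) \<and> esssup (lebesgue_on S) (\<lambda>z. ereal \<bar>f z\<bar>) < \<infinity>"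

definition Linf_norm :: "'a::euclidean_space set \<Rightarrow> ('a \<Rightarrow> real) \<Rightarrow> real" where
  "Linf_norm S f = real_of_ereal (esssup (lebesgue_on S) (\<lambda>z. ereal \<bar>f z\<bar>))"

text \<open>Absolute continuity on \<open>[p, q]\<close>; the finite set \<open>D\<close> is a family of non-overlapping intervals,
  each given by its pair of endpoints.\<close>

definition abs_cont_on :: "real \<Rightarrow> real \<Rightarrow> (real \<Rightarrow> real) \<Rightarrow> bool" where
  "abs_cont_on p q u \<longleftrightarrow>
     (\<forall>\<epsilon>>0. \<exists>\<delta>>0. \<forall>D.
        finite D \<and> (\<forall>(x, y)\<in>D. p \<le> x \<and> x < y \<and> y \<le> q) \<and>
        pairwise (\<lambda>I J. {fst I<..<snd I} \<inter> {fst J<..<snd J} = {}) D \<and>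
        (\<Sum>(x, y)\<in>D. y - x) < \<delta>
        \<longrightarrow> (\<Sum>(x, y)\<in>D. \<bar>u y - u x\<bar>) < \<epsilon>)"

text \<open>The spatial derivative \<open>u\<^sub>x\<close> is \<^const>\<open>deriv\<close>: an absolutely continuous function is
  differentiable almost everywhere, and the arbitrary value of \<^const>\<open>deriv\<close> at the remaining
  points is immaterial.\<close>

definition H1a :: "(real \<Rightarrow> real) \<Rightarrow> (real \<Rightarrow> real) set" where
  "H1a a = {u. L2_on Omega u \<and> abs_cont_on 0 1 u \<and>
               L2_on Omega (\<lambda>x. sqrt (a x) * deriv u x) \<and> u 0 = 0 \<and> u 1 = 0}"

text \<open>The space \<open>L\<^sup>2((0,T); H\<^sup>1\<^sub>a) \<inter> C([0,T]; L\<^sup>2)\<close>; \<open>u t\<close> is the slice of \<open>u\<close> at time \<open>t\<close>. For almost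
  every \<open>t\<close> the absolutely continuous representative of the slice is used.\<close>

definition solution_space :: "(real \<Rightarrow> real) \<Rightarrow> real \<Rightarrow> (real \<Rightarrow> real \<Rightarrow> real) set" where
  "solution_space a T = {u.
     (AE t in lebesgue_on {0<..<T}. u t \<in> H1a a) \<and>
     L2_on (cyl T) (\<lambda>(t, x). u t x) \<and>
     L2_on (cyl T) (\<lambda>(t, x). sqrt (a x) * deriv (u t) x) \<and>
     (\<forall>t\<in>{0..T}. L2_on Omega (u t)) \<and>
     (\<forall>t\<in>{0..T}. ((\<lambda>s. LINT x|lebesgue_on Omega. (u s x - u t x)\<^sup>2) \<longlongrightarrow> 0) (at t within {0..T}))}"

section \<open>Hypotheses on the data\<close>

text \<open>Hypothesis (A) with exponent \<open>\<tau>\<close>. The inequality \<open>x a'(x) \<le> \<tau> a(x)\<close> is imposed on \<open>(0,1]\<close>,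
  where \<open>a'\<close> exists; at \<open>x = 0\<close> both sides are \<open>0\<close> by convention.\<close>

definition hypothesis_A :: "(real \<Rightarrow> real) \<Rightarrow> real \<Rightarrow> bool" where
  "hypothesis_A a \<tau> \<longleftrightarrow>
     continuous_on {0..1} a \<and> (\<forall>x\<in>{0<..1}. a x > 0) \<and> a 0 = 0 \<and> 0 \<le> \<tau> \<and> \<tau> < 1 \<and>
     (\<exists>a'. (\<forall>x\<in>{0<..1}. (a has_real_derivative a' x) (at x within {0..1})) \<and>
           continuous_on {0<..1} a' \<and>
           (\<forall>x\<in>{0<..1}. x * a' x \<le> \<tau> * a x))"

text \<open>\<open>\<sigma> \<in> C\<^sup>2([0,1])\<close>, positive in \<open>(0,1)\<close>, zero at the endpoints, without critical point
  outside \<open>O0\<close>.\<close>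

definition sigma_function :: "real set \<Rightarrow> (real \<Rightarrow> real) \<Rightarrow> bool" where
  "sigma_function O0 \<sigma> \<longleftrightarrow>
     (\<exists>\<sigma>' \<sigma>''.
        (\<forall>x\<in>{0..1}. (\<sigma> has_real_derivative \<sigma>' x) (at x within {0..1})) \<and>
        (\<forall>x\<in>{0..1}. (\<sigma>' has_real_derivative \<sigma>'' x) (at x within {0..1})) \<and>
        continuous_on {0..1} \<sigma>'' \<and>
        (\<forall>x\<in>{0..1} - O0. \<sigma>' x \<noteq> 0)) \<and>
     (\<forall>x\<in>{0<..<1}. \<sigma> x > 0) \<and> \<sigma> 0 = 0 \<and> \<sigma> 1 = 0"

definition sup_norm :: "(real \<Rightarrow> real) \<Rightarrow> real" where
  "sup_norm \<sigma> = (SUP x\<in>{0..1}. \<bar>\<sigma> x\<bar>)"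

definition carleman_parameters ::
  "(real \<Rightarrow> real) \<Rightarrow> real \<Rightarrow> real set \<Rightarrow> real set \<Rightarrow> real set \<Rightarrow> (real \<Rightarrow> real) \<Rightarrow>
   real \<Rightarrow> real \<Rightarrow> real \<Rightarrow> bool" where
  "carleman_parameters a \<tau> U O0 O1 \<sigma> r d lam \<longleftrightarrow>
     open O0 \<and> O0 \<noteq> {} \<and> open O1 \<and> O1 \<noteq> {} \<and> closure O0 \<subseteq> O1 \<and> closure O1 \<subseteq> U \<and>
     sigma_function O0 \<sigma> \<and>
     r \<ge> 4 * ln 2 / sup_norm \<sigma> \<and>
     d \<ge> 5 / (a 1 * (2 - \<tau>)) \<and>
     lam \<ge> a 1 * (2 - \<tau>) * (exp (2 * r * sup_norm \<sigma>) - 1) / (d * a 1 * (2 - \<tau>) - 1) \<and>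
     lam \<le> 4 * (exp (2 * r * sup_norm \<sigma>) - exp (r * sup_norm \<sigma>)) / (3 * d)"

section \<open>Weak solutions of the coupled system\<close>

text \<open>Weak solutions of \<open>-u\<^sub>t - (a u\<^sub>x)\<^sub>x + c u - (g u)\<^sub>x = F\<close>, \<open>u(t,0) = u(t,1) = 0\<close>, \<open>u(T) = uT\<close>:
  the equation is paired with \<open>w \<in> H\<^sup>1\<^sub>a\<close>, integrated by parts in \<open>x\<close>, and integrated over \<open>(t,T)\<close>.\<close>

definition weak_sol_backward ::
  "(real \<Rightarrow> real) \<Rightarrow> real \<Rightarrow> (real \<Rightarrow> real \<Rightarrow> real) \<Rightarrow> (real \<Rightarrow> real \<Rightarrow> real) \<Rightarrow>
   (real \<Rightarrow> real \<Rightarrow> real) \<Rightarrow> (real \<Rightarrow> real) \<Rightarrow> (real \<Rightarrow> real \<Rightarrow> real) \<Rightarrow> bool" where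
  "weak_sol_backward a T c g F uT u \<longleftrightarrow>
     u \<in> solution_space a T \<and>
     (AE x in lebesgue_on Omega. u T x = uT x) \<and>
     (\<forall>t\<in>{0..T}. \<forall>w\<in>H1a a.
        (LINT x|lebesgue_on Omega. u t x * w x) - (LINT x|lebesgue_on Omega. u T x * w x)
        + (LINT z|lebesgue_on ({t<..<T} \<times> Omega). (case z of (s, x) \<Rightarrow>
             a x * deriv (u s) x * deriv w x + c s x * u s x * w x + g s x * u s x * deriv w x))
        = (LINT z|lebesgue_on ({t<..<T} \<times> Omega). (case z of (s, x) \<Rightarrow> F s x * w x)))"

text \<open>Weak solutions of \<open>u\<^sub>t - (a u\<^sub>x)\<^sub>x + c u + g u\<^sub>x = F\<close>, \<open>u(t,0) = u(t,1) = 0\<close>, \<open>u(0) = u0\<close>.\<close>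

definition weak_sol_forward ::
  "(real \<Rightarrow> real) \<Rightarrow> real \<Rightarrow> (real \<Rightarrow> real \<Rightarrow> real) \<Rightarrow> (real \<Rightarrow> real \<Rightarrow> real) \<Rightarrow>
   (real \<Rightarrow> real \<Rightarrow> real) \<Rightarrow> (real \<Rightarrow> real) \<Rightarrow> (real \<Rightarrow> real \<Rightarrow> real) \<Rightarrow> bool" where
  "weak_sol_forward a T c g F u0 u \<longleftrightarrow>
     u \<in> solution_space a T \<and>
     (AE x in lebesgue_on Omega. u 0 x = u0 x) \<and>
     (\<forall>t\<in>{0..T}. \<forall>w\<in>H1a a.
        (LINT x|lebesgue_on Omega. u t x * w x) - (LINT x|lebesgue_on Omega. u 0 x * w x)
        + (LINT z|lebesgue_on ({0<..<t} \<times> Omega). (case z of (s, x) \<Rightarrow>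
             a x * deriv (u s) x * deriv w x + c s x * u s x * w x + g s x * deriv (u s) x * w x))
        = (LINT z|lebesgue_on ({0<..<t} \<times> Omega). (case z of (s, x) \<Rightarrow> F s x * w x)))"

definition coupled_solution ::
  "(real \<Rightarrow> real) \<Rightarrow> (real \<Rightarrow> real) \<Rightarrow> real set \<Rightarrow> real set \<Rightarrow> real set \<Rightarrow> real \<Rightarrow> real \<Rightarrow>
   real \<Rightarrow> real \<Rightarrow> real \<Rightarrow>
   (real \<Rightarrow> real \<Rightarrow> real) \<Rightarrow> (real \<Rightarrow> real \<Rightarrow> real) \<Rightarrow> (real \<Rightarrow> real \<Rightarrow> real) \<Rightarrow> (real \<Rightarrow> real \<Rightarrow> real) \<Rightarrow>
   (real \<Rightarrow> real) \<Rightarrow> (real \<Rightarrow> real \<Rightarrow> real) \<Rightarrow> (real \<Rightarrow> real \<Rightarrow> real) \<Rightarrow> (real \<Rightarrow> real \<Rightarrow> real) \<Rightarrow> bool" where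
  "coupled_solution a \<beta> \<omega>1 \<omega>2 \<omega>d \<alpha>1 \<alpha>2 \<mu>1 \<mu>2 T a1 a2 b1 b2 \<rho>T \<rho> \<psi>1 \<psi>2 \<longleftrightarrow>
     weak_sol_backward a T a1 (\<lambda>t x. \<beta> x * a2 t x)
       (\<lambda>t x. \<alpha>1 * \<psi>1 t x * indicator \<omega>d x + \<alpha>2 * \<psi>2 t x * indicator \<omega>d x) \<rho>T \<rho> \<and>
     weak_sol_forward a T b1 (\<lambda>t x. \<beta> x * b2 t x)
       (\<lambda>t x. - (1 / \<mu>1) * \<rho> t x * indicator \<omega>1 x) (\<lambda>x. 0) \<psi>1 \<and>
     weak_sol_forward a T b1 (\<lambda>t x. \<beta> x * b2 t x)
       (\<lambda>t x. - (1 / \<mu>2) * \<rho> t x * indicator \<omega>2 x) (\<lambda>x. 0) \<psi>2"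

section \<open>The Carleman estimate defining \<open>C\<^sub>2\<close>\<close>

definition Theta :: "real \<Rightarrow> real \<Rightarrow> real" where
  "Theta T t = 1 / (t * (T - t)) ^ 4"

definition phi :: "(real \<Rightarrow> real) \<Rightarrow> real \<Rightarrow> real \<Rightarrow> real \<Rightarrow> real \<Rightarrow> real \<Rightarrow> real" where
  "phi a d lam T t x = Theta T t * (lam * ((LINT y|lebesgue_on {0..x}. y / a y) - d))"

definition carleman_I ::
  "(real \<Rightarrow> real) \<Rightarrow> real \<Rightarrow> real \<Rightarrow> real \<Rightarrow> real \<Rightarrow> (real \<Rightarrow> real \<Rightarrow> real) \<Rightarrow> real" where
  "carleman_I a d lam T s z =
     (LINT p|lebesgue_on (cyl T). (case p of (t, x) \<Rightarrow>
        (s ^ 3 * Theta T t ^ 3 * (x\<^sup>2 / a x) * (z t x)\<^sup>2 + s * Theta T t * a x * (deriv (z t) x)\<^sup>2)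
        * exp (2 * s * phi a d lam T t x)))"

text \<open>\<open>s0\<close> is the threshold in ``for \<open>s\<close> large enough''; it does not depend on the
  solution.  Like \<open>C2\<close> it may depend on the data; the observability constant \<open>C\<close>, which is a
  function of \<open>C2\<close>, \<open>T\<close>, \<open>\<mu>\<^sub>i\<close> and the norms of the potentials, must therefore be stated relative to a
  threshold prescribed as a function of these same quantities.\<close>

definition carleman_estimate ::
  "(real \<Rightarrow> real) \<Rightarrow> (real \<Rightarrow> real) \<Rightarrow> real set \<Rightarrow> real set \<Rightarrow> real set \<Rightarrow> real set \<Rightarrow> real \<Rightarrow> real \<Rightarrow>
   real \<Rightarrow> real \<Rightarrow> real \<Rightarrow> real \<Rightarrow> real \<Rightarrow>
   (real \<Rightarrow> real \<Rightarrow> real) \<Rightarrow> (real \<Rightarrow> real \<Rightarrow> real) \<Rightarrow> (real \<Rightarrow> real \<Rightarrow> real) \<Rightarrow> (real \<Rightarrow> real \<Rightarrow> real) \<Rightarrow>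
   real \<Rightarrow> real \<Rightarrow> bool" where
  "carleman_estimate a \<beta> \<omega> \<omega>1 \<omega>2 \<omega>d \<alpha>1 \<alpha>2 d lam \<mu>1 \<mu>2 T a1 a2 b1 b2 C2 s0 \<longleftrightarrow>
     (\<forall>s\<ge>s0. \<forall>\<rho>T \<rho> \<psi>1 \<psi>2.
        L2_on Omega \<rho>T \<longrightarrow>
        coupled_solution a \<beta> \<omega>1 \<omega>2 \<omega>d \<alpha>1 \<alpha>2 \<mu>1 \<mu>2 T a1 a2 b1 b2 \<rho>T \<rho> \<psi>1 \<psi>2 \<longrightarrow>
        carleman_I a d lam T s \<rho>
        + carleman_I a d lam T s (\<lambda>t x. \<alpha>1 * \<psi>1 t x + \<alpha>2 * \<psi>2 t x)
        \<le> C2 * s ^ 7 * (LINT p|lebesgue_on ({0<..<T} \<times> \<omega>). (case p of (t, x) \<Rightarrow> (\<rho> t x)\<^sup>2)))"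

end

theory Submission
  imports Defs
begin

text \<open>The Carleman weight vanishes at both \<open>t = 0\<close> and \<open>t = T\<close>, so at \<open>s\<close> fixed the Carleman estimate
  together with the Poincare inequality \<open>\<parallel>u\<parallel>\<^sup>2 \<le> c \<integral> a u\<^sub>x\<^sup>2\<close> controls \<open>\<rho>\<close> in \<open>L\<^sup>2\<close> only on
  time intervals \<open>(\<delta>, t)\<close> with \<open>0 < \<delta> < t < T\<close>. Near \<open>t = 0\<close> energy estimates take over: backwards in
  time they bound \<open>\<rho>\<close> on \<open>[0, \<delta>]\<close> by its later values and by \<open>\<psi>\<^sup>1, \<psi>\<^sup>2\<close>, while forwards in time, as
  \<open>\<psi>\<^sup>i(0) = 0\<close>, they bound \<open>\<psi>\<^sup>i\<close> by earlier values of \<open>\<rho>\<close>. For \<open>\<delta>\<close> small, depending on the data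
  only through the admissible quantities, this coupling is absorbed. Finally \<open>\<kappa>\<^sup>2\<close> is a decreasing
  minorant of the Carleman weight, which controls \<open>\<psi>\<^sup>i\<close> through \<open>\<integral>\<^sub>0\<^sup>t \<parallel>\<rho>\<parallel>\<^sup>2\<close>.

  The energy identity is obtained without regularising in time: the increment \<open>u(s + h) - u(s)\<close> is
  tested with the slices \<open>u(s)\<close> and \<open>u(s + h)\<close>, which gives \<open>\<parallel>u(s + h)\<parallel>\<^sup>2 - \<parallel>u(s)\<parallel>\<^sup>2\<close>, and the mean over
  \<open>s\<close> is passed to the limit \<open>h \<rightarrow> 0\<close> by continuity of translations in \<open>L\<^sup>2\<close>. The Poincare inequality
  needs that an absolutely continuous function is the integral of its derivative, proved by writing it
  as a difference of monotone absolutely continuous functions, whose Stieltjes measures have densities.\<close>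

section \<open>Absolutely continuous functions\<close>

text \<open>The Carleman estimate sees the two states only through the combination
  \<open>\<alpha>1 * \<psi>1 + \<alpha>2 * \<psi>2\<close>, which bounds neither of them separately;
  hence each of them is recovered from \<rho> through its own forward equation. For \<rho> the
  gradient term is the one to work with: the zero-order weight \<open>x^2 / a\<close> tends to 0 at
  the degenerate end, while the integral of \<open>a u_x^2\<close> controls \<open>u\<close> up to
  that end. Reading anything off the estimate requires integrability of the whole integrand, since a
  Bochner integral is 0 by default otherwise. There the lower bound on \<open>d\<close> enters: it
  keeps the exponent below a negative multiple of \<Theta>, so that the exponential beats the powers
  of \<Theta>. The drift terms stay harmless because \<beta> is of order \<open>x\<close> and
  \<open>x / sqrt a\<close> is bounded. Finally, the constant is a function chosen before the
  horizon and the coefficients are given, hence the explicit formulas for the absorption time, the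
  value of \<open>s\<close> and the time weight in place of mere existence.\<close>

definition interval_families :: "real \<Rightarrow> real \<Rightarrow> (real \<times> real) set set" where
  "interval_families p q = {D. finite D \<and> (\<forall>(x, y)\<in>D. p \<le> x \<and> x < y \<and> y \<le> q) \<and>
     pairwise (\<lambda>I J. {fst I<..<snd I} \<inter> {fst J<..<snd J} = {}) D}"

lemma abs_cont_on_altdef:
  "abs_cont_on p q u \<longleftrightarrow> (\<forall>\<epsilon>>0. \<exists>\<delta>>0. \<forall>D\<in>interval_families p q.
     (\<Sum>(x, y)\<in>D. y - x) < \<delta> \<longrightarrow> (\<Sum>(x, y)\<in>D. \<bar>u y - u x\<bar>) < \<epsilon>)"
  unfolding abs_cont_on_def interval_families_def Ball_Collect[symmetric] by (simp only: Ball_def mem_Collect_eq imp_conjL conj_assoc)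

lemma interval_families_mono: "p' \<le> p \<Longrightarrow> q \<le> q' \<Longrightarrow> interval_families p q \<subseteq> interval_families p' q'"
  unfolding interval_families_def by fastforce

lemma empty_in_interval_families [simp]: "{} \<in> interval_families p q"
  by (simp add: interval_families_def)

lemma singleton_in_interval_families: "p \<le> x \<Longrightarrow> x < y \<Longrightarrow> y \<le> q \<Longrightarrow> {(x, y)} \<in> interval_families p q"
  by (simp add: interval_families_def)

lemma abs_cont_on_subinterval:
  assumes "abs_cont_on p q u" "p \<le> p'" "q' \<le> q"
  shows "abs_cont_on p' q' u"
  using assms interval_families_mono[OF assms(2,3)] unfolding abs_cont_on_altdef by (meson subsetD)

text \<open>Additivity of Lebesgue measure on disjoint open intervals turns the sum of lengths into
  the measure of a subset of \<open>{p..q}\<close>.\<close>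

lemma interval_families_length_le:
  assumes D: "D \<in> interval_families p q" and pq: "p \<le> q"
  shows "(\<Sum>(x, y)\<in>D. y - x) \<le> q - p"
proof -
  have fin: "finite D" and dis: "disjoint_family_on (\<lambda>I. {fst I<..<snd I}) D"
    using D by (auto simp: interval_families_def disjoint_family_on_def pairwise_def)
  have "(\<Sum>(x, y)\<in>D. y - x) = (\<Sum>I\<in>D. measure lborel {fst I<..<snd I})"
    using D by (intro sum.cong) (auto simp: interval_families_def)
  also have "\<dots> = measure lborel (\<Union>I\<in>D. {fst I<..<snd I})"
  proof (rule measure_finite_Union[symmetric])
    show "\<And>i. i \<in> D \<Longrightarrow> emeasure lborel {fst i<..<snd i} \<noteq> \<infinity>"
      using D by (auto simp: interval_families_def)
  qed (use fin dis in auto)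
  also have "\<dots> \<le> measure lborel {p..q}"
    using D pq by (intro measure_mono_fmeasurable) (auto simp: interval_families_def case_prod_beta fmeasurable_def)
  finally show ?thesis using pq by simp
qed

lemma abs_cont_on_continuous:
  assumes "abs_cont_on p q u"
  shows "continuous_on {p..q} u"
proof (rule continuous_onI)
  fix x e :: real assume x: "x \<in> {p..q}" and e: "0 < e"
  obtain d where d: "d > 0" and *: "\<And>D. D \<in> interval_families p q \<Longrightarrow>
     (\<Sum>(x, y)\<in>D. y - x) < d \<Longrightarrow> (\<Sum>(x, y)\<in>D. \<bar>u y - u x\<bar>) < e"
    using assms e unfolding abs_cont_on_altdef by meson
  have "dist (u x') (u x) \<le> e" if x': "x' \<in> {p..q}" "dist x' x < d" for x'
  proof (cases x x' rule: linorder_cases)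
    case less
    then show ?thesis using *[of "{(x, x')}"] x x' by (auto simp: singleton_in_interval_families dist_real_def)
  next
    case greater
    then show ?thesis using *[of "{(x', x)}"] x x' by (auto simp: singleton_in_interval_families dist_real_def)
  qed (use e in auto)
  then show "\<exists>d>0. \<forall>x'\<in>{p..q}. dist x' x < d \<longrightarrow> dist (u x') (u x) \<le> e" using d by blast
qed

lemma abs_cont_on_diff:
  assumes "abs_cont_on p q u" "abs_cont_on p q v"
  shows "abs_cont_on p q (\<lambda>x. u x - v x)"
  unfolding abs_cont_on_altdef
proof (intro allI impI)
  fix e :: real assume "e > 0"
  then have e2: "e / 2 > 0" by simp
  obtain d where d: "d > 0" and *: "\<And>D. D \<in> interval_families p q \<Longrightarrow>
     (\<Sum>(x, y)\<in>D. y - x) < d \<Longrightarrow> (\<Sum>(x, y)\<in>D. \<bar>u y - u x\<bar>) < e/2"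
    using assms(1) e2 unfolding abs_cont_on_altdef by meson
  obtain d' where d': "d' > 0" and **: "\<And>D. D \<in> interval_families p q \<Longrightarrow>
     (\<Sum>(x, y)\<in>D. y - x) < d' \<Longrightarrow> (\<Sum>(x, y)\<in>D. \<bar>v y - v x\<bar>) < e/2"
    using assms(2) e2 unfolding abs_cont_on_altdef by meson
  have "(\<Sum>(x, y)\<in>D. \<bar>u y - v y - (u x - v x)\<bar>) < e"
    if D: "D \<in> interval_families p q" "(\<Sum>(x, y)\<in>D. y - x) < min d d'" for D
  proof -
    have "(\<Sum>(x, y)\<in>D. \<bar>u y - v y - (u x - v x)\<bar>) \<le> (\<Sum>(x, y)\<in>D. \<bar>u y - u x\<bar>) + (\<Sum>(x, y)\<in>D. \<bar>v y - v x\<bar>)"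
      unfolding sum.distrib[symmetric] by (intro sum_mono) auto
    also have "\<dots> < e" using *[of D] **[of D] D by force
    finally show ?thesis .
  qed
  then show "\<exists>\<delta>>0. \<forall>D\<in>interval_families p q. (\<Sum>(x, y)\<in>D. y - x) < \<delta> \<longrightarrow>
      (\<Sum>(x, y)\<in>D. \<bar>u y - v y - (u x - v x)\<bar>) < e"
    using d d' by (intro exI[of _ "min d d'"]) auto
qed

text \<open>Every endpoint is clamped into \<open>{x..y}\<close> and the intervals that collapse are
  removed. The right-hand sum still runs over all of \<open>D\<close>, where collapsed intervals
  contribute 0, so the sums for two adjacent windows can be added term by term.\<close>

lemma interval_families_clamp:
  fixes u :: "real \<Rightarrow> real"
  assumes D: "D \<in> interval_families p q" and xy: "x \<le> y"
  obtains D' where "D' \<in> interval_families x y"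
    "(\<Sum>(s, t)\<in>D'. u t - u s) = (\<Sum>(s, t)\<in>D. u (max x (min t y)) - u (max x (min s y)))"
proof -
  let ?c = "\<lambda>s. max x (min s y)"
  let ?g = "\<lambda>(s, t). (?c s, ?c t)"
  define E where "E = {I\<in>D. ?c (fst I) < ?c (snd I)}"
  have fin: "finite D" using D by (simp add: interval_families_def)
  have ne: "{?c (fst I)<..<?c (snd I)} \<noteq> {}" "{?c (fst I)<..<?c (snd I)} \<subseteq> {fst I<..<snd I}" if "I \<in> E" for I
    using that unfolding E_def by (auto simp: max_def min_def split: if_splits)
  have disj: "{fst I<..<snd I} \<inter> {fst J<..<snd J} = {}" if "I \<in> E" "J \<in> E" "I \<noteq> J" for I J
    using that D unfolding E_def interval_families_def pairwise_def by auto
  \<comment> \<open>A clamped interval of \<open>E\<close> is nonempty and lies inside the original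
    one, and the originals are disjoint, so no two images coincide.\<close>
  have inj: "inj_on ?g E"
  proof (rule inj_onI, rule ccontr)
    fix I J assume IJ: "I \<in> E" "J \<in> E" "?g I = ?g J" "I \<noteq> J"
    then have "?c (fst I) = ?c (fst J)" "?c (snd I) = ?c (snd J)" by (auto simp: case_prod_beta)
    then have "{?c (fst I)<..<?c (snd I)} \<subseteq> {fst I<..<snd I} \<inter> {fst J<..<snd J}"
      using ne(2)[OF IJ(1)] ne(2)[OF IJ(2)] by (metis Int_greatest)
    then show False using ne(1)[OF IJ(1)] disj[OF IJ(1,2,4)] by blast
  qed
  have "?g ` E \<in> interval_families x y"
    unfolding interval_families_def
  proof (intro CollectI conjI)
    show "finite (?g ` E)" using fin by (simp add: E_def)
    show "\<forall>(s, t)\<in>?g ` E. x \<le> s \<and> s < t \<and> t \<le> y" using xy by (auto simp: E_def)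
    show "pairwise (\<lambda>I J. {fst I<..<snd I} \<inter> {fst J<..<snd J} = {}) (?g ` E)"
    proof (rule pairwise_imageI)
      fix I J assume "I \<in> E" "J \<in> E" "I \<noteq> J"
      then show "{fst (?g I)<..<snd (?g I)} \<inter> {fst (?g J)<..<snd (?g J)} = {}"
        using disj[of I J] ne(2)[of I] ne(2)[of J] unfolding case_prod_beta fst_conv snd_conv by blast
    qed
  qed
  moreover have "(\<Sum>(s, t)\<in>?g ` E. u t - u s) = (\<Sum>(s, t)\<in>E. u (?c t) - u (?c s))"
    by (subst sum.reindex[OF inj]) (simp add: case_prod_beta)
  moreover have "\<dots> = (\<Sum>(s, t)\<in>D. u (?c t) - u (?c s))"
  proof (rule sum.mono_neutral_left)
    show "\<forall>i\<in>D - E. (case i of (s, t) \<Rightarrow> u (?c t) - u (?c s)) = 0"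
    proof
      fix i assume i: "i \<in> D - E"
      obtain s t where st: "i = (s, t)" by (cases i)
      have "s < t" "\<not> ?c s < ?c t" using i D st by (auto simp: interval_families_def E_def)
      then have "?c s = ?c t" by (auto simp: max_def min_def)
      then show "(case i of (s, t) \<Rightarrow> u (?c t) - u (?c s)) = 0" using st by simp
    qed
  qed (use fin in \<open>auto simp: E_def\<close>)
  ultimately show ?thesis using that by metis
qed

text \<open>The positive variation of \<open>u\<close>: the increments are signed and the intervals
  need not cover, so the supremum collects the rises only. It splits \<open>u\<close> into the
  difference of \<open>pos_variation u p\<close> and \<open>pos_variation u p - u\<close>, both
  increasing.\<close>

definition pos_variation :: "(real \<Rightarrow> real) \<Rightarrow> real \<Rightarrow> real \<Rightarrow> real" where
  "pos_variation u p x = (SUP D\<in>interval_families p x. \<Sum>(s, t)\<in>D. u t - u s)"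

text \<open>The bound \<open>B\<close> keeps the supremum finite. A family on \<open>{p..x}\<close>
  is also one on \<open>{p..y}\<close>, and it may be extended by \<open>(x, y)\<close>, which gains
  \<open>u y - u x\<close>: this yields the two monotonicities. Absolute continuity is inherited
  because the increments of the variation over a family are nearly attained by a refined family of
  no larger total length.\<close>

lemma abs_cont_on_pos_variation:
  assumes ac: "abs_cont_on p q u" and pq: "p \<le> q"
    and bd: "\<And>D. D \<in> interval_families p q \<Longrightarrow> (\<Sum>(s, t)\<in>D. u t - u s) \<le> B"
  shows "mono_on {p..q} (pos_variation u p)"
    and "mono_on {p..q} (\<lambda>x. pos_variation u p x - u x)"
    and "abs_cont_on p q (pos_variation u p)"
proof -
  let ?S = "\<lambda>D. \<Sum>(s, t)\<in>D. u t - u s"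
  let ?P = "pos_variation u p"
  have bdd: "bdd_above (?S ` interval_families p x)" if "x \<le> q" for x
    using bd interval_families_mono[of p p x q] that by (auto intro!: bdd_aboveI[of _ B])
  have up: "?S D \<le> ?P x" if "D \<in> interval_families p x" "x \<le> q" for D x
    unfolding pos_variation_def by (rule cSUP_upper[OF that(1) bdd[OF that(2)]])
  have least: "?P x \<le> c" if "\<And>D. D \<in> interval_families p x \<Longrightarrow> ?S D \<le> c" for x c
    unfolding pos_variation_def using that by (intro cSUP_least) (auto simp: ex_in_conv[symmetric] intro: empty_in_interval_families)
  show "mono_on {p..q} ?P"
    by (rule mono_onI, rule least, rule up) (use interval_families_mono[OF order_refl] in \<open>auto dest!: subsetD\<close>)
  show "mono_on {p..q} (\<lambda>x. ?P x - u x)"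
  proof (rule mono_onI)
    fix x y assume xy: "x \<in> {p..q}" "y \<in> {p..q}" "x \<le> y"
    show "?P x - u x \<le> ?P y - u y"
    proof (cases "x = y")
      case False
      have "?P x \<le> ?P y - u y + u x"
      proof (rule least)
        fix D assume D: "D \<in> interval_families p x"
        have nin: "(x, y) \<notin> D" using D False xy by (auto simp: interval_families_def)
        have "insert (x, y) D \<in> interval_families p y"
          unfolding interval_families_def
        proof (intro CollectI conjI)
          have *: "p \<le> fst I \<and> fst I < snd I \<and> snd I \<le> x" if "I \<in> D" for I
            using D that by (auto simp: interval_families_def case_prod_beta)
          show "\<forall>(s, t)\<in>insert (x, y) D. p \<le> s \<and> s < t \<and> t \<le> y"
            using * xy False by (force simp: case_prod_beta)
          have "pairwise (\<lambda>I J. {fst I<..<snd I} \<inter> {fst J<..<snd J} = {}) D"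
            using D by (simp add: interval_families_def)
          moreover have "{fst I<..<snd I} \<inter> {x<..<y} = {}" if "I \<in> D" for I
            using *[OF that] by auto
          ultimately show "pairwise (\<lambda>I J. {fst I<..<snd I} \<inter> {fst J<..<snd J} = {}) (insert (x, y) D)"
            by (auto simp only: pairwise_insert fst_conv snd_conv Int_commute)
        qed (use D in \<open>simp add: interval_families_def\<close>)
        from up[OF this] have "?S (insert (x, y) D) \<le> ?P y" using xy by auto
        then show "?S D \<le> ?P y - u y + u x"
          using nin D by (simp add: interval_families_def)
      qed
      then show ?thesis by simp
    qed simp
  qed
  \<comment> \<open>A nearly optimal family for \<open>{p..y}\<close> is cut at \<open>x\<close>;
    its part left of \<open>x\<close> contributes at most \<open>?P x\<close>, so the part inside
    \<open>{x..y}\<close> must account for the increment.\<close>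
  have split: "\<exists>D\<in>interval_families x y. ?P y - ?P x \<le> ?S D + e"
    if xy: "p \<le> x" "x \<le> y" "y \<le> q" and e: "e > 0" for x y e
  proof -
    have "\<exists>D\<in>interval_families p y. ?P y - e < ?S D"
    proof (rule ccontr)
      assume "\<not> ?thesis"
      then have "?P y \<le> ?P y - e" by (intro least) auto
      then show False using e by simp
    qed
    then obtain D where D: "D \<in> interval_families p y" "?P y - e < ?S D" by blast
    obtain D1 where D1: "D1 \<in> interval_families p x"
      "?S D1 = (\<Sum>(s, t)\<in>D. u (max p (min t x)) - u (max p (min s x)))"
      using interval_families_clamp[OF D(1) xy(1), of u] by blast
    obtain D2 where D2: "D2 \<in> interval_families x y"
      "?S D2 = (\<Sum>(s, t)\<in>D. u (max x (min t y)) - u (max x (min s y)))"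
      using interval_families_clamp[OF D(1) xy(2), of u] by blast
    have "?S D1 + ?S D2 = ?S D"
      unfolding D1(2) D2(2) sum.distrib[symmetric]
    proof (rule sum.cong[OF refl])
      fix I assume I: "I \<in> D"
      obtain s t where st: "I = (s, t)" by (cases I)
      have "p \<le> s" "s < t" "t \<le> y" using D(1) I st by (auto simp: interval_families_def)
      then show "(case I of (s, t) \<Rightarrow> u (max p (min t x)) - u (max p (min s x))) +
         (case I of (s, t) \<Rightarrow> u (max x (min t y)) - u (max x (min s y))) = (case I of (s, t) \<Rightarrow> u t - u s)"
        using xy st by (cases "s \<le> x"; cases "t \<le> x") (simp_all add: max_def min_def)
    qed
    moreover have "?S D1 \<le> ?P x" using up[OF D1(1)] xy by auto
    ultimately show ?thesis using D(2) D2(1) by (intro bexI[of _ D2]) auto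
  qed
  show "abs_cont_on p q ?P"
    unfolding abs_cont_on_altdef
  proof (intro allI impI)
    fix e :: real assume e: "e > 0"
    then have "e / 2 > 0" by simp
    then obtain d where d: "d > 0" and *: "\<And>D. D \<in> interval_families p q \<Longrightarrow>
       (\<Sum>(x, y)\<in>D. y - x) < d \<Longrightarrow> (\<Sum>(x, y)\<in>D. \<bar>u y - u x\<bar>) < e/2"
      using ac unfolding abs_cont_on_altdef by meson
    have "(\<Sum>(x, y)\<in>D. \<bar>?P y - ?P x\<bar>) < e"
      if D: "D \<in> interval_families p q" and len: "(\<Sum>(x, y)\<in>D. y - x) < d" for D
    proof -
      have fin: "finite D" using D by (simp add: interval_families_def)
      \<comment> \<open>The error allowed per interval: \<open>card D\<close> of them add up to at
        most \<open>e/2\<close>, and the added 1 covers the empty family.\<close>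
      define \<eta> where "\<eta> = e / (2 * (real (card D) + 1))"
      have \<eta>: "\<eta> > 0" using e by (simp add: \<eta>_def)
      have "\<forall>I\<in>D. \<exists>E\<in>interval_families (fst I) (snd I). ?P (snd I) - ?P (fst I) \<le> ?S E + \<eta>"
      proof
        fix I assume I: "I \<in> D"
        have "p \<le> fst I" "fst I \<le> snd I" "snd I \<le> q"
          using D I by (auto simp: interval_families_def case_prod_beta intro: less_imp_le)
        then show "\<exists>E\<in>interval_families (fst I) (snd I). ?P (snd I) - ?P (fst I) \<le> ?S E + \<eta>"
          using split \<eta> by blast
      qed
      then obtain E where E: "\<And>I. I \<in> D \<Longrightarrow> E I \<in> interval_families (fst I) (snd I)"
        "\<And>I. I \<in> D \<Longrightarrow> ?P (snd I) - ?P (fst I) \<le> ?S (E I) + \<eta>"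
        by metis
      have sub: "{fst J<..<snd J} \<noteq> {} \<and> {fst J<..<snd J} \<subseteq> {fst I<..<snd I}" if "I \<in> D" "J \<in> E I" for I J
        using E(1)[OF that(1)] that(2) by (auto simp: interval_families_def case_prod_beta)
      have disjD: "{fst I<..<snd I} \<inter> {fst J<..<snd J} = {}" if "I \<in> D" "J \<in> D" "I \<noteq> J" for I J
        using D that by (auto simp: interval_families_def pairwise_def)
      have disjE: "E I \<inter> E J = {}" if "I \<in> D" "J \<in> D" "I \<noteq> J" for I J
      proof (rule equals0I)
        fix z assume z: "z \<in> E I \<inter> E J"
        then show False using disjD[OF that] sub[of I z] sub[of J z] that by blast
      qed
      have finE: "finite (E I)" if "I \<in> D" for I using E(1)[OF that] by (simp add: interval_families_def)
      \<comment> \<open>The refinements of the disjoint intervals of \<open>D\<close> form one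
        family, to which the modulus \<open>d\<close> of \<open>u\<close> applies.\<close>
      let ?U = "\<Union>I\<in>D. E I"
      have U: "?U \<in> interval_families p q"
        unfolding interval_families_def
      proof (intro CollectI conjI)
        show "finite ?U" using fin finE by blast
        show "\<forall>(x, y)\<in>?U. p \<le> x \<and> x < y \<and> y \<le> q"
        proof
          fix J assume "J \<in> ?U"
          then obtain I where I: "I \<in> D" "J \<in> E I" by blast
          have "p \<le> fst I" "snd I \<le> q" using D I(1) by (auto simp: interval_families_def case_prod_beta)
          moreover have "fst I \<le> fst J" "fst J < snd J" "snd J \<le> snd I"
            using E(1)[OF I(1)] I(2) by (auto simp: interval_families_def case_prod_beta)
          ultimately show "case J of (x, y) \<Rightarrow> p \<le> x \<and> x < y \<and> y \<le> q" by (simp add: case_prod_beta)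
        qed
        show "pairwise (\<lambda>I J. {fst I<..<snd I} \<inter> {fst J<..<snd J} = {}) ?U"
        proof (rule pairwiseI)
          fix I J assume IJ: "I \<in> ?U" "J \<in> ?U" "I \<noteq> J"
          obtain I' J' where IJ': "I' \<in> D" "I \<in> E I'" "J' \<in> D" "J \<in> E J'" using IJ by blast
          show "{fst I<..<snd I} \<inter> {fst J<..<snd J} = {}"
          proof (cases "I' = J'")
            case True
            then show ?thesis using IJ IJ' E(1)[of I'] unfolding interval_families_def pairwise_def by auto
          next
            case False
            then show ?thesis using sub[OF IJ'(1,2)] sub[OF IJ'(3,4)] disjD[OF IJ'(1,3)] by blast
          qed
        qed
      qed
      have sumU: "(\<Sum>J\<in>?U. f J) = (\<Sum>I\<in>D. \<Sum>J\<in>E I. f J)" for f :: "real \<times> real \<Rightarrow> real"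
        using fin finE disjE by (intro sum.UNION_disjoint) auto
      have "(\<Sum>(x, y)\<in>?U. y - x) \<le> (\<Sum>(x, y)\<in>D. y - x)"
        unfolding sumU
      proof (rule sum_mono)
        fix I assume I: "I \<in> D"
        then have "fst I \<le> snd I" using D by (auto simp: interval_families_def case_prod_beta intro: less_imp_le)
        then show "(\<Sum>(x, y)\<in>E I. y - x) \<le> (case I of (x, y) \<Rightarrow> y - x)"
          using interval_families_length_le[OF E(1)[OF I]] by (simp add: case_prod_beta)
      qed
      then have less: "(\<Sum>(x, y)\<in>?U. \<bar>u y - u x\<bar>) < e/2" using * U len by fastforce
      have "(\<Sum>(x, y)\<in>D. \<bar>?P y - ?P x\<bar>) \<le> (\<Sum>I\<in>D. ?S (E I) + \<eta>)"
      proof (rule sum_mono)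
        fix I assume I: "I \<in> D"
        have "?P (fst I) \<le> ?P (snd I)"
        proof (rule mono_onD[OF \<open>mono_on {p..q} ?P\<close>])
          show "fst I \<in> {p..q}" "snd I \<in> {p..q}" "fst I \<le> snd I"
            using I D by (auto simp: interval_families_def case_prod_beta intro: less_imp_le order_trans)
        qed
        then show "(case I of (x, y) \<Rightarrow> \<bar>?P y - ?P x\<bar>) \<le> ?S (E I) + \<eta>"
          using E(2)[OF I] by (simp add: case_prod_beta)
      qed
      also have "\<dots> = ?S ?U + real (card D) * \<eta>" by (simp add: sumU sum.distrib)
      also have "\<dots> \<le> (\<Sum>(x, y)\<in>?U. \<bar>u y - u x\<bar>) + real (card D) * \<eta>"
        by (intro add_right_mono sum_mono) auto
      also have "real (card D) * \<eta> \<le> e/2" using e by (simp add: \<eta>_def field_simps)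
      finally show ?thesis using less by linarith
    qed
    then show "\<exists>\<delta>>0. \<forall>D\<in>interval_families p q. (\<Sum>(x, y)\<in>D. y - x) < \<delta> \<longrightarrow>
      (\<Sum>(x, y)\<in>D. \<bar>?P y - ?P x\<bar>) < e" using d by blast
  qed
qed

section \<open>Densities of monotone absolutely continuous functions\<close>

lemma open_connected_bounded_real:
  fixes c :: "real set"
  assumes "open c" "connected c" "c \<noteq> {}" "c \<subseteq> {p..q}"
  shows "c = {Inf c<..<Sup c}" "Inf c < Sup c" "p \<le> Inf c" "Sup c \<le> q"
proof -
  have bd: "bdd_below c" "bdd_above c" using assms(4) by (meson bdd_above_Icc bdd_above_mono bdd_below_Icc bdd_below_mono)+
  show "p \<le> Inf c" "Sup c \<le> q" using assms(3,4) by (auto intro!: cInf_greatest cSup_least)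
  have sub: "{Inf c<..<Sup c} \<subseteq> c"
  proof
    fix z assume "z \<in> {Inf c<..<Sup c}"
    then obtain x y where "x \<in> c" "x < z" "y \<in> c" "z < y"
      using cInf_less_iff[OF assms(3) bd(1)] less_cSup_iff[OF assms(3) bd(2)] by auto
    then show "z \<in> c" using connectedD_interval[OF assms(2)] by (meson less_imp_le)
  qed
  have sup: "Inf c < x \<and> x < Sup c" if x: "x \<in> c" for x
  proof -
    obtain e where "e > 0" "ball x e \<subseteq> c" using assms(1) x by (meson openE)
    then have "x - e/2 \<in> c" "x + e/2 \<in> c" by (auto simp: subset_iff dist_real_def)
    then have "Inf c \<le> x - e/2" "x + e/2 \<le> Sup c" using bd by (auto intro: cInf_lower cSup_upper)
    then show ?thesis using \<open>e > 0\<close> by linarith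
  qed
  show "c = {Inf c<..<Sup c}" using sub sup by auto
  then show "Inf c < Sup c" using assms(3) by auto
qed

text \<open>The Stieltjes measure of \<open>G\<close> vanishes on Lebesgue null sets, so
  Radon-Nikodym provides \<open>f\<close>. For an open set the definition of absolute continuity
  applies to finitely many components at a time, and continuity from below passes to all of them; a
  null set is covered by open sets of small measure.\<close>

lemma mono_abs_cont_density:
  assumes ac: "abs_cont_on p q G" and mono: "mono_on {p..q} G" and pq: "p < q"
  obtains f where "\<And>x. 0 \<le> f x" "\<And>x. x \<in> {p..q} \<Longrightarrow> (f has_integral (G x - G p)) {p..x}"
proof -
  \<comment> \<open>Freezing \<open>G\<close> outside \<open>{p..q}\<close> gives a monotone
    continuous function on the whole line, as the Stieltjes construction requires.\<close>
  define F where "F x = G (max p (min x q))" for x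
  define \<nu> where "\<nu> = interval_measure F"
  define \<nu>' where "\<nu>' = density \<nu> (indicator {p<..q})"
  have Feq: "F x = G x" if "x \<in> {p..q}" for x using that by (auto simp: F_def)
  have monoF: "F x \<le> F y" if "x \<le> y" for x y
    unfolding F_def using that pq by (intro mono_onD[OF mono]) auto
  have contF: "continuous_on UNIV F"
    unfolding F_def
    by (rule continuous_on_compose2[OF abs_cont_on_continuous[OF ac]]) (use pq in \<open>auto intro!: continuous_intros\<close>)
  then have rcF: "continuous (at_right x) F" for x
    by (auto simp: continuous_on_eq_continuous_within intro: continuous_within_subset)
  have Ioc: "emeasure \<nu> {x<..y} = ennreal (F y - F x)" if "x \<le> y" for x y
    unfolding \<nu>_def using that monoF rcF by (intro emeasure_interval_measure_Ioc)
  have sets\<nu>[measurable_cong, simp]: "sets \<nu> = sets borel" by (simp add: \<nu>_def)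
  have Ioo: "emeasure \<nu> {x<..<y} \<le> ennreal (F y - F x)" if "x \<le> y" for x y
    unfolding Ioc[OF that, symmetric] by (intro emeasure_mono) auto
  \<comment> \<open>Continuity of \<open>F\<close> excludes an atom at \<open>q\<close>, so
    \<open>{p<..<q}\<close>, in which the covering open sets lie, may be exchanged for
    \<open>{p<..q}\<close>.\<close>
  have pt: "emeasure \<nu> {q} = 0"
    using emeasure_interval_measure_Icc[OF order_refl monoF contF, of q] by (simp add: \<nu>_def)
  have \<nu>': "emeasure \<nu>' N = emeasure \<nu> (N \<inter> {p<..q})" if "N \<in> sets borel" for N
    using that by (simp add: \<nu>'_def emeasure_density indicator_inter_arith[symmetric] mult.commute)
  have small: "emeasure \<nu> O' \<le> ennreal e"
    if e: "e > 0" and O': "open O'" "O' \<subseteq> {p<..<q}" and len: "emeasure lborel O' < ennreal d" and d: "d > 0"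
      and *: "\<And>D. D \<in> interval_families p q \<Longrightarrow>
     (\<Sum>(x, y)\<in>D. y - x) < d \<Longrightarrow> (\<Sum>(x, y)\<in>D. \<bar>G y - G x\<bar>) < e" for e d O'
  proof (cases "O' = {}")
    case False
    let ?C = "components O'"
    have opn: "open c" if "c \<in> ?C" for c using open_components O' that by blast
    have ne: "?C \<noteq> {}" using False by (simp add: components_eq_empty)
    have dis: "c \<inter> c' = {}" if "c \<in> ?C" "c' \<in> ?C" "c \<noteq> c'" for c c'
      using pairwise_disjoint_components[of O'] that by (auto simp: pairwise_def)
    have cnt: "countable ?C"
      by (rule countable_disjoint_open_subsets) (use opn dis in \<open>auto simp: pairwise_def disjnt_def\<close>)
    have c: "c = {Inf c<..<Sup c}" "Inf c < Sup c" "p \<le> Inf c" "Sup c \<le> q" if "c \<in> ?C" for c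
    proof -
      have "c \<subseteq> {p..q}" using in_components_subset[OF that] O'(2) by fastforce
      from open_connected_bounded_real[OF opn[OF that] in_components_connected[OF that] in_components_nonempty[OF that] this]
      show "c = {Inf c<..<Sup c}" "Inf c < Sup c" "p \<le> Inf c" "Sup c \<le> q" by auto
    qed
    have fin: "emeasure \<nu> (\<Union>X) \<le> ennreal e" if X: "finite X" "X \<subseteq> ?C" for X
    proof -
      let ?D = "(\<lambda>c. (Inf c, Sup c)) ` X"
      have inj: "inj_on (\<lambda>c. (Inf c, Sup c)) X"
      proof (rule inj_onI)
        fix c1 c2 assume "c1 \<in> X" "c2 \<in> X" "(Inf c1, Sup c1) = (Inf c2, Sup c2)"
        then show "c1 = c2" using c(1)[of c1] c(1)[of c2] X by auto
      qed
      have D: "?D \<in> interval_families p q"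
        unfolding interval_families_def
      proof (intro CollectI conjI)
        show "\<forall>(x, y)\<in>?D. p \<le> x \<and> x < y \<and> y \<le> q" using c X by auto
        show "pairwise (\<lambda>I J. {fst I<..<snd I} \<inter> {fst J<..<snd J} = {}) ?D"
        proof (rule pairwise_imageI)
          fix c1 c2 assume "c1 \<in> X" "c2 \<in> X" "c1 \<noteq> c2"
          then show "{fst (Inf c1, Sup c1)<..<snd (Inf c1, Sup c1)} \<inter> {fst (Inf c2, Sup c2)<..<snd (Inf c2, Sup c2)} = {}"
            using c(1)[of c1] c(1)[of c2] dis[of c1 c2] X unfolding fst_conv snd_conv by blast
        qed
      qed (use X in simp)
      have "(\<Sum>(x, y)\<in>?D. y - x) = (\<Sum>c\<in>X. Sup c - Inf c)"
        by (subst sum.reindex[OF inj]) simp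
      also have "ennreal \<dots> = (\<Sum>c\<in>X. ennreal (Sup c - Inf c))"
        using c(2) X by (intro sum_ennreal[symmetric]) (auto simp: less_imp_le subset_iff)
      also have "\<dots> = (\<Sum>c\<in>X. emeasure lborel c)"
      proof (rule sum.cong[OF refl])
        fix x assume "x \<in> X"
        then have "x \<in> ?C" using X by auto
        then have "emeasure lborel {Inf x<..<Sup x} = ennreal (Sup x - Inf x)" using c(2)[OF \<open>x \<in> ?C\<close>] by (intro emeasure_lborel_Ioo) simp
        then show "ennreal (Sup x - Inf x) = emeasure lborel x" using c(1)[OF \<open>x \<in> ?C\<close>] by simp
      qed
      also have "\<dots> = emeasure lborel (\<Union>c\<in>X. c)"
        using X opn dis by (intro sum_emeasure) (auto simp: disjoint_family_on_def subset_iff)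
      also have "\<dots> \<le> emeasure lborel O'"
      proof (rule emeasure_mono)
        show "(\<Union>c\<in>X. c) \<subseteq> O'" using X(2) in_components_subset by blast
      qed (use O' in auto)
      also have "\<dots> < ennreal d" by fact
      finally have "(\<Sum>(x, y)\<in>?D. y - x) < d" by (meson ennreal_leI not_le)
      from *[OF D this] have less: "(\<Sum>c\<in>X. \<bar>G (Sup c) - G (Inf c)\<bar>) < e"
        by (subst (asm) sum.reindex[OF inj]) simp
      have "emeasure \<nu> (\<Union>c\<in>X. c) \<le> (\<Sum>c\<in>X. emeasure \<nu> c)"
        using X opn by (intro emeasure_subadditive_finite) auto
      also have "\<dots> \<le> (\<Sum>c\<in>X. ennreal \<bar>G (Sup c) - G (Inf c)\<bar>)"
      proof (rule sum_mono)
        fix x assume "x \<in> X"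
        then have x: "x \<in> ?C" using X by auto
        have "emeasure \<nu> {Inf x<..<Sup x} \<le> ennreal (F (Sup x) - F (Inf x))" using Ioo c(2)[OF x] by simp
        also have "\<dots> \<le> ennreal \<bar>G (Sup x) - G (Inf x)\<bar>"
          using Feq[of "Sup x"] Feq[of "Inf x"] c(2-4)[OF x] by (intro ennreal_leI) auto
        finally show "emeasure \<nu> x \<le> ennreal \<bar>G (Sup x) - G (Inf x)\<bar>" using c(1)[OF x] by simp
      qed
      also have "\<dots> = ennreal (\<Sum>c\<in>X. \<bar>G (Sup c) - G (Inf c)\<bar>)" by (intro sum_ennreal) auto
      also have "\<dots> \<le> ennreal e" using less by (intro ennreal_leI) auto
      finally show ?thesis by simp
    qed
    \<comment> \<open>The components are countably many; finite unions along an enumeration increase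
      to \<open>O'\<close>.\<close>
    define A where "A n = (\<Union>i\<le>n. from_nat_into ?C i)" for n
    have fC: "from_nat_into ?C i \<in> ?C" for i using from_nat_into[OF ne] .
    have "(\<Union>n. A n) = O'"
    proof -
      have "(\<Union>n. A n) = \<Union>(range (from_nat_into ?C))" unfolding A_def by blast
      then show ?thesis using range_from_nat_into[OF ne cnt] Union_components[of O'] by simp
    qed
    moreover have "(\<lambda>n. emeasure \<nu> (A n)) \<longlonglongrightarrow> emeasure \<nu> (\<Union>n. A n)"
    proof (rule Lim_emeasure_incseq)
      show "range A \<subseteq> sets \<nu>" unfolding A_def using opn fC by (auto intro!: open_UN)
      show "incseq A" unfolding A_def incseq_def by (intro allI impI UN_mono) auto
    qed
    moreover have "emeasure \<nu> (A n) \<le> ennreal e" for n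
      using fin[of "from_nat_into ?C ` {..n}"] fC by (auto simp: A_def)
    ultimately show ?thesis using LIMSEQ_le_const2 by metis
  qed simp
  have null: "emeasure \<nu>' N = 0" if N: "N \<in> null_sets lborel" for N
  proof -
    have Nb: "N \<in> sets borel" using N by auto
    have "emeasure \<nu> (N \<inter> {p<..<q}) \<le> 0"
    proof (rule ennreal_le_epsilon)
      fix e :: real assume e: "0 < e"
      obtain d where d: "d > 0" and *: "\<And>D. D \<in> interval_families p q \<Longrightarrow>
         (\<Sum>(x, y)\<in>D. y - x) < d \<Longrightarrow> (\<Sum>(x, y)\<in>D. \<bar>G y - G x\<bar>) < e"
        using ac e unfolding abs_cont_on_altdef by meson
      obtain U where U: "open U" "N \<subseteq> U" "emeasure lborel (U - N) < d"
        using outer_regular_lborel[OF Nb d] .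
      have "emeasure lborel (U \<inter> {p<..<q}) \<le> emeasure lborel ((U - N) \<union> N)"
        using U Nb by (intro emeasure_mono) auto
      also have "\<dots> \<le> emeasure lborel (U - N) + emeasure lborel N"
        using U Nb by (intro emeasure_subadditive) auto
      also have "\<dots> < d" using U(3) N by auto
      finally have "emeasure lborel (U \<inter> {p<..<q}) < ennreal d" .
      then have "emeasure \<nu> (U \<inter> {p<..<q}) \<le> ennreal e"
        using U d e * by (intro small) auto
      moreover have "emeasure \<nu> (N \<inter> {p<..<q}) \<le> emeasure \<nu> (U \<inter> {p<..<q})"
        using U Nb by (intro emeasure_mono) auto
      ultimately show "emeasure \<nu> (N \<inter> {p<..<q}) \<le> 0 + ennreal e" by simp
    qed
    moreover have "emeasure \<nu> (N \<inter> {p<..q}) \<le> emeasure \<nu> ((N \<inter> {p<..<q}) \<union> {q})"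
      using Nb by (intro emeasure_mono) auto
    moreover have "\<dots> \<le> emeasure \<nu> (N \<inter> {p<..<q}) + emeasure \<nu> {q}"
      using Nb by (intro emeasure_subadditive) auto
    ultimately show ?thesis using pt \<nu>'[OF Nb] by simp
  qed
  have "absolutely_continuous lborel \<nu>'"
    unfolding absolutely_continuous_def
  proof
    fix N :: "real set" assume "N \<in> null_sets lborel"
    then show "N \<in> null_sets \<nu>'" using null[of N] by (auto simp: null_sets_def \<nu>'_def)
  qed
  moreover have "sets \<nu>' = sets lborel" by (simp add: \<nu>'_def)
  ultimately obtain f where f: "f \<in> borel_measurable lborel" "density lborel f = \<nu>'"
    using sigma_finite_measure.Radon_Nikodym[OF sigma_finite_lborel] by blast
  have fx: "(\<integral>\<^sup>+y. f y * indicator {p..x} y \<partial>lborel) = ennreal (G x - G p)" if x: "x \<in> {p..q}" for x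
  proof -
    have "(\<integral>\<^sup>+y. f y * indicator {p..x} y \<partial>lborel) = emeasure \<nu>' {p..x}"
      using f by (subst f(2)[symmetric], subst emeasure_density) auto
    also have "\<dots> = emeasure \<nu> {p<..x}"
    proof -
      have "{p..x} \<inter> {p<..q} = {p<..x}" using x by auto
      then show ?thesis by (simp add: \<nu>')
    qed
    also have "\<dots> = ennreal (G x - G p)" using x Ioc[of p x] Feq[of x] Feq[of p] by auto
    finally show ?thesis .
  qed
  have AEfin: "AE y in lborel. f y * indicator {p..q} y \<noteq> \<infinity>"
    using f fx[of q] pq by (intro nn_integral_PInf_AE) auto
  \<comment> \<open>The density is finite almost everywhere on \<open>{p..q}\<close>, its integral
    there being finite, so the real-valued version has the same integrals.\<close>
  define g where "g y = enn2real (f y * indicator {p..q} y)" for y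
  have "(g has_integral (G x - G p)) {p..x}" if x: "x \<in> {p..q}" for x
  proof -
    have "((\<lambda>y. g y * indicator {p..x} y) has_integral (G x - G p)) UNIV"
    proof (rule nn_integral_has_integral)
      show "(\<lambda>y. g y * indicator {p..x} y) \<in> borel_measurable borel" using f unfolding g_def by measurable
      show "0 \<le> g y * indicator {p..x} y" for y by (simp add: g_def)
      show "0 \<le> G x - G p" using mono_onD[OF mono, of p x] x by auto
      show "(\<integral>\<^sup>+y. ennreal (g y * indicator {p..x} y) \<partial>lborel) = ennreal (G x - G p)"
        unfolding fx[OF x, symmetric]
      proof (rule nn_integral_cong_AE, use AEfin in eventually_elim)
        fix y assume "f y * indicator {p..q} y \<noteq> \<infinity>"
        then show "ennreal (g y * indicator {p..x} y) = f y * indicator {p..x} y"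
          using x by (auto simp: g_def indicator_def less_top[symmetric])
      qed
    qed
    moreover have "(\<lambda>y. g y * indicator {p..x} y) = (\<lambda>y. if y \<in> {p..x} then g y else 0)" by auto
    ultimately show ?thesis by (simp only: has_integral_restrict_UNIV)
  qed
  moreover have "0 \<le> g y" for y by (simp add: g_def)
  ultimately show ?thesis using that by blast
qed

section \<open>Differentiation of indefinite integrals\<close>

lemma indefinite_integral_derivative:
  fixes f U :: "real \<Rightarrow> real"
  assumes U: "\<And>x. x \<in> {p..q} \<Longrightarrow> (f has_integral (U x - U p)) {p..x}"
  obtains N where "negligible N" "\<And>x. x \<in> {p<..<q} - N \<Longrightarrow> (U has_real_derivative f x) (at x)"
proof (cases "p < q")
  case False
  then show ?thesis using that[of "{}"] by auto
next
  case True
  define f0 where "f0 x = (if x \<in> {p..q} then f x else 0)" for x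
  \<comment> \<open>The averages in \<open>integrable_ccontinuous_explicit\<close> extend to the
    right of a point. Reflection turns left averages into right ones, so \<open>f0\<close> and
    \<open>f1\<close> together give the two-sided derivative.\<close>
  define f1 where "f1 x = f0 (- x)" for x
  have f0U: "(f0 has_integral (U q - U p)) UNIV"
    using U[of q] True unfolding f0_def by (subst has_integral_restrict_UNIV) auto
  have int0: "f0 integrable_on cbox a b" for a b
    using f0U integrable_on_subcbox[of f0 UNIV] by (auto simp: integrable_on_def)
  have int1: "f1 integrable_on cbox a b" for a b
  proof -
    have "f0 integrable_on {-b..-a}" using int0[of "-b" "-a"] by simp
    then have "(\<lambda>x. f0 (- x)) integrable_on {- (-a)..-(-b)}" unfolding integrable_on_def has_integral_reflect_real .
    then show ?thesis by (simp add: f1_def[abs_def])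
  qed
  have f0: "(f0 has_integral (U y - U x)) {x..y}" if "p \<le> x" "x \<le> y" "y \<le> q" for x y
  proof -
    have "(f0 has_integral (U y - U p)) {p..y}" if "y \<in> {p..q}" for y
      using U[OF that] by (rule has_integral_eq[rotated]) (use that in \<open>auto simp: f0_def\<close>)
    then have "integral {p..x} f0 = U x - U p" "integral {p..y} f0 = U y - U p" "f0 integrable_on {p..y}"
      using that int0[of p y] by (auto intro!: integral_unique)
    then have "integral {x..y} f0 = U y - U x"
      using Henstock_Kurzweil_Integration.integral_combine[of p x y f0] that by simp
    then show ?thesis using int0[of x y] by (simp add: has_integral_integral)
  qed
  obtain N0 where N0: "negligible N0" "\<And>x e. \<lbrakk>x \<notin> N0; 0 < e\<rbrakk> \<Longrightarrow>
     \<exists>d>0. \<forall>h. 0 < h \<and> h < d \<longrightarrow> norm(integral (cbox x (x + h *\<^sub>R One)) f0 /\<^sub>R h ^ DIM(real) - f0 x) < e"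
    using integrable_ccontinuous_explicit[of f0] int0 by blast
  obtain N1 where N1: "negligible N1" "\<And>x e. \<lbrakk>x \<notin> N1; 0 < e\<rbrakk> \<Longrightarrow>
     \<exists>d>0. \<forall>h. 0 < h \<and> h < d \<longrightarrow> norm(integral (cbox x (x + h *\<^sub>R One)) f1 /\<^sub>R h ^ DIM(real) - f1 x) < e"
    using integrable_ccontinuous_explicit[of f1] int1 by blast
  let ?N = "N0 \<union> uminus ` N1"
  have "negligible ?N"
    using N0(1) N1(1) by (intro negligible_Un negligible_differentiable_image_negligible[OF order_refl]) (auto intro!: derivative_intros)
  moreover have "(U has_real_derivative f x) (at x)" if x: "x \<in> {p<..<q} - ?N" for x
    unfolding has_field_derivative_iff LIM_def
  proof (intro allI impI)
    fix e :: real assume e: "0 < e"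
    have "x \<notin> N0" "- x \<notin> N1" using x by force+
    obtain d0 where d0: "d0 > 0" "\<And>h. 0 < h \<Longrightarrow> h < d0 \<Longrightarrow> \<bar>integral {x..x+h} f0 / h - f0 x\<bar> < e"
      using N0(2)[OF \<open>x \<notin> N0\<close> e] by (auto simp: divide_inverse mult.commute)
    obtain d1 where d1: "d1 > 0" "\<And>h. 0 < h \<Longrightarrow> h < d1 \<Longrightarrow> \<bar>integral {-x..-x+h} f1 / h - f1 (-x)\<bar> < e"
      using N1(2)[OF \<open>- x \<notin> N1\<close> e] by (auto simp: divide_inverse mult.commute)
    define d where "d = Min {d0, d1, x - p, q - x}"
    have d: "d > 0" "d \<le> d0" "d \<le> d1" "d \<le> x - p" "d \<le> q - x" using d0(1) d1(1) x by (auto simp: d_def)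
    have fx: "f0 x = f x" "f1 (- x) = f x" using x by (auto simp: f0_def f1_def)
    have "dist ((U y - U x) / (y - x)) (f x) < e" if y: "y \<noteq> x" "dist y x < d" for y
    proof (cases "x < y")
      case True
      have "integral {x..x+(y-x)} f0 = U y - U x"
        using f0[of x y] x y d True by (intro integral_unique) (auto simp: dist_real_def)
      then show ?thesis using d0(2)[of "y - x"] True y d fx by (auto simp: dist_real_def)
    next
      case False
      then have yx: "y < x" using y by simp
      have "(f0 has_integral (U x - U y)) {y..x}"
        using f0[of y x] x y d yx by (auto simp: dist_real_def)
      then have "(f1 has_integral (U x - U y)) {-x..-y}"
        unfolding f1_def by simp
      then have "integral {-x..-x+(x-y)} f1 = U x - U y" by (intro integral_unique) auto
      moreover have "(U x - U y) / (x - y) = (U y - U x) / (y - x)" using yx by (simp add: field_simps)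
      ultimately show ?thesis using d1(2)[of "x - y"] yx y d fx by (auto simp: dist_real_def)
    qed
    then show "\<exists>s>0. \<forall>xa. xa \<noteq> x \<and> dist xa x < s \<longrightarrow> dist ((U xa - U x) / (xa - x)) (f x) < e"
      using d(1) by blast
  qed
  ultimately show ?thesis using that by blast
qed

text \<open>On intervals shorter than the modulus \<open>d\<close> for \<epsilon> = 1 all increment
  sums stay below 1, so the positive variation is finite and \<open>u\<close> is a difference of two
  increasing absolutely continuous functions with densities \<open>f\<close> and \<open>g\<close>.
  Then \<open>deriv u\<close> is \<open>f - g\<close> almost everywhere, and finitely many such
  intervals are glued.\<close>

theorem abs_cont_on_deriv_has_integral:
  assumes ac: "abs_cont_on p q u" and pq: "p \<le> q"
  shows "deriv u absolutely_integrable_on {p..q}" "(deriv u has_integral (u q - u p)) {p..q}"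
proof -
  obtain d where d: "d > 0" and *: "\<And>D. D \<in> interval_families p q \<Longrightarrow>
     (\<Sum>(x, y)\<in>D. y - x) < d \<Longrightarrow> (\<Sum>(x, y)\<in>D. \<bar>u y - u x\<bar>) < 1"
    using ac unfolding abs_cont_on_altdef by (meson zero_less_one)
  have short: "deriv u absolutely_integrable_on {x..y} \<and> (deriv u has_integral (u y - u x)) {x..y}"
    if xy: "p \<le> x" "x < y" "y \<le> q" "y - x < d" for x y
  proof -
    have acx: "abs_cont_on x y u" using abs_cont_on_subinterval[OF ac] xy by blast
    have "(\<Sum>(s, t)\<in>D. u t - u s) \<le> 1" if D: "D \<in> interval_families x y" for D
    proof -
      have "(\<Sum>(s, t)\<in>D. \<bar>u t - u s\<bar>) < 1"
        using *[of D] D interval_families_mono[of p x y q] interval_families_length_le[OF D] xy by (auto simp: subset_iff)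
      moreover have "(\<Sum>(s, t)\<in>D. u t - u s) \<le> (\<Sum>(s, t)\<in>D. \<bar>u t - u s\<bar>)" by (intro sum_mono) auto
      ultimately show ?thesis by linarith
    qed
    note P = abs_cont_on_pos_variation[OF acx less_imp_le[OF xy(2)] this]
    obtain f where f: "\<And>z. 0 \<le> f z" "\<And>z. z \<in> {x..y} \<Longrightarrow> (f has_integral (pos_variation u x z - pos_variation u x x)) {x..z}"
      using mono_abs_cont_density[OF P(3,1) xy(2)] by blast
    obtain g where g: "\<And>z. 0 \<le> g z" "\<And>z. z \<in> {x..y} \<Longrightarrow>
        (g has_integral ((pos_variation u x z - u z) - (pos_variation u x x - u x))) {x..z}"
      using mono_abs_cont_density[OF abs_cont_on_diff[OF P(3) acx] P(2) xy(2)] by blast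
    let ?h = "\<lambda>z. f z - g z"
    have h: "(?h has_integral (u z - u x)) {x..z}" if "z \<in> {x..y}" for z
      using has_integral_diff[OF f(2) g(2), OF that that] by simp
    obtain N where N: "negligible N" "\<And>z. z \<in> {x<..<y} - N \<Longrightarrow> (u has_real_derivative ?h z) (at z)"
      using indefinite_integral_derivative[OF h] by blast
    have "f absolutely_integrable_on {x..y}" "g absolutely_integrable_on {x..y}"
      using f(1) f(2)[of y] g(1) g(2)[of y] xy by (auto intro!: nonnegative_absolutely_integrable_1 simp: integrable_on_def)
    then have "?h absolutely_integrable_on {x..y}" by (rule set_integral_diff)
    moreover have negl: "negligible (N \<union> {x, y})" using N(1) by auto
    moreover have eq: "deriv u z = ?h z" if "z \<in> {x..y} - (N \<union> {x, y})" for z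
      using N(2)[of z] that by (auto intro!: DERIV_imp_deriv)
    ultimately have "deriv u absolutely_integrable_on {x..y}"
      by (subst absolutely_integrable_spike_eq[OF negl]) auto
    moreover have "(deriv u has_integral (u y - u x)) {x..y}"
      using h[of y] xy by (intro has_integral_spike[OF negl eq]) auto
    ultimately show ?thesis by blast
  qed
  \<comment> \<open>Induction over the number of steps of length \<open>d/2\<close>; each newly
    added piece has length at most \<open>d/2\<close>, hence below \<open>d\<close>.\<close>
  have "deriv u absolutely_integrable_on {p..x} \<and> (deriv u has_integral (u x - u p)) {p..x}"
    if "p \<le> x" "x \<le> q" "x - p \<le> real n * (d/2)" for n x
    using that
  proof (induction n arbitrary: x)
    case 0
    then have "x = p" by simp
    then show ?case using absolutely_integrable_negligible[of "{p}"] has_integral_refl(2)[of "deriv u" p] by simp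
  next
    case (Suc n)
    show ?case
    proof (cases "x - p \<le> real n * (d/2)")
      case True
      then show ?thesis using Suc by blast
    next
      case False
      define y where "y = p + real n * (d/2)"
      have y: "p \<le> y" "y < x" "x - y < d" using False Suc.prems d by (auto simp: y_def algebra_simps)
      have 1: "deriv u absolutely_integrable_on {p..y} \<and> (deriv u has_integral (u y - u p)) {p..y}"
        using Suc.IH[of y] y Suc.prems by (auto simp: y_def)
      have 2: "deriv u absolutely_integrable_on {y..x} \<and> (deriv u has_integral (u x - u y)) {y..x}"
        using short[of y x] y Suc.prems by auto
      have "(deriv u has_integral ((u y - u p) + (u x - u y))) {p..x}"
        using 1 2 y by (intro has_integral_combine[of p y x]) auto
      moreover have "{p..x} = {p..y} \<union> {y..x}" using y by auto
      ultimately show ?thesis using 1 2 by (auto intro!: absolutely_integrable_Un)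
    qed
  qed
  moreover obtain n :: nat where "(q - p) / (d/2) \<le> real n" using real_arch_simple by blast
  ultimately have "deriv u absolutely_integrable_on {p..q} \<and> (deriv u has_integral (u q - u p)) {p..q}"
    using pq d by (simp add: field_simps)
  then show "deriv u absolutely_integrable_on {p..q}" "(deriv u has_integral (u q - u p)) {p..q}" by auto
qed

section \<open>Square integrable functions and translations\<close>

text \<open>Stated for an arbitrary measure: the inequalities serve \<open>lborel\<close>, where
  Fubini and translations are available, as well as \<open>lebesgue_on\<close> of the cylinder and
  of \<open>Omega\<close>, where the problem lives.\<close>

definition square_integrable :: "'a measure \<Rightarrow> ('a \<Rightarrow> real) \<Rightarrow> bool" where
  "square_integrable M f \<longleftrightarrow> f \<in> borel_measurable M \<and> integrable M (\<lambda>x. (f x)\<^sup>2)"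

lemma square_integrable_measurable [measurable_dest]: "square_integrable M f \<Longrightarrow> f \<in> borel_measurable M"
  by (simp add: square_integrable_def)

lemma square_integrable_integrable: "square_integrable M f \<Longrightarrow> integrable M (\<lambda>x. (f x)\<^sup>2)"
  by (simp add: square_integrable_def)

lemma square_integrable_mult:
  assumes f: "square_integrable M f" and g: "square_integrable M g"
  shows "integrable M (\<lambda>x. f x * g x)"
proof (rule Bochner_Integration.integrable_bound)
  show "integrable M (\<lambda>x. (f x)\<^sup>2 + (g x)\<^sup>2)"
    using f g by (auto simp: square_integrable_def)
  show "(\<lambda>x. f x * g x) \<in> borel_measurable M"
    using f g by (auto simp: square_integrable_def)
  have "\<bar>f x * g x\<bar> \<le> (f x)\<^sup>2 + (g x)\<^sup>2" for x
    using sum_squares_bound[of "\<bar>f x\<bar>" "\<bar>g x\<bar>"] by (simp add: abs_mult mult.assoc) (smt (verit) abs_ge_zero zero_le_mult_iff)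
  then show "AE x in M. norm (f x * g x) \<le> norm ((f x)\<^sup>2 + (g x)\<^sup>2)" by simp
qed

lemma square_integrable_add:
  assumes f: "square_integrable M f" and g: "square_integrable M g"
  shows "square_integrable M (\<lambda>x. f x + g x)"
  unfolding square_integrable_def
proof
  show "(\<lambda>x. f x + g x) \<in> borel_measurable M" using f g by (auto simp: square_integrable_def)
  have "integrable M (\<lambda>x. (f x)\<^sup>2 + (g x)\<^sup>2 + 2 * (f x * g x))"
    using f g square_integrable_mult[OF f g] by (auto simp: square_integrable_def)
  moreover have "(\<lambda>x. (f x + g x)\<^sup>2) = (\<lambda>x. (f x)\<^sup>2 + (g x)\<^sup>2 + 2 * (f x * g x))"
    by (auto simp: power2_eq_square algebra_simps)
  ultimately show "integrable M (\<lambda>x. (f x + g x)\<^sup>2)" by simp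
qed

lemma square_integrable_mult_bounded:
  assumes f: "square_integrable M f" and c: "c \<in> borel_measurable M" "AE x in M. \<bar>c x\<bar> \<le> B"
  shows "square_integrable M (\<lambda>x. c x * f x)"
  unfolding square_integrable_def
proof
  show m: "(\<lambda>x. c x * f x) \<in> borel_measurable M" using f c by (auto simp: square_integrable_def)
  show "integrable M (\<lambda>x. (c x * f x)\<^sup>2)"
  proof (rule Bochner_Integration.integrable_bound)
    show "integrable M (\<lambda>x. B\<^sup>2 * (f x)\<^sup>2)" using f by (simp add: square_integrable_def)
    show "AE x in M. norm ((c x * f x)\<^sup>2) \<le> norm (B\<^sup>2 * (f x)\<^sup>2)"
      using c(2)
    proof eventually_elim
      fix x assume "\<bar>c x\<bar> \<le> B"
      then have "(c x)\<^sup>2 \<le> B\<^sup>2" by (metis abs_le_square_iff abs_of_nonneg abs_ge_zero order_trans)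
      then show "norm ((c x * f x)\<^sup>2) \<le> norm (B\<^sup>2 * (f x)\<^sup>2)" by (simp add: power_mult_distrib mult_right_mono)
    qed
  qed (use m in measurable)
qed

lemma square_integrable_cmult: "square_integrable M f \<Longrightarrow> square_integrable M (\<lambda>x. c * f x)"
  by (auto simp: square_integrable_def power_mult_distrib)

lemma square_integrable_diff:
  assumes f: "square_integrable M f" and g: "square_integrable M g"
  shows "square_integrable M (\<lambda>x. f x - g x)"
  using square_integrable_add[OF f square_integrable_cmult[OF g, of "-1"]] by simp

text \<open>The integral of \<open>(s f + g)^2\<close> is a nonnegative quadratic in
  \<open>s\<close>. If its leading coefficient is positive, its value at the minimiser gives the
  claim; if it is 0, the remaining linear function must be constant.\<close>

lemma Cauchy_Schwarz_integral:
  assumes f: "square_integrable M f" and g: "square_integrable M g"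
  shows "(\<integral>x. f x * g x \<partial>M)\<^sup>2 \<le> (\<integral>x. (f x)\<^sup>2 \<partial>M) * (\<integral>x. (g x)\<^sup>2 \<partial>M)"
proof -
  let ?A = "\<integral>x. (f x)\<^sup>2 \<partial>M" and ?B = "\<integral>x. f x * g x \<partial>M" and ?C = "\<integral>x. (g x)\<^sup>2 \<partial>M"
  have int: "integrable M (\<lambda>x. (f x)\<^sup>2)" "integrable M (\<lambda>x. (g x)\<^sup>2)" "integrable M (\<lambda>x. f x * g x)"
    using f g square_integrable_mult[OF f g] by (auto simp: square_integrable_def)
  have q: "0 \<le> s\<^sup>2 * ?A + 2 * s * ?B + ?C" for s
  proof -
    have "0 \<le> (\<integral>x. (s * f x + g x)\<^sup>2 \<partial>M)" by simp
    also have "(\<lambda>x. (s * f x + g x)\<^sup>2) = (\<lambda>x. s\<^sup>2 * (f x)\<^sup>2 + 2 * s * (f x * g x) + (g x)\<^sup>2)"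
      by (auto simp: power2_eq_square algebra_simps)
    finally show ?thesis using int by simp
  qed
  show ?thesis
  proof (cases "?A = 0")
    case True
    have "?B = 0"
    proof (rule ccontr)
      assume "?B \<noteq> 0"
      then have "2 * (- (?C + 1) / (2 * ?B)) * ?B + ?C = -1" by (simp add: field_simps)
      then show False using q[of "- (?C + 1) / (2 * ?B)"] True by simp
    qed
    then show ?thesis using True by simp
  next
    case False
    then have A: "?A > 0" by (simp add: less_le)
    have "0 \<le> (- ?B / ?A)\<^sup>2 * ?A + 2 * (- ?B / ?A) * ?B + ?C" by (rule q)
    also have "\<dots> = ?C - ?B\<^sup>2 / ?A" using A by (simp add: field_simps power2_eq_square)
    finally show ?thesis using A by (simp add: field_simps)
  qed
qed

lemma Cauchy_Schwarz_integral_abs: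
  assumes f: "square_integrable M f" and g: "square_integrable M g"
  shows "(\<integral>x. \<bar>f x * g x\<bar> \<partial>M) \<le> sqrt (\<integral>x. (f x)\<^sup>2 \<partial>M) * sqrt (\<integral>x. (g x)\<^sup>2 \<partial>M)"
proof -
  have "square_integrable M (\<lambda>x. \<bar>f x\<bar>)" "square_integrable M (\<lambda>x. \<bar>g x\<bar>)"
    using f g by (auto simp: square_integrable_def)
  from Cauchy_Schwarz_integral[OF this]
  have "(\<integral>x. \<bar>f x * g x\<bar> \<partial>M)\<^sup>2 \<le> (\<integral>x. (f x)\<^sup>2 \<partial>M) * (\<integral>x. (g x)\<^sup>2 \<partial>M)"
    by (simp add: abs_mult)
  from real_sqrt_le_mono[OF this] show ?thesis by (simp add: real_sqrt_mult)
qed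

section \<open>Approximation and translations in L2\<close>

lemma integrable_const_on_ball:
  "integrable lborel (\<lambda>x::'a::euclidean_space. c * indicator (cball 0 R) x :: real)"
  by (intro integrable_mult_right integrable_real_indicator) (use emeasure_bounded_finite[OF bounded_cball] in auto)

lemma translation_lborel:
  fixes f :: "'a::euclidean_space \<Rightarrow> real"
  assumes [measurable]: "f \<in> borel_measurable borel"
  shows "integrable lborel (\<lambda>x. f (x + h)) \<longleftrightarrow> integrable lborel f"
    and "(\<integral>x. f (x + h) \<partial>lborel) = (\<integral>x. f x \<partial>lborel)"
proof -
  have "integrable (distr lborel borel ((+) h)) f \<longleftrightarrow> integrable lborel (\<lambda>x. f (h + x))"
    by (subst integrable_distr_eq) auto
  then show "integrable lborel (\<lambda>x. f (x + h)) \<longleftrightarrow> integrable lborel f"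
    by (simp add: lborel_distr_plus add.commute)
  have "(\<integral>x. f x \<partial>distr lborel borel ((+) h)) = (\<integral>x. f (h + x) \<partial>lborel)"
    by (subst integral_distr) auto
  then show "(\<integral>x. f (x + h) \<partial>lborel) = (\<integral>x. f x \<partial>lborel)"
    by (simp add: lborel_distr_plus add.commute)
qed

lemma square_integrable_translation:
  "square_integrable lborel (f :: 'a::euclidean_space \<Rightarrow> real) \<Longrightarrow> square_integrable lborel (\<lambda>x. f (x + h))"
  unfolding square_integrable_def using translation_lborel(1)[of "\<lambda>x. (f x)\<^sup>2" h] by auto

text \<open>A measurable function is an almost everywhere limit of continuous functions
  \<open>g n\<close>. Clamping their values between \<open>- B\<close> and \<open>B\<close> and
  multiplying by a cutoff supported in the ball of radius \<open>R + 1\<close> keeps the limit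
  \<open>f\<close> and provides a dominating function.\<close>

lemma square_integrable_approx_bounded:
  fixes f :: "'a::euclidean_space \<Rightarrow> real"
  assumes f: "f \<in> borel_measurable borel" "\<And>x. \<bar>f x\<bar> \<le> B" "\<And>x. R < norm x \<Longrightarrow> f x = 0" and e: "e > 0"
  obtains g where "continuous_on UNIV g" "\<And>x. \<bar>g x\<bar> \<le> B" "\<And>x. R + 1 < norm x \<Longrightarrow> g x = 0"
    "(\<integral>x. (f x - g x)\<^sup>2 \<partial>lborel) < e"
proof -
  have "f measurable_on UNIV"
    using f(1) by (intro lebesgue_measurable_imp_measurable_on measurable_completion) auto
  then obtain N g where N: "negligible N" and gc: "\<And>n. continuous_on UNIV (g n)"
    and gf: "\<And>x. x \<notin> N \<Longrightarrow> (\<lambda>n. g n x) \<longlonglongrightarrow> f x"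
    unfolding measurable_on_def by auto
  have B: "0 \<le> B" using f(2)[of 0] by linarith
  define cut where "cut x = max 0 (min 1 (R + 1 - norm x))" for x :: 'a
  define k where "k n x = cut x * max (- B) (min B (g n x))" for n x
  have kc: "continuous_on UNIV (k n)" for n
    unfolding k_def cut_def by (intro continuous_intros gc)
  have kB: "\<bar>k n x\<bar> \<le> B" for n x
  proof -
    have "\<bar>k n x\<bar> \<le> 1 * B" unfolding k_def abs_mult using B by (intro mult_mono) (auto simp: cut_def)
    then show ?thesis by simp
  qed
  have k0: "k n x = 0" if "R + 1 < norm x" for n x using that by (simp add: k_def cut_def)
  have km[measurable]: "k n \<in> borel_measurable borel" for n by (rule borel_measurable_continuous_onI[OF kc])
  have "(\<lambda>n. \<integral>x. (f x - k n x)\<^sup>2 \<partial>lborel) \<longlonglongrightarrow> (\<integral>x. 0 \<partial>(lborel :: 'a measure))"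
  proof (rule integral_dominated_convergence[where w = "\<lambda>x. (2 * B)\<^sup>2 * indicator (cball 0 (R + 1)) x"])
    show "integrable lborel (\<lambda>x::'a. (2 * B)\<^sup>2 * indicator (cball 0 (R + 1)) x)" by (rule integrable_const_on_ball)
    have "N \<in> null_sets lebesgue" using N by (simp add: negligible_iff_null_sets)
    then have "AE x in lebesgue. x \<notin> N" by (rule AE_not_in)
    then have "AE x in lborel. x \<notin> N" by (simp add: AE_completion_iff)
    then show "AE x in lborel. (\<lambda>n. (f x - k n x)\<^sup>2) \<longlonglongrightarrow> 0"
    proof eventually_elim
      fix x assume "x \<notin> N"
      then have "(\<lambda>n. (f x - k n x)\<^sup>2) \<longlonglongrightarrow> (f x - cut x * max (- B) (min B (f x)))\<^sup>2"
        unfolding k_def by (intro tendsto_intros gf)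
      moreover have "cut x * max (- B) (min B (f x)) = f x"
      proof (cases "R < norm x")
        case False
        then show ?thesis using f(2)[of x] by (auto simp: cut_def max_def min_def)
      qed (use f(3) B in \<open>simp add: max_def min_def\<close>)
      ultimately show "(\<lambda>n. (f x - k n x)\<^sup>2) \<longlonglongrightarrow> 0" by simp
    qed
    show "AE x in lborel. norm ((f x - k n x)\<^sup>2) \<le> (2 * B)\<^sup>2 * indicator (cball 0 (R + 1)) x" for n
    proof (rule AE_I2)
      fix x
      show "norm ((f x - k n x)\<^sup>2) \<le> (2 * B)\<^sup>2 * indicator (cball 0 (R + 1)) x"
      proof (cases "R + 1 < norm x")
        case False
        have "\<bar>f x - k n x\<bar> \<le> 2 * B" using f(2)[of x] kB[of n x] by linarith
        then have "(f x - k n x)\<^sup>2 \<le> (2 * B)\<^sup>2" using abs_le_square_iff[of "f x - k n x" "2 * B"] B by simp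
        then show ?thesis using False by simp
      qed (use f(3) k0 in simp)
    qed
  qed (use f in auto)
  then have "(\<lambda>n. \<integral>x. (f x - k n x)\<^sup>2 \<partial>lborel) \<longlonglongrightarrow> 0" by simp
  then have "eventually (\<lambda>n. (\<integral>x. (f x - k n x)\<^sup>2 \<partial>lborel) < e) sequentially"
    using e by (rule order_tendstoD)
  then obtain n where "(\<integral>x. (f x - k n x)\<^sup>2 \<partial>lborel) < e" unfolding eventually_sequentially by blast
  then show ?thesis using that[of "k n"] kc kB k0 by blast
qed

lemma square_sum3: "(a + b + c)\<^sup>2 \<le> 3 * (a\<^sup>2 + b\<^sup>2 + c\<^sup>2)" for a b c :: real
proof -
  have "3 * (a\<^sup>2 + b\<^sup>2 + c\<^sup>2) - (a + b + c)\<^sup>2 = (a - b)\<^sup>2 + (b - c)\<^sup>2 + (a - c)\<^sup>2"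
    by (simp add: power2_eq_square algebra_simps)
  then show ?thesis by (smt (verit) zero_le_power2)
qed

lemma square_sum2: "(a + b)\<^sup>2 \<le> 2 * (a\<^sup>2 + b\<^sup>2)" for a b :: real
  using sum_squares_bound[of a b] by (simp add: power2_sum)

text \<open>Truncating \<open>f\<close> both in value and in support reduces to the bounded case;
  the two errors of \<open>e/4\<close> combine through \<open>square_sum2\<close>.\<close>

lemma square_integrable_approx:
  fixes f :: "'a::euclidean_space \<Rightarrow> real"
  assumes f: "square_integrable lborel f" and e: "e > 0"
  obtains g B R where "continuous_on UNIV g" "\<And>x. \<bar>g x\<bar> \<le> B" "\<And>x. R < norm x \<Longrightarrow> g x = 0"
    "(\<integral>x. (f x - g x)\<^sup>2 \<partial>lborel) < e"
proof -
  note [measurable] = square_integrable_measurable[OF f, simplified]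
  define t where "t n x = f x * indicator {x. norm x \<le> real n \<and> \<bar>f x\<bar> \<le> real n} x" for n x
  have t[measurable]: "t n \<in> borel_measurable borel" for n unfolding t_def by measurable
  have "(\<lambda>n. \<integral>x. (f x - t n x)\<^sup>2 \<partial>lborel) \<longlonglongrightarrow> (\<integral>x. 0 \<partial>(lborel :: 'a measure))"
  proof (rule integral_dominated_convergence[where w = "\<lambda>x. (f x)\<^sup>2"])
    show "integrable lborel (\<lambda>x. (f x)\<^sup>2)" using f by (rule square_integrable_integrable)
    show "AE x in lborel. (\<lambda>n. (f x - t n x)\<^sup>2) \<longlonglongrightarrow> 0"
    proof (rule AE_I2)
      fix x
      obtain m :: nat where m: "max (norm x) \<bar>f x\<bar> \<le> real m" using real_arch_simple by blast
      have "eventually (\<lambda>n. (f x - t n x)\<^sup>2 = 0) sequentially"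
        using eventually_ge_at_top[of m] by eventually_elim (use m in \<open>auto simp: t_def\<close>)
      then show "(\<lambda>n. (f x - t n x)\<^sup>2) \<longlonglongrightarrow> 0" by (rule tendsto_eventually)
    qed
    show "AE x in lborel. norm ((f x - t n x)\<^sup>2) \<le> (f x)\<^sup>2" for n
      by (auto simp: t_def indicator_def)
  qed (use f in auto)
  then have "eventually (\<lambda>n. (\<integral>x. (f x - t n x)\<^sup>2 \<partial>lborel) < e/4) sequentially"
    using e by (intro order_tendstoD) auto
  then obtain n where n: "(\<integral>x. (f x - t n x)\<^sup>2 \<partial>lborel) < e/4" unfolding eventually_sequentially by blast
  obtain g where g: "continuous_on UNIV g" "\<And>x. \<bar>g x\<bar> \<le> real n" "\<And>x. real n + 1 < norm x \<Longrightarrow> g x = 0"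
    "(\<integral>x. (t n x - g x)\<^sup>2 \<partial>lborel) < e/4"
  proof (rule square_integrable_approx_bounded[of "t n" "real n" "real n" "e/4"])
    show "\<bar>t n x\<bar> \<le> real n" for x by (auto simp: t_def indicator_def)
  qed (use e in \<open>auto simp: t_def\<close>)
  have [measurable]: "g \<in> borel_measurable borel" by (rule borel_measurable_continuous_onI[OF g(1)])
  have bnd: "integrable lborel (\<lambda>x. (w x)\<^sup>2)" if [measurable]: "w \<in> borel_measurable borel"
    and "\<And>x. \<bar>w x\<bar> \<le> real n" "\<And>x. real n + 1 < norm x \<Longrightarrow> w x = 0" for w :: "'a \<Rightarrow> real"
  proof (rule Bochner_Integration.integrable_bound[OF integrable_const_on_ball[of "(real n)\<^sup>2" "real n + 1"]])
    show "AE x in lborel. norm ((w x)\<^sup>2) \<le> norm ((real n)\<^sup>2 * indicator (cball 0 (real n + 1)) x :: real)"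
    proof (rule AE_I2)
      fix x show "norm ((w x)\<^sup>2) \<le> norm ((real n)\<^sup>2 * indicator (cball 0 (real n + 1)) x :: real)"
        using that(3)[of x] abs_le_square_iff[of "w x" "real n"] that(2)[of x] by (cases "real n + 1 < norm x") auto
    qed
  qed auto
  have sg: "square_integrable lborel g" using bnd[of g] g by (auto simp: square_integrable_def)
  have st: "square_integrable lborel (t n)"
    using bnd[of "t n"] by (auto simp: square_integrable_def t_def indicator_def)
  have "(\<integral>x. (f x - g x)\<^sup>2 \<partial>lborel) \<le> (\<integral>x. 2 * ((f x - t n x)\<^sup>2 + (t n x - g x)\<^sup>2) \<partial>lborel)"
  proof (rule integral_mono)
    show "integrable lborel (\<lambda>x. (f x - g x)\<^sup>2)"
      "integrable lborel (\<lambda>x. 2 * ((f x - t n x)\<^sup>2 + (t n x - g x)\<^sup>2))"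
      using square_integrable_diff[OF f sg] square_integrable_diff[OF f st] square_integrable_diff[OF st sg]
      by (auto simp: square_integrable_def)
    show "(f x - g x)\<^sup>2 \<le> 2 * ((f x - t n x)\<^sup>2 + (t n x - g x)\<^sup>2)" for x
      using square_sum2[of "f x - t n x" "t n x - g x"] by simp
  qed
  also have "\<dots> = 2 * ((\<integral>x. (f x - t n x)\<^sup>2 \<partial>lborel) + (\<integral>x. (t n x - g x)\<^sup>2 \<partial>lborel))"
    using square_integrable_diff[OF f st] square_integrable_diff[OF st sg]
    by (simp add: square_integrable_def)
  also have "\<dots> < e" using add_strict_mono[OF n g(4)] by simp
  finally show ?thesis using that[OF g(1,2)] g(3) by blast
qed

text \<open>For a continuous function of compact support dominated convergence suffices, and
  translations are isometries of L2, so the approximation error is the same before and after the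
  shift. Three terms of size \<open>e/9\<close>, with the factor 3 of \<open>square_sum3\<close>,
  add up to \<open>e\<close>.\<close>

theorem translation_continuous_L2:
  fixes f :: "'a::euclidean_space \<Rightarrow> real"
  assumes f: "square_integrable lborel f" and h: "h \<longlonglongrightarrow> 0"
  shows "(\<lambda>n. \<integral>x. (f (x + h n) - f x)\<^sup>2 \<partial>lborel) \<longlonglongrightarrow> 0"
proof (rule LIMSEQ_I)
  fix e :: real assume e: "0 < e"
  note [measurable] = square_integrable_measurable[OF f, simplified]
  obtain g B R where g: "continuous_on UNIV g" "\<And>x. \<bar>g x\<bar> \<le> B" "\<And>x. R < norm x \<Longrightarrow> g x = 0"
    "(\<integral>x. (f x - g x)\<^sup>2 \<partial>lborel) < e/9"
    using square_integrable_approx[OF f, of "e/9"] e by auto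
  have [measurable]: "g \<in> borel_measurable borel" by (rule borel_measurable_continuous_onI[OF g(1)])
  have B: "0 \<le> B" using g(2)[of 0] by linarith
  have "square_integrable lborel g"
    unfolding square_integrable_def
  proof
    show "integrable lborel (\<lambda>x. (g x)\<^sup>2)"
    proof (rule Bochner_Integration.integrable_bound[OF integrable_const_on_ball[of "B\<^sup>2" R]])
      show "AE x in lborel. norm ((g x)\<^sup>2) \<le> norm (B\<^sup>2 * indicator (cball 0 R) x :: real)"
      proof (rule AE_I2)
        fix x show "norm ((g x)\<^sup>2) \<le> norm (B\<^sup>2 * indicator (cball 0 R) x :: real)"
          using g(3)[of x] abs_le_square_iff[of "g x" B] g(2)[of x] B by (cases "R < norm x") auto
      qed
    qed auto
  qed auto
  note sg = this
  have hb: "eventually (\<lambda>n. norm (h n) < 1) sequentially"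
    using tendstoD[OF h, of 1] by (simp add: dist_norm)
  obtain m where m: "\<And>n. n \<ge> m \<Longrightarrow> norm (h n) < 1" using hb unfolding eventually_sequentially by blast
  \<comment> \<open>Discarding the first \<open>m\<close> shifts leaves only shifts shorter than 1,
    so that all translates of \<open>g\<close> vanish outside one ball.\<close>
  have "(\<lambda>n. \<integral>x. (g (x + h (n + m)) - g x)\<^sup>2 \<partial>lborel) \<longlonglongrightarrow> (\<integral>x. 0 \<partial>(lborel :: 'a measure))"
  proof (rule integral_dominated_convergence[where w = "\<lambda>x. (2 * B)\<^sup>2 * indicator (cball 0 (R + 1)) x"])
    show "integrable lborel (\<lambda>x::'a. (2 * B)\<^sup>2 * indicator (cball 0 (R + 1)) x)" by (rule integrable_const_on_ball)
    show "AE x in lborel. (\<lambda>n. (g (x + h (n + m)) - g x)\<^sup>2) \<longlonglongrightarrow> 0"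
    proof (rule AE_I2)
      fix x
      have "isCont g x" using g(1) continuous_on_eq_continuous_at open_UNIV by blast
      moreover have "(\<lambda>n. x + h (n + m)) \<longlonglongrightarrow> x + 0"
        by (intro tendsto_intros LIMSEQ_ignore_initial_segment h)
      ultimately have "(\<lambda>n. g (x + h (n + m))) \<longlonglongrightarrow> g x" using isCont_tendsto_compose by fastforce
      then have "(\<lambda>n. (g (x + h (n + m)) - g x)\<^sup>2) \<longlonglongrightarrow> (g x - g x)\<^sup>2" by (intro tendsto_intros)
      then show "(\<lambda>n. (g (x + h (n + m)) - g x)\<^sup>2) \<longlonglongrightarrow> 0" by simp
    qed
    show "AE x in lborel. norm ((g (x + h (n + m)) - g x)\<^sup>2) \<le> (2 * B)\<^sup>2 * indicator (cball 0 (R + 1)) x" for n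
    proof (rule AE_I2)
      fix x
      show "norm ((g (x + h (n + m)) - g x)\<^sup>2) \<le> (2 * B)\<^sup>2 * indicator (cball 0 (R + 1)) x"
      proof (cases "R + 1 < norm x")
        case False
        have "\<bar>g (x + h (n + m)) - g x\<bar> \<le> 2 * B" using g(2)[of x] g(2)[of "x + h (n + m)"] by linarith
        then have "(g (x + h (n + m)) - g x)\<^sup>2 \<le> (2 * B)\<^sup>2"
          using abs_le_square_iff[of "g (x + h (n + m)) - g x" "2 * B"] B by simp
        then show ?thesis using False by simp
      next
        case True
        have "norm x \<le> norm (x + h (n + m)) + norm (h (n + m))"
          using norm_triangle_sub[of x "x + h (n + m)"] by (simp add: norm_minus_commute)
        then have "R < norm (x + h (n + m))" "R < norm x" using True m[of "n + m"] by auto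
        then show ?thesis using g(3) by simp
      qed
    qed
  qed auto
  then have "eventually (\<lambda>n. (\<integral>x. (g (x + h (n + m)) - g x)\<^sup>2 \<partial>lborel) < e/9) sequentially"
    using e by (intro order_tendstoD) auto
  then obtain k where k: "\<And>n. n \<ge> k \<Longrightarrow> (\<integral>x. (g (x + h (n + m)) - g x)\<^sup>2 \<partial>lborel) < e/9"
    unfolding eventually_sequentially by blast
  have "norm ((\<integral>x. (f (x + h n) - f x)\<^sup>2 \<partial>lborel) - 0) < e" if n: "n \<ge> k + m" for n
  proof -
    define c where "c = h n"
    have gk: "(\<integral>x. (g (x + c) - g x)\<^sup>2 \<partial>lborel) < e/9" using k[of "n - m"] n by (simp add: c_def)
    note fg = square_integrable_diff[OF f sg]
    have fgc: "(\<integral>x. (f (x + c) - g (x + c))\<^sup>2 \<partial>lborel) = (\<integral>x. (f x - g x)\<^sup>2 \<partial>lborel)"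
      by (rule translation_lborel(2)[of "\<lambda>x. (f x - g x)\<^sup>2"]) auto
    have ints: "integrable lborel (\<lambda>x. (f (x + c) - f x)\<^sup>2)" "integrable lborel (\<lambda>x. (f x - g x)\<^sup>2)"
        "integrable lborel (\<lambda>x. (f (x + c) - g (x + c))\<^sup>2)" "integrable lborel (\<lambda>x. (g (x + c) - g x)\<^sup>2)"
      using square_integrable_diff[OF square_integrable_translation[OF f, of c] f] fg
        square_integrable_translation[OF fg, of c] square_integrable_diff[OF square_integrable_translation[OF sg, of c] sg]
      by (auto simp: square_integrable_def)
    have "(\<integral>x. (f (x + c) - f x)\<^sup>2 \<partial>lborel) \<le>
       (\<integral>x. 3 * ((f (x + c) - g (x + c))\<^sup>2 + (g (x + c) - g x)\<^sup>2 + (f x - g x)\<^sup>2) \<partial>lborel)"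
    proof (rule integral_mono)
      show "(f (x + c) - f x)\<^sup>2 \<le> 3 * ((f (x + c) - g (x + c))\<^sup>2 + (g (x + c) - g x)\<^sup>2 + (f x - g x)\<^sup>2)" for x
        using square_sum3[of "f (x + c) - g (x + c)" "g (x + c) - g x" "g x - f x"] by (simp add: power2_commute)
    qed (use ints in auto)
    also have "\<dots> = 3 * ((\<integral>x. (f x - g x)\<^sup>2 \<partial>lborel) + (\<integral>x. (g (x + c) - g x)\<^sup>2 \<partial>lborel) + (\<integral>x. (f x - g x)\<^sup>2 \<partial>lborel))"
      using ints by (simp add: fgc)
    also have "\<dots> < e" using add_strict_mono[OF add_strict_mono[OF g(4) gk] g(4)] by simp
    finally show ?thesis by (simp add: c_def)
  qed
  then show "\<exists>no. \<forall>n\<ge>no. norm ((\<integral>x. (f (x + h n) - f x)\<^sup>2 \<partial>lborel) - 0) < e" by blast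
qed

section \<open>The energy identity\<close>

text \<open>Sequential continuity at 0 of the L2 modulus of \<open>f\<close>, turned into a uniform
  statement: in \<open>pairing_average_tendsto\<close> the shift runs through a whole interval and
  not along a sequence.\<close>

lemma translation_uniform_L2:
  fixes f :: "'a::euclidean_space \<Rightarrow> real"
  assumes f: "square_integrable lborel f" and e: "e > 0"
  obtains d where "d > 0" "\<And>h. norm h < d \<Longrightarrow> (\<integral>x. (f (x + h) - f x)\<^sup>2 \<partial>lborel) < e"
proof -
  let ?w = "\<lambda>h. \<integral>x. (f (x + h) - f x)\<^sup>2 \<partial>lborel"
  have "isCont ?w 0"
    unfolding continuous_at_sequentially comp_def using translation_continuous_L2[OF f] by simp
  then obtain d where "d > 0" "\<And>h. dist h 0 < d \<Longrightarrow> dist (?w h) (?w 0) < e"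
    using e unfolding continuous_at_eps_delta by blast
  then show ?thesis using that by (auto simp: dist_norm)
qed

text \<open>The functions \<open>w n\<close> vary with \<open>n\<close>, so continuity of a single
  function at 0 does not apply; closeness to \<open>c\<close>, uniform on the window
  \<open>{0<..<h n}\<close>, is what survives the averaging.\<close>

lemma average_tendsto:
  fixes w :: "nat \<Rightarrow> real \<Rightarrow> real"
  assumes h: "\<And>n. 0 < h n"
    and int: "\<And>n. integrable lborel (\<lambda>\<eta>. indicator {0<..<h n} \<eta> * w n \<eta>)"
    and close: "\<And>e. e > 0 \<Longrightarrow> \<exists>m. \<forall>n\<ge>m. \<forall>\<eta>\<in>{0<..<h n}. \<bar>w n \<eta> - c\<bar> \<le> e"
  shows "(\<lambda>n. (\<integral>\<eta>. indicator {0<..<h n} \<eta> * w n \<eta> \<partial>lborel) / h n) \<longlonglongrightarrow> c"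
proof (rule LIMSEQ_I)
  fix e :: real assume e: "0 < e"
  obtain m where m: "\<And>n \<eta>. n \<ge> m \<Longrightarrow> \<eta> \<in> {0<..<h n} \<Longrightarrow> \<bar>w n \<eta> - c\<bar> \<le> e / 2"
    using close[OF half_gt_zero[OF e]] by metis
  have "norm ((\<integral>\<eta>. indicator {0<..<h n} \<eta> * w n \<eta> \<partial>lborel) / h n - c) < e" if n: "n \<ge> m" for n
  proof -
    let ?i = "indicator {0<..<h n} :: real \<Rightarrow> real"
    have ii: "integrable lborel (\<lambda>\<eta>. b * ?i \<eta>)" "(\<integral>\<eta>. b * ?i \<eta> \<partial>lborel) = b * h n" for b
      using h[of n] by (auto intro!: integrable_mult_right integrable_real_indicator)
    have "(\<integral>\<eta>. ?i \<eta> * w n \<eta> \<partial>lborel) - c * h n = (\<integral>\<eta>. ?i \<eta> * w n \<eta> - c * ?i \<eta> \<partial>lborel)"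
      by (simp only: Bochner_Integration.integral_diff[OF int[of n] ii(1)] ii(2))
    also have "norm \<dots> \<le> (\<integral>\<eta>. norm (?i \<eta> * w n \<eta> - c * ?i \<eta>) \<partial>lborel)"
      by (rule integral_norm_bound)
    also have "\<dots> \<le> (\<integral>\<eta>. (e/2) * ?i \<eta> \<partial>lborel)"
    proof (rule integral_mono)
      show "integrable lborel (\<lambda>\<eta>. norm (?i \<eta> * w n \<eta> - c * ?i \<eta>))" using int[of n] ii(1) by auto
      show "norm (?i \<eta> * w n \<eta> - c * ?i \<eta>) \<le> (e/2) * ?i \<eta>" for \<eta>
        using m[OF n, of \<eta>] by (auto simp: indicator_def)
    qed (rule ii(1))
    also have "\<dots> = (e/2) * h n" by (rule ii(2))
    also have "\<dots> < e * h n" using e h[of n] by simp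
    finally have "\<bar>(\<integral>\<eta>. ?i \<eta> * w n \<eta> \<partial>lborel) - c * h n\<bar> < e * h n" by simp
    moreover have "(\<integral>\<eta>. ?i \<eta> * w n \<eta> \<partial>lborel) / h n - c = ((\<integral>\<eta>. ?i \<eta> * w n \<eta> \<partial>lborel) - c * h n) / h n"
      using h[of n] by (simp add: field_simps)
    ultimately show ?thesis using h[of n] by (simp add: abs_mult divide_less_eq)
  qed
  then show "\<exists>no. \<forall>n\<ge>no. norm ((\<integral>\<eta>. indicator {0<..<h n} \<eta> * w n \<eta> \<partial>lborel) / h n - c) < e" by blast
qed

section \<open>Averaged pairings with time translates\<close>

lemma square_integrable_indicator_fst:
  fixes P :: "real \<times> real \<Rightarrow> real"
  assumes "square_integrable lborel P" "A \<in> sets borel"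
  shows "square_integrable lborel (\<lambda>z. indicator A (fst z) * P z)"
proof (rule square_integrable_mult_bounded[OF assms(1), where B = 1])
  have [measurable]: "A \<in> sets borel" by fact
  show "(\<lambda>z. indicator A (fst z)) \<in> borel_measurable (lborel :: (real \<times> real) measure)"
    by (simp add: lborel_prod[symmetric])
qed (auto simp: indicator_def)

text \<open>Fubini in the delay \<eta> and the point \<open>z\<close>. \<open>G s\<close> is the
  shape in which the weak formulation delivers an increment over a window of length
  \<open>h\<close>, while \<open>c \<eta>\<close> pairs \<open>V\<close> with \<open>P\<close> moved
  by \<open>\<delta> * \<eta>\<close> in time; \<delta> will be 1 or -1. Translations preserve the
  L2 norm, so Cauchy-Schwarz bounds every \<eta>-slice by the same \<open>K\<close>.\<close>

lemma pairing_swap: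
  fixes P V :: "real \<times> real \<Rightarrow> real" and \<delta> h :: real
  assumes P: "square_integrable lborel P" and V: "square_integrable lborel V" and A: "A \<in> sets borel" and h: "0 < h"
  defines "c \<equiv> \<lambda>\<eta>. \<integral>z. indicator A (fst z) * (P (z + (\<delta> * \<eta>, 0)) * V z) \<partial>lborel"
    and "G \<equiv> \<lambda>s. indicator A s * (\<integral>x. (\<integral>\<eta>. indicator {0<..<h} \<eta> * P (s + \<delta> * \<eta>, x) \<partial>lborel) * V (s, x) \<partial>lborel)"
  shows "integrable lborel (\<lambda>\<eta>. indicator {0<..<h} \<eta> * c \<eta>)" "integrable lborel G"
    "(\<integral>s. G s \<partial>lborel) = (\<integral>\<eta>. indicator {0<..<h} \<eta> * c \<eta> \<partial>lborel)"
proof -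
  have [measurable]: "P \<in> borel_measurable (lborel \<Otimes>\<^sub>M lborel)" "V \<in> borel_measurable (lborel \<Otimes>\<^sub>M lborel)"
    using P V by (simp_all add: square_integrable_def lborel_prod)
  have [measurable]: "A \<in> sets borel" by fact
  define F where "F \<eta> z = indicator {0<..<h} \<eta> * (indicator A (fst z) * (P (z + (\<delta> * \<eta>, 0)) * V z))" for \<eta> and z :: "real \<times> real"
  have shift: "square_integrable lborel (\<lambda>z. P (z + (\<delta> * \<eta>, 0)))" for \<eta>
    by (rule square_integrable_translation[OF P])
  define K where "K = sqrt (\<integral>z. (P z)\<^sup>2 \<partial>lborel) * sqrt (\<integral>z. (V z)\<^sup>2 \<partial>lborel)"
  have K: "(\<integral>z. \<bar>P (z + (\<delta> * \<eta>, 0)) * V z\<bar> \<partial>lborel) \<le> K" for \<eta>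
  proof -
    have "(\<integral>z. (P (z + (\<delta> * \<eta>, 0)))\<^sup>2 \<partial>lborel) = (\<integral>z. (P z)\<^sup>2 \<partial>lborel)"
      by (rule translation_lborel(2)[of "\<lambda>z. (P z)\<^sup>2"]) (use P in \<open>auto simp: square_integrable_def intro: borel_measurable_power\<close>)
    then show ?thesis using Cauchy_Schwarz_integral_abs[OF shift V, of \<eta>] by (simp only: K_def)
  qed
  have iF: "integrable lborel (F \<eta>)" for \<eta>
    unfolding F_def
    using square_integrable_mult[OF shift square_integrable_indicator_fst[OF V A], of \<eta>]
    by (intro integrable_mult_right) (simp add: mult_ac)
  have bnd: "(\<integral>z. norm (F \<eta> z) \<partial>lborel) \<le> indicator {0<..<h} \<eta> * K" for \<eta>
  proof (cases "\<eta> \<in> {0<..<h}")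
    case True
    have "(\<integral>z. norm (F \<eta> z) \<partial>lborel) \<le> (\<integral>z. \<bar>P (z + (\<delta> * \<eta>, 0)) * V z\<bar> \<partial>lborel)"
    proof (rule integral_mono)
      show "integrable lborel (\<lambda>z. norm (F \<eta> z))" using iF[of \<eta>] by (rule integrable_norm)
      show "norm (F \<eta> z) \<le> \<bar>P (z + (\<delta> * \<eta>, 0)) * V z\<bar>" for z by (auto simp: F_def indicator_def)
    qed (use square_integrable_mult[OF shift V, of \<eta>] in auto)
    then show ?thesis using K[of \<eta>] True by simp
  qed (simp add: F_def)
  have meas: "case_prod F \<in> borel_measurable (lborel \<Otimes>\<^sub>M (lborel :: (real \<times> real) measure))"
    unfolding F_def lborel_prod[symmetric, where 'a = real and 'b = real] by (simp add: plus_prod_def case_prod_beta)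
  have int: "integrable (lborel \<Otimes>\<^sub>M lborel) (case_prod F)"
  proof (rule lborel_pair.Fubini_integrable[OF meas])
    show "integrable lborel (\<lambda>\<eta>. \<integral>z. norm (case (\<eta>, z) of (\<eta>, z) \<Rightarrow> F \<eta> z) \<partial>lborel)"
    proof (rule Bochner_Integration.integrable_bound)
      show "integrable lborel (\<lambda>\<eta>. indicator {0<..<h} \<eta> * K)"
        using h by (intro integrable_mult_left integrable_real_indicator) auto
      have [measurable]: "case_prod F \<in> borel_measurable (lborel \<Otimes>\<^sub>M (lborel :: (real \<times> real) measure))" by (rule meas)
      show "(\<lambda>\<eta>. \<integral>z. norm (case (\<eta>, z) of (\<eta>, z) \<Rightarrow> F \<eta> z) \<partial>lborel) \<in> borel_measurable lborel"
        by measurable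
      show "AE \<eta> in lborel. norm (\<integral>z. norm (case (\<eta>, z) of (\<eta>, z) \<Rightarrow> F \<eta> z) \<partial>lborel) \<le> norm (indicator {0<..<h} \<eta> * K)"
      proof (rule AE_I2)
        fix \<eta>
        have "0 \<le> (\<integral>z. norm (F \<eta> z) \<partial>lborel)" by simp
        then show "norm (\<integral>z. norm (case (\<eta>, z) of (\<eta>, z) \<Rightarrow> F \<eta> z) \<partial>lborel) \<le> norm (indicator {0<..<h} \<eta> * K)"
          using bnd[of \<eta>] by simp
      qed
    qed
    show "AE \<eta> in lborel. integrable lborel (\<lambda>z. case (\<eta>, z) of (\<eta>, z) \<Rightarrow> F \<eta> z)" using iF by simp
  qed
  have Fc: "(\<integral>z. F \<eta> z \<partial>lborel) = indicator {0<..<h} \<eta> * c \<eta>" for \<eta>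
    by (simp add: F_def c_def)
  show "integrable lborel (\<lambda>\<eta>. indicator {0<..<h} \<eta> * c \<eta>)"
    using lborel_pair.integrable_fst[OF int] by (simp add: Fc)
  have snd: "integrable lborel (\<lambda>z. \<integral>\<eta>. F \<eta> z \<partial>lborel)"
    by (rule lborel_pair.integrable_snd[OF int])
  have "(\<integral>\<eta>. indicator {0<..<h} \<eta> * c \<eta> \<partial>lborel) = (\<integral>z. (\<integral>\<eta>. F \<eta> z \<partial>lborel) \<partial>lborel)"
    unfolding Fc[symmetric] by (rule lborel_pair.Fubini_integral[OF int, symmetric])
  also have "\<dots> = (\<integral>s. \<integral>x. (\<integral>\<eta>. F \<eta> (s, x) \<partial>lborel) \<partial>lborel \<partial>lborel)"
    using lborel_pair.integral_fst'[of "\<lambda>z. \<integral>\<eta>. F \<eta> z \<partial>lborel"] snd by (simp add: lborel_prod)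
  finally have "(\<integral>\<eta>. indicator {0<..<h} \<eta> * c \<eta> \<partial>lborel) = (\<integral>s. \<integral>x. (\<integral>\<eta>. F \<eta> (s, x) \<partial>lborel) \<partial>lborel \<partial>lborel)" .
  moreover have G: "(\<integral>x. (\<integral>\<eta>. F \<eta> (s, x) \<partial>lborel) \<partial>lborel) = G s" for s
  proof -
    have "(\<integral>\<eta>. F \<eta> (s, x) \<partial>lborel) = indicator A s * ((\<integral>\<eta>. indicator {0<..<h} \<eta> * P (s + \<delta> * \<eta>, x) \<partial>lborel) * V (s, x))" for x
    proof -
      have "(\<lambda>\<eta>. F \<eta> (s, x)) = (\<lambda>\<eta>. (indicator A s * V (s, x)) * (indicator {0<..<h} \<eta> * P (s + \<delta> * \<eta>, x)))"
        by (auto simp: F_def)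
      then show ?thesis by simp
    qed
    then show ?thesis by (simp add: G_def)
  qed
  ultimately show "(\<integral>s. G s \<partial>lborel) = (\<integral>\<eta>. indicator {0<..<h} \<eta> * c \<eta> \<partial>lborel)" by simp
  show "integrable lborel G"
    using lborel_pair.integrable_fst'[of "\<lambda>z. \<integral>\<eta>. F \<eta> z \<partial>lborel"] snd by (simp add: lborel_prod G)
qed

text \<open>For \<eta> below \<open>h n\<close> the translate of \<open>P\<close> is uniformly close
  to \<open>P\<close> in L2, and the sets \<open>A n\<close> fill up \<open>I\<close>, which
  dominated convergence handles. The two errors are estimated separately, by \<open>e/2\<close>
  each.\<close>

lemma pairing_average_tendsto:
  fixes P V :: "real \<times> real \<Rightarrow> real" and \<delta> :: real
  assumes P: "square_integrable lborel P" and V: "square_integrable lborel V"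
    and A: "\<And>n. A n \<in> sets borel" "\<And>n. A n \<subseteq> I" "\<And>x. x \<in> I \<Longrightarrow> eventually (\<lambda>n. x \<in> A n) sequentially"
    and I: "I \<in> sets borel" and h: "\<And>n. 0 < h n" "h \<longlonglongrightarrow> 0" and \<delta>: "\<bar>\<delta>\<bar> = 1"
  shows "(\<lambda>n. (\<integral>s. indicator (A n) s * (\<integral>x. (\<integral>\<eta>. indicator {0<..<h n} \<eta> * P (s + \<delta> * \<eta>, x) \<partial>lborel) * V (s, x) \<partial>lborel) \<partial>lborel) / h n)
     \<longlonglongrightarrow> (\<integral>z. indicator I (fst z) * (P z * V z) \<partial>lborel)"
  unfolding pairing_swap(3)[OF P V A(1) h(1)]
proof (rule average_tendsto[OF h(1) pairing_swap(1)[OF P V A(1) h(1)]])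
  fix e :: real assume e: "0 < e"
  note [measurable] = A(1) I
  have [measurable]: "P \<in> borel_measurable (lborel \<Otimes>\<^sub>M lborel)" "V \<in> borel_measurable (lborel \<Otimes>\<^sub>M lborel)"
    using P V by (simp_all add: square_integrable_def lborel_prod)
  have PV: "integrable lborel (\<lambda>z. P z * V z)" by (rule square_integrable_mult[OF P V])
  define v where "v = sqrt (\<integral>z. (V z)\<^sup>2 \<partial>lborel)"
  have v: "v \<ge> 0" by (simp add: v_def)
  \<comment> \<open>Chosen so that \<open>sqrt e' * v \<le> e/2\<close>; the added 1 covers
    \<open>v = 0\<close>.\<close>
  define e' where "e' = (e / (2 * (v + 1)))\<^sup>2"
  have e': "e' > 0" using e v by (simp add: e'_def)
  obtain d where d: "d > 0" "\<And>h. norm h < d \<Longrightarrow> (\<integral>z. (P (z + h) - P z)\<^sup>2 \<partial>lborel) < e'"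
    using translation_uniform_L2[OF P e'] by blast
  have "(\<lambda>n. \<integral>z. (indicator I (fst z) - indicator (A n) (fst z)) * \<bar>P z * V z\<bar> \<partial>lborel) \<longlonglongrightarrow> (\<integral>z. 0 \<partial>(lborel :: (real \<times> real) measure))"
  proof (rule integral_dominated_convergence[where w = "\<lambda>z. \<bar>P z * V z\<bar>"])
    show "(\<lambda>z. (indicator I (fst z) - indicator (A n) (fst z)) * \<bar>P z * V z\<bar>) \<in> borel_measurable lborel" for n
      unfolding lborel_prod[symmetric, where 'a = real and 'b = real] by measurable
    show "AE z in lborel. (\<lambda>n. (indicator I (fst z) - indicator (A n) (fst z)) * \<bar>P z * V z\<bar>) \<longlonglongrightarrow> 0"
    proof (rule AE_I2)
      fix z :: "real \<times> real"
      have "eventually (\<lambda>n. (indicator I (fst z) - indicator (A n) (fst z)) * \<bar>P z * V z\<bar> = 0) sequentially"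
      proof (cases "fst z \<in> I")
        case True
        from A(3)[OF this] show ?thesis by eventually_elim (use True in simp)
      next
        case False
        then have "fst z \<notin> A n" for n using A(2) by blast
        then show ?thesis using False by simp
      qed
      then show "(\<lambda>n. (indicator I (fst z) - indicator (A n) (fst z)) * \<bar>P z * V z\<bar>) \<longlonglongrightarrow> 0"
        by (rule tendsto_eventually)
    qed
    show "AE z in lborel. norm ((indicator I (fst z) - indicator (A n) (fst z)) * \<bar>P z * V z\<bar>) \<le> \<bar>P z * V z\<bar>" for n
      using A(2)[of n] by (intro AE_I2) (auto simp: indicator_def)
  qed (use PV in auto)
  then have "eventually (\<lambda>n. (\<integral>z. (indicator I (fst z) - indicator (A n) (fst z)) * \<bar>P z * V z\<bar> \<partial>lborel) < e/2) sequentially"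
    using e by (intro order_tendstoD) auto
  moreover have "eventually (\<lambda>n. h n < d) sequentially" using h(2) d(1) by (rule order_tendstoD)
  ultimately have ev: "eventually (\<lambda>n. (\<integral>z. (indicator I (fst z) - indicator (A n) (fst z)) * \<bar>P z * V z\<bar> \<partial>lborel) < e/2 \<and> h n < d) sequentially"
    by eventually_elim simp
  have "\<bar>(\<integral>z. indicator (A n) (fst z) * (P (z + (\<delta> * \<eta>, 0)) * V z) \<partial>lborel) - (\<integral>z. indicator I (fst z) * (P z * V z) \<partial>lborel)\<bar> \<le> e"
    if n: "(\<integral>z. (indicator I (fst z) - indicator (A n) (fst z)) * \<bar>P z * V z\<bar> \<partial>lborel) < e/2" "h n < d"
      and \<eta>: "\<eta> \<in> {0<..<h n}" for n \<eta>
  proof -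
    let ?P = "\<lambda>z. P (z + (\<delta> * \<eta>, 0))"
    have sP: "square_integrable lborel ?P" by (rule square_integrable_translation[OF P])
    have sD: "square_integrable lborel (\<lambda>z. ?P z - P z)" by (rule square_integrable_diff[OF sP P])
    have i1: "integrable lborel (\<lambda>z. indicator (A n) (fst z) * (?P z * V z))"
      using square_integrable_mult[OF sP square_integrable_indicator_fst[OF V A(1)], of n] by (simp add: mult_ac)
    have i2: "integrable lborel (\<lambda>z. indicator I (fst z) * (P z * V z))"
      using square_integrable_mult[OF P square_integrable_indicator_fst[OF V I]] by (simp add: mult_ac)
    have i2': "integrable lborel (\<lambda>z. indicator (A n) (fst z) * (P z * V z))"
      using square_integrable_mult[OF P square_integrable_indicator_fst[OF V A(1)], of n] by (simp add: mult_ac)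
    have i3: "integrable lborel (\<lambda>z. \<bar>(?P z - P z) * V z\<bar>)"
      using square_integrable_mult[OF sD V] by auto
    have i4: "integrable lborel (\<lambda>z. (indicator I (fst z) - indicator (A n) (fst z)) * \<bar>P z * V z\<bar>)"
    proof -
      have "integrable lborel (\<lambda>z. \<bar>indicator I (fst z) * (P z * V z)\<bar> - \<bar>indicator (A n) (fst z) * (P z * V z)\<bar>)"
        using i2 i2' by auto
      then show ?thesis by (simp add: abs_mult left_diff_distrib)
    qed
    have "\<bar>(\<integral>z. indicator (A n) (fst z) * (?P z * V z) \<partial>lborel) - (\<integral>z. indicator I (fst z) * (P z * V z) \<partial>lborel)\<bar>
       = \<bar>\<integral>z. indicator (A n) (fst z) * (?P z * V z) - indicator I (fst z) * (P z * V z) \<partial>lborel\<bar>"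
      using i1 i2 by simp
    also have "\<dots> \<le> (\<integral>z. \<bar>indicator (A n) (fst z) * (?P z * V z) - indicator I (fst z) * (P z * V z)\<bar> \<partial>lborel)"
      using integral_norm_bound[of lborel "\<lambda>z. indicator (A n) (fst z) * (?P z * V z) - indicator I (fst z) * (P z * V z)"] by simp
    also have "\<dots> \<le> (\<integral>z. \<bar>(?P z - P z) * V z\<bar> + (indicator I (fst z) - indicator (A n) (fst z)) * \<bar>P z * V z\<bar> \<partial>lborel)"
    proof (rule integral_mono)
      show "\<bar>indicator (A n) (fst z) * (?P z * V z) - indicator I (fst z) * (P z * V z)\<bar>
         \<le> \<bar>(?P z - P z) * V z\<bar> + (indicator I (fst z) - indicator (A n) (fst z)) * \<bar>P z * V z\<bar>" for z
        using A(2)[of n] by (auto simp: indicator_def left_diff_distrib)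
    qed (use i1 i2 i3 i4 in auto)
    also have "\<dots> = (\<integral>z. \<bar>(?P z - P z) * V z\<bar> \<partial>lborel) + (\<integral>z. (indicator I (fst z) - indicator (A n) (fst z)) * \<bar>P z * V z\<bar> \<partial>lborel)"
      using i3 i4 by simp
    also have "\<dots> \<le> e/2 + e/2"
    proof (rule add_mono)
      have "norm (\<delta> * \<eta>, 0::real) < d" using \<eta> n(2) \<delta> by (simp add: norm_Pair abs_mult)
      from d(2)[OF this] have "sqrt (\<integral>z. (?P z - P z)\<^sup>2 \<partial>lborel) \<le> sqrt e'" by simp
      also have "sqrt e' = e / (2 * (v + 1))" using e v by (simp add: e'_def)
      finally have le: "sqrt (\<integral>z. (?P z - P z)\<^sup>2 \<partial>lborel) \<le> e / (2 * (v + 1))" .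
      have "(\<integral>z. \<bar>(?P z - P z) * V z\<bar> \<partial>lborel) \<le> sqrt (\<integral>z. (?P z - P z)\<^sup>2 \<partial>lborel) * v"
        using Cauchy_Schwarz_integral_abs[OF sD V] by (simp add: v_def)
      also have "\<dots> \<le> e / (2 * (v + 1)) * v" by (rule mult_right_mono[OF le v])
      also have "\<dots> \<le> e/2" using e v by (simp add: field_simps)
      finally show "(\<integral>z. \<bar>(?P z - P z) * V z\<bar> \<partial>lborel) \<le> e/2" .
    qed (use n(1) in simp)
    finally show ?thesis by simp
  qed
  with ev show "\<exists>m. \<forall>n\<ge>m. \<forall>\<eta>\<in>{0<..<h n}. \<bar>(\<integral>z. indicator (A n) (fst z) * (P (z + (\<delta> * \<eta>, 0)) * V z) \<partial>lborel)
       - (\<integral>z. indicator I (fst z) * (P z * V z) \<partial>lborel)\<bar> \<le> e"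
    unfolding eventually_sequentially by meson
qed

text \<open>\<open>k r s\<close> stands for the inner product of the slices at \<open>r\<close> and
  \<open>s\<close>. The difference \<open>k (s+h) (s+h) - k s s\<close> splits, by symmetry, into
  two increments in the first argument, with second argument \<open>s\<close> and
  \<open>s + h\<close>, to which \<open>weak\<close> applies for almost every \<open>s\<close>.
  Averaged over \<open>s\<close>, the left side telescopes to means near \<open>t2\<close> and
  \<open>t1\<close>; on the right each pairing appears once with a forward and once with a backward
  window, whence the factor 2.\<close>

theorem energy_identity:
  fixes P V Q U :: "real \<times> real \<Rightarrow> real" and k :: "real \<Rightarrow> real \<Rightarrow> real"
  assumes P: "square_integrable lborel P" and V: "square_integrable lborel V"
    and Q: "square_integrable lborel Q" and U: "square_integrable lborel U"
    and t: "t1 < t2"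
    and sym: "\<And>r s. k r s = k s r"
    and cont: "continuous_on {t1..t2} (\<lambda>t. k t t)"
    and weak: "AE s in lborel. s \<in> {t1<..<t2} \<longrightarrow> (\<forall>r1 r2. t1 \<le> r1 \<longrightarrow> r1 \<le> r2 \<longrightarrow> r2 \<le> t2 \<longrightarrow>
       k r2 s - k r1 s = - (\<integral>x. (\<integral>r. indicator {r1<..<r2} r * P (r, x) \<partial>lborel) * V (s, x) \<partial>lborel)
                         - (\<integral>x. (\<integral>r. indicator {r1<..<r2} r * Q (r, x) \<partial>lborel) * U (s, x) \<partial>lborel))"
    (is "AE s in lborel. ?W s")
  shows "k t2 t2 - k t1 t1 = - 2 * ((\<integral>z. indicator {t1<..<t2} (fst z) * (P z * V z) \<partial>lborel)
                                  + (\<integral>z. indicator {t1<..<t2} (fst z) * (Q z * U z) \<partial>lborel))"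
proof -
  \<comment> \<open>The diagonal is extended by constants beyond \<open>{t1..t2}\<close>, so that
    its shifts are defined and continuous everywhere.\<close>
  define N where "N s = k (max t1 (min s t2)) (max t1 (min s t2))" for s
  have Nc: "continuous_on UNIV N"
    unfolding N_def by (rule continuous_on_compose2[OF cont]) (use t in \<open>auto intro!: continuous_intros\<close>)
  have Nm[measurable]: "N \<in> borel_measurable borel" by (rule borel_measurable_continuous_onI[OF Nc])
  have Neq: "N s = k s s" if "t1 \<le> s" "s \<le> t2" for s using that by (simp add: N_def)
  \<comment> \<open>The summand 3 gives \<open>h n < (t2 - t1) / 2\<close>, so the windows at the
    two ends are disjoint.\<close>
  define h where "h n = (t2 - t1) / (real n + 3)" for n
  have h: "0 < h n" "h n < (t2 - t1) / 2" for n
    using t unfolding h_def by (simp, intro divide_strict_left_mono) auto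
  have h0: "h \<longlonglongrightarrow> 0" unfolding h_def by real_asymp
  \<comment> \<open>\<open>A n\<close> holds the base points \<open>s\<close>, \<open>A' n\<close>
    the moved points \<open>s + h n\<close>.\<close>
  define A where "A n = {t1<..<t2 - h n}" for n
  define A' where "A' n = {t1 + h n<..<t2}" for n
  have Nint: "integrable lborel (\<lambda>s. indicator {a<..<b} s * N (c + d * s))" if "d \<noteq> 0" for a b c d
  proof -
    have "set_integrable lborel {a..b} (\<lambda>s. N (c + d * s))"
      by (rule borel_integrable_atLeastAtMost') (intro continuous_on_compose2[OF Nc] continuous_intros, auto)
    then have "set_integrable lborel {a<..<b} (\<lambda>s. N (c + d * s))"
      by (rule set_integrable_subset) auto
    then show ?thesis by (simp add: set_integrable_def)
  qed
  define E where "E P V \<delta> h s = (\<integral>x. (\<integral>\<eta>. indicator {0<..<h} \<eta> * P (s + \<delta> * \<eta>, x) \<partial>lborel) * V (s, x) \<partial>lborel)"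
    for P V :: "real \<times> real \<Rightarrow> real" and \<delta> h s :: real
  have limE: "(\<lambda>n. (\<integral>s. indicator (A n) s * E P V 1 (h n) s \<partial>lborel) / h n)
     \<longlonglongrightarrow> (\<integral>z. indicator {t1<..<t2} (fst z) * (P z * V z) \<partial>lborel)"
     "(\<lambda>n. (\<integral>s. indicator (A' n) s * E P V (- 1) (h n) s \<partial>lborel) / h n)
     \<longlonglongrightarrow> (\<integral>z. indicator {t1<..<t2} (fst z) * (P z * V z) \<partial>lborel)"
    if PV: "square_integrable lborel P" "square_integrable lborel V" for P V
  proof -
    have ev: "eventually (\<lambda>n. x \<in> A n) sequentially" "eventually (\<lambda>n. x \<in> A' n) sequentially" if "x \<in> {t1<..<t2}" for x
    proof -
      have "eventually (\<lambda>n. h n < t2 - x) sequentially" using that by (intro order_tendstoD(2)[OF h0]) auto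
      then show "eventually (\<lambda>n. x \<in> A n) sequentially" by eventually_elim (use that in \<open>auto simp: A_def\<close>)
      have "eventually (\<lambda>n. h n < x - t1) sequentially" using that by (intro order_tendstoD(2)[OF h0]) auto
      then show "eventually (\<lambda>n. x \<in> A' n) sequentially" by eventually_elim (use that in \<open>auto simp: A'_def\<close>)
    qed
    have sub: "A n \<subseteq> {t1<..<t2}" "A' n \<subseteq> {t1<..<t2}" for n using h(1)[of n] by (auto simp: A_def A'_def)
    show "(\<lambda>n. (\<integral>s. indicator (A n) s * E P V 1 (h n) s \<partial>lborel) / h n)
     \<longlonglongrightarrow> (\<integral>z. indicator {t1<..<t2} (fst z) * (P z * V z) \<partial>lborel)"
      unfolding E_def by (rule pairing_average_tendsto[OF PV _ sub(1) ev(1) _ h(1) h0]) (auto simp: A_def)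
    show "(\<lambda>n. (\<integral>s. indicator (A' n) s * E P V (-1) (h n) s \<partial>lborel) / h n)
     \<longlonglongrightarrow> (\<integral>z. indicator {t1<..<t2} (fst z) * (P z * V z) \<partial>lborel)"
      unfolding E_def by (rule pairing_average_tendsto[OF PV _ sub(2) ev(2) _ h(1) h0]) (auto simp: A'_def)
  qed
  have intE: "integrable lborel (\<lambda>s. indicator A s * E P V \<delta> (h n) s)"
    if "square_integrable lborel P" "square_integrable lborel V" "A \<in> sets borel" for P V A \<delta> n
    unfolding E_def by (rule pairing_swap(2)[OF that h(1)])
  obtain Z where Z: "Z \<in> null_sets lborel" and W: "\<And>s. s \<in> space lborel - Z \<Longrightarrow> ?W s"
    by (rule AE_E3[OF weak]) blast
  have good: "k r2 s - k r1 s = - (\<integral>x. (\<integral>r. indicator {r1<..<r2} r * P (r, x) \<partial>lborel) * V (s, x) \<partial>lborel)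
                         - (\<integral>x. (\<integral>r. indicator {r1<..<r2} r * Q (r, x) \<partial>lborel) * U (s, x) \<partial>lborel)"
    if "s \<notin> Z" "s \<in> {t1<..<t2}" "t1 \<le> r1" "r1 \<le> r2" "r2 \<le> t2" for s r1 r2
  proof -
    have "s \<in> space lborel - Z" using that by simp
    from W[OF this] that(2-) show ?thesis by blast
  qed
  \<comment> \<open>The substitutions \<open>r = s + \<eta>\<close> and
    \<open>r = s + h - \<eta>\<close> present the same window as a forward one seen from
    \<open>s\<close> and as a backward one seen from \<open>s + h\<close>.\<close>
  have shiftE: "(\<integral>x. (\<integral>r. indicator {s<..<s + h} r * P (r, x) \<partial>lborel) * V (s, x) \<partial>lborel) = E P V 1 h s"
     "(\<integral>x. (\<integral>r. indicator {s<..<s + h} r * P (r, x) \<partial>lborel) * V (s + h, x) \<partial>lborel) = E P V (-1) h (s + h)"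
    for P V :: "real \<times> real \<Rightarrow> real" and s h :: real
  proof -
    have "(\<integral>r. indicator {s<..<s + h} r * P (r, x) \<partial>lborel) = (\<integral>\<eta>. indicator {0<..<h} \<eta> * P (s + 1 * \<eta>, x) \<partial>lborel)" for x
      by (subst lborel_integral_real_affine[where c = 1 and t = s]) (auto intro!: Bochner_Integration.integral_cong simp: indicator_def)
    then show "(\<integral>x. (\<integral>r. indicator {s<..<s + h} r * P (r, x) \<partial>lborel) * V (s, x) \<partial>lborel) = E P V 1 h s"
      by (simp add: E_def)
    have "(\<integral>r. indicator {s<..<s + h} r * P (r, x) \<partial>lborel) = (\<integral>\<eta>. indicator {0<..<h} \<eta> * P (s + h + - 1 * \<eta>, x) \<partial>lborel)" for x
      by (subst lborel_integral_real_affine[where c = "-1" and t = "s + h"]) (auto intro!: Bochner_Integration.integral_cong simp: indicator_def)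
    then show "(\<integral>x. (\<integral>r. indicator {s<..<s + h} r * P (r, x) \<partial>lborel) * V (s + h, x) \<partial>lborel) = E P V (-1) h (s + h)"
      by (simp add: E_def)
  qed
  have key: "(\<integral>s. indicator (A n) s * (N (s + h n) - N s) \<partial>lborel) =
     - (\<integral>s. indicator (A n) s * E P V 1 (h n) s \<partial>lborel) - (\<integral>s. indicator (A' n) s * E P V (- 1) (h n) s \<partial>lborel)
     - (\<integral>s. indicator (A n) s * E Q U 1 (h n) s \<partial>lborel) - (\<integral>s. indicator (A' n) s * E Q U (- 1) (h n) s \<partial>lborel)" for n
  proof -
    have AA': "indicator (A n) s = (indicator (A' n) (s + h n) :: real)" for s by (auto simp: A_def A'_def indicator_def)
    have iE': "integrable lborel (\<lambda>s. indicator (A n) s * E P V (-1) (h n) (s + h n))"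
      "(\<integral>s. indicator (A n) s * E P V (-1) (h n) (s + h n) \<partial>lborel) = (\<integral>s. indicator (A' n) s * E P V (- 1) (h n) s \<partial>lborel)"
      if "square_integrable lborel P" "square_integrable lborel V" for P V
    proof -
      have i: "integrable lborel (\<lambda>s. indicator (A' n) s * E P V (- 1) (h n) s)"
        by (rule intE[OF that]) (simp add: A'_def)
      then have m: "(\<lambda>s. indicator (A' n) s * E P V (- 1) (h n) s) \<in> borel_measurable borel" by auto
      show "integrable lborel (\<lambda>s. indicator (A n) s * E P V (-1) (h n) (s + h n))"
        using translation_lborel(1)[OF m, of "h n"] i by (simp add: AA')
      show "(\<integral>s. indicator (A n) s * E P V (-1) (h n) (s + h n) \<partial>lborel) = (\<integral>s. indicator (A' n) s * E P V (- 1) (h n) s \<partial>lborel)"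
        using translation_lborel(2)[OF m, of "h n"] by (simp add: AA')
    qed
    have iE: "integrable lborel (\<lambda>s. indicator (A n) s * E P V 1 (h n) s)"
      if "square_integrable lborel P" "square_integrable lborel V" for P V
      by (rule intE[OF that]) (simp add: A_def)
    have "(\<integral>s. indicator (A n) s * (N (s + h n) - N s) \<partial>lborel) =
      (\<integral>s. - (indicator (A n) s * E P V 1 (h n) s) - indicator (A n) s * E P V (-1) (h n) (s + h n)
        - indicator (A n) s * E Q U 1 (h n) s - indicator (A n) s * E Q U (-1) (h n) (s + h n) \<partial>lborel)"
    proof (rule integral_cong_AE)
      show "(\<lambda>s. indicator (A n) s * (N (s + h n) - N s)) \<in> borel_measurable lborel" by (simp add: A_def)
      have [measurable]: "(\<lambda>s. indicator (A n) s * E P V 1 (h n) s) \<in> borel_measurable borel"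
         "(\<lambda>s. indicator (A n) s * E P V (-1) (h n) (s + h n)) \<in> borel_measurable borel"
         "(\<lambda>s. indicator (A n) s * E Q U 1 (h n) s) \<in> borel_measurable borel"
         "(\<lambda>s. indicator (A n) s * E Q U (-1) (h n) (s + h n)) \<in> borel_measurable borel"
        using iE[OF P V] iE[OF Q U] iE'(1)[OF P V] iE'(1)[OF Q U] by auto
      show "(\<lambda>s. - (indicator (A n) s * E P V 1 (h n) s) - indicator (A n) s * E P V (-1) (h n) (s + h n)
        - indicator (A n) s * E Q U 1 (h n) s - indicator (A n) s * E Q U (-1) (h n) (s + h n)) \<in> borel_measurable lborel"
        by measurable
      have Zm: "Z \<in> sets borel" using Z by auto
      \<comment> \<open>Both \<open>s\<close> and \<open>s + h n\<close> serve as frozen second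
        arguments, so both have to avoid the exceptional set.\<close>
      have "AE s in lborel. s \<notin> Z" using AE_not_in[OF Z] .
      moreover have "AE s in lborel. h n + 1 * s \<notin> Z"
        by (rule AE_borel_affine[where P = "\<lambda>s. s \<notin> Z"]) (use Zm AE_not_in[OF Z] in auto)
      ultimately show "AE s in lborel. indicator (A n) s * (N (s + h n) - N s) =
         - (indicator (A n) s * E P V 1 (h n) s) - indicator (A n) s * E P V (-1) (h n) (s + h n)
        - indicator (A n) s * E Q U 1 (h n) s - indicator (A n) s * E Q U (-1) (h n) (s + h n)"
      proof eventually_elim
        case (elim s)
        show ?case
        proof (cases "s \<in> A n")
          case True
          then have s: "t1 < s" "s + h n < t2" by (auto simp: A_def)
          have g1: "k (s + h n) s - k s s = - E P V 1 (h n) s - E Q U 1 (h n) s"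
            using good[of s s "s + h n"] elim(1) s h(1)[of n] by (simp add: shiftE)
          have g2: "k (s + h n) (s + h n) - k s (s + h n) = - E P V (-1) (h n) (s + h n) - E Q U (-1) (h n) (s + h n)"
            using good[of "s + h n" s "s + h n"] elim(2) s h(1)[of n] by (simp add: shiftE add.commute)
          have "N (s + h n) - N s = k (s + h n) (s + h n) - k s s" using s h(1)[of n] by (simp add: Neq)
          then show ?thesis using True g1 g2 sym[of s "s + h n"] by simp
        qed simp
      qed
    qed
    also have "\<dots> = - (\<integral>s. indicator (A n) s * E P V 1 (h n) s \<partial>lborel) - (\<integral>s. indicator (A' n) s * E P V (- 1) (h n) s \<partial>lborel)
     - (\<integral>s. indicator (A n) s * E Q U 1 (h n) s \<partial>lborel) - (\<integral>s. indicator (A' n) s * E Q U (- 1) (h n) s \<partial>lborel)"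
      using iE[OF P V] iE[OF Q U] iE'[OF P V] iE'[OF Q U] by simp
    finally show ?thesis .
  qed
  \<comment> \<open>Telescoping: the common part of the shifted and the unshifted integral cancels,
    leaving windows of length \<open>h n\<close> at \<open>t2\<close> and \<open>t1\<close>.\<close>
  have Nside: "(\<integral>s. indicator (A n) s * (N (s + h n) - N s) \<partial>lborel) =
     (\<integral>\<eta>. indicator {0<..<h n} \<eta> * (N (t2 - \<eta>) - N (t1 + \<eta>)) \<partial>lborel)" for n
  proof -
    have iN: "integrable lborel (\<lambda>s. indicator {a<..<b} s * N s)" for a b using Nint[of 1 a b 0] by simp
    have "(\<integral>s. indicator (A n) s * (N (s + h n) - N s) \<partial>lborel)
       = (\<integral>s. indicator (A n) s * N (s + h n) \<partial>lborel) - (\<integral>s. indicator (A n) s * N s \<partial>lborel)"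
      using Nint[of 1 t1 "t2 - h n" "h n"] iN[of t1 "t2 - h n"] by (simp add: A_def right_diff_distrib add.commute)
    also have "(\<integral>s. indicator (A n) s * N (s + h n) \<partial>lborel) = (\<integral>s. indicator (A' n) s * N s \<partial>lborel)"
    proof -
      have "indicator (A n) s = (indicator (A' n) (s + h n) :: real)" for s by (auto simp: A_def A'_def indicator_def)
      then show ?thesis using translation_lborel(2)[of "\<lambda>s. indicator (A' n) s * N s" "h n"] by (simp add: A'_def)
    qed
    also have "(\<integral>s. indicator (A' n) s * N s \<partial>lborel) - (\<integral>s. indicator (A n) s * N s \<partial>lborel)
       = (\<integral>s. indicator (A' n) s * N s - indicator (A n) s * N s \<partial>lborel)"
      using iN[of t1 "t2 - h n"] iN[of "t1 + h n" t2] by (simp add: A_def A'_def)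
    also have "\<dots> = (\<integral>s. indicator {t2 - h n<..<t2} s * N s - indicator {t1<..<t1 + h n} s * N s \<partial>lborel)"
    proof (rule integral_cong_AE)
      have "AE s in lborel. s \<noteq> t1 + h n \<and> s \<noteq> t2 - h n"
        using AE_lborel_singleton[of "t1 + h n"] AE_lborel_singleton[of "t2 - h n"] by eventually_elim simp
      then show "AE s in lborel. indicator (A' n) s * N s - indicator (A n) s * N s =
         indicator {t2 - h n<..<t2} s * N s - indicator {t1<..<t1 + h n} s * N s"
      proof eventually_elim
        case (elim s)
        then show ?case using h[of n] by (auto simp: A_def A'_def indicator_def)
      qed
    qed (auto simp: A_def A'_def)
    also have "\<dots> = (\<integral>s. indicator {t2 - h n<..<t2} s * N s \<partial>lborel) - (\<integral>s. indicator {t1<..<t1 + h n} s * N s \<partial>lborel)"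
      using iN by simp
    also have "(\<integral>s. indicator {t2 - h n<..<t2} s * N s \<partial>lborel) = (\<integral>\<eta>. indicator {0<..<h n} \<eta> * N (t2 + (-1) * \<eta>) \<partial>lborel)"
      by (subst lborel_integral_real_affine[where c = "-1" and t = t2]) (auto intro!: Bochner_Integration.integral_cong simp: indicator_def)
    also have "(\<integral>s. indicator {t1<..<t1 + h n} s * N s \<partial>lborel) = (\<integral>\<eta>. indicator {0<..<h n} \<eta> * N (t1 + 1 * \<eta>) \<partial>lborel)"
      by (subst lborel_integral_real_affine[where c = 1 and t = t1]) (auto intro!: Bochner_Integration.integral_cong simp: indicator_def)
    finally show ?thesis
      using Nint[of "-1" 0 "h n" t2] Nint[of 1 0 "h n" t1] by (simp add: right_diff_distrib)
  qed
  have "(\<lambda>n. (\<integral>\<eta>. indicator {0<..<h n} \<eta> * (N (t2 - \<eta>) - N (t1 + \<eta>)) \<partial>lborel) / h n) \<longlonglongrightarrow> N t2 - N t1"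
  proof (rule average_tendsto[OF h(1)])
    show "integrable lborel (\<lambda>\<eta>. indicator {0<..<h n} \<eta> * (N (t2 - \<eta>) - N (t1 + \<eta>)))" for n
      using Nint[of "-1" 0 "h n" t2] Nint[of 1 0 "h n" t1] by (simp add: right_diff_distrib)
    fix e :: real assume e: "e > 0"
    have "isCont N s" for s using Nc by (simp add: continuous_on_eq_continuous_at)
    then have *: "\<exists>d>0. \<forall>s'. dist s' s < d \<longrightarrow> dist (N s') (N s) < e/2" for s
      using e unfolding continuous_at_eps_delta by (meson half_gt_zero)
    obtain d1 where d1: "d1 > 0" "\<And>s'. dist s' t1 < d1 \<Longrightarrow> dist (N s') (N t1) < e/2" using * by blast
    obtain d2 where d2: "d2 > 0" "\<And>s'. dist s' t2 < d2 \<Longrightarrow> dist (N s') (N t2) < e/2" using * by blast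
    have "eventually (\<lambda>n. h n < min d1 d2) sequentially" using d1 d2 by (intro order_tendstoD(2)[OF h0]) auto
    then obtain m where m: "\<And>n. n \<ge> m \<Longrightarrow> h n < min d1 d2" unfolding eventually_sequentially by blast
    have "\<bar>N (t2 - \<eta>) - N (t1 + \<eta>) - (N t2 - N t1)\<bar> \<le> e" if "n \<ge> m" "\<eta> \<in> {0<..<h n}" for n \<eta>
    proof -
      have "dist (N (t2 - \<eta>)) (N t2) < e/2" using d2(2)[of "t2 - \<eta>"] m[OF that(1)] that(2) by (auto simp: dist_real_def)
      moreover have "dist (N (t1 + \<eta>)) (N t1) < e/2" using d1(2)[of "t1 + \<eta>"] m[OF that(1)] that(2) by (auto simp: dist_real_def)
      moreover have "\<bar>N (t2 - \<eta>) - N (t1 + \<eta>) - (N t2 - N t1)\<bar> \<le> dist (N (t2 - \<eta>)) (N t2) + dist (N (t1 + \<eta>)) (N t1)"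
        using abs_triangle_ineq4[of "N (t2 - \<eta>) - N t2" "N (t1 + \<eta>) - N t1"] by (simp add: dist_real_def algebra_simps)
      ultimately show ?thesis by simp
    qed
    then show "\<exists>m. \<forall>n\<ge>m. \<forall>\<eta>\<in>{0<..<h n}. \<bar>N (t2 - \<eta>) - N (t1 + \<eta>) - (N t2 - N t1)\<bar> \<le> e" by blast
  qed
  moreover let ?p = "\<integral>z. indicator {t1<..<t2} (fst z) * (P z * V z) \<partial>lborel"
    and ?q = "\<integral>z. indicator {t1<..<t2} (fst z) * (Q z * U z) \<partial>lborel"
  have "(\<lambda>n. - ((\<integral>s. indicator (A n) s * E P V 1 (h n) s \<partial>lborel) / h n) - (\<integral>s. indicator (A' n) s * E P V (- 1) (h n) s \<partial>lborel) / h n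
     - (\<integral>s. indicator (A n) s * E Q U 1 (h n) s \<partial>lborel) / h n - (\<integral>s. indicator (A' n) s * E Q U (- 1) (h n) s \<partial>lborel) / h n)
     \<longlonglongrightarrow> - ?p - ?p - ?q - ?q"
    by (intro tendsto_intros limE[OF P V] limE[OF Q U])
  then have "(\<lambda>n. (\<integral>\<eta>. indicator {0<..<h n} \<eta> * (N (t2 - \<eta>) - N (t1 + \<eta>)) \<partial>lborel) / h n) \<longlonglongrightarrow> - ?p - ?p - ?q - ?q"
    unfolding Nside[symmetric] key by (simp add: diff_divide_distrib)
  ultimately have "N t2 - N t1 = - ?p - ?p - ?q - ?q" by (rule LIMSEQ_unique)
  then show ?thesis using t by (simp add: Neq)
qed

section \<open>Borel representatives and slices\<close>

lemma borel_representative: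
  fixes f :: "'a::euclidean_space \<Rightarrow> real"
  assumes f: "f \<in> borel_measurable (lebesgue_on S)" and S: "S \<in> sets borel"
  obtains g where "g \<in> borel_measurable borel" "\<And>z. z \<notin> S \<Longrightarrow> g z = 0"
    "AE z in lborel. z \<in> S \<longrightarrow> g z = f z"
proof -
  have "(\<lambda>z. if z \<in> S then f z else 0) \<in> borel_measurable (completion lborel)"
    using f S by (subst borel_measurable_if) auto
  then obtain g where g: "g \<in> borel_measurable lborel" "AE z in lborel. (if z \<in> S then f z else 0) = g z"
    using completion_ex_borel_measurable_real by blast
  have [measurable]: "g \<in> borel_measurable borel" "S \<in> sets borel" using g S by simp_all
  show ?thesis
  proof (rule that[of "\<lambda>z. indicator S z * g z"])
    show "AE z in lborel. z \<in> S \<longrightarrow> indicator S z * g z = f z"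
      using g(2) by eventually_elim auto
  qed auto
qed

text \<open>Fubini and translations work with \<open>lborel\<close>, while the data are Lebesgue
  measurable on \<open>S\<close>. A Borel function that agrees with \<open>f\<close> almost
  everywhere on \<open>S\<close> and is 0 outside turns integrals over \<open>S\<close> into
  integrals over the whole space.\<close>

lemma lebesgue_on_representative:
  fixes f g :: "'a::euclidean_space \<Rightarrow> real"
  assumes g: "g \<in> borel_measurable borel" "\<And>z. z \<notin> S \<Longrightarrow> g z = 0"
    and fg: "AE z in lborel. z \<in> S \<longrightarrow> g z = f z" and S: "S \<in> sets borel"
  shows "f \<in> borel_measurable (lebesgue_on S)"
    "integrable (lebesgue_on S) f \<longleftrightarrow> integrable lborel g"
    "(LINT z|lebesgue_on S. f z) = (\<integral>z. g z \<partial>lborel)"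
proof -
  let ?f = "\<lambda>z. if z \<in> S then f z else 0"
  have gl: "g \<in> borel_measurable lebesgue" using g(1) by (intro measurable_completion) simp
  have "AE z in lborel. g z = ?f z" using fg by eventually_elim (use g(2) in auto)
  then have ae: "AE z in lebesgue. g z = ?f z" by (rule AE_completion)
  have fm: "?f \<in> borel_measurable lebesgue" by (rule borel_measurable_AE[OF gl ae])
  then show "f \<in> borel_measurable (lebesgue_on S)" using S by (subst (asm) borel_measurable_if) auto
  have "integrable (lebesgue_on S) f \<longleftrightarrow> integrable lebesgue ?f"
    using Lebesgue_Measure.integrable_restrict_UNIV[of S f] S by simp
  also have "\<dots> \<longleftrightarrow> integrable lebesgue g"
    by (rule integrable_cong_AE[OF fm gl]) (use ae in eventually_elim, auto)
  also have "\<dots> \<longleftrightarrow> integrable lborel g" using g(1) by (intro integrable_completion) simp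
  finally show "integrable (lebesgue_on S) f \<longleftrightarrow> integrable lborel g" .
  have "(LINT z|lebesgue_on S. f z) = (\<integral>z. ?f z \<partial>lebesgue)"
    using S by (subst Lebesgue_Measure.integral_restrict_UNIV) auto
  also have "\<dots> = (\<integral>z. g z \<partial>lebesgue)"
    by (rule integral_cong_AE[OF fm gl]) (use ae in eventually_elim, auto)
  also have "\<dots> = (\<integral>z. g z \<partial>lborel)" using g(1) by (intro integral_completion) simp
  finally show "(LINT z|lebesgue_on S. f z) = (\<integral>z. g z \<partial>lborel)" .
qed

lemma AE_lborel_Pair:
  fixes R :: "real \<times> real \<Rightarrow> bool"
  assumes "AE z in lborel. R z"
  shows "AE s in lborel. AE x in lborel. R (s, x)"
  using assms lborel_pair.AE_pair[of R] unfolding lborel_prod by blast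

lemma AE_lborel_snd:
  fixes R :: "real \<Rightarrow> bool"
  assumes "AE x in lborel. R x"
  shows "AE z in (lborel :: (real \<times> real) measure). R (snd z)"
proof -
  obtain N where N: "N \<in> null_sets lborel" "\<And>x. x \<in> space lborel - N \<Longrightarrow> R x"
    by (rule AE_E3[OF assms]) blast
  have "emeasure lborel ((UNIV :: real set) \<times> N) = 0"
    using lborel.emeasure_pair_measure_Times[of UNIV lborel N] N(1) by (simp add: lborel_prod null_sets_def)
  then have "(UNIV :: real set) \<times> N \<in> null_sets lborel"
    using N(1) by (auto simp: null_sets_def lborel_prod[symmetric])
  from AE_not_in[OF this] show ?thesis
  proof eventually_elim
    fix z :: "real \<times> real" assume "z \<notin> UNIV \<times> N"
    then have "snd z \<notin> N" by (cases z) auto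
    then show "R (snd z)" using N(2)[of "snd z"] by simp
  qed
qed

lemma cyl_borel [measurable]: "cyl T \<in> sets borel" "Omega \<in> sets borel"
  "{r1<..<r2 :: real} \<times> Omega \<in> sets borel"
  by (auto simp: cyl_def intro!: borel_open open_Times)

lemma borel_pair: "borel_measurable (borel :: (real \<times> real) measure) = borel_measurable (lborel \<Otimes>\<^sub>M lborel)"
  by (simp add: lborel_prod)

lemma L2_on_representative:
  fixes f :: "'a::euclidean_space \<Rightarrow> real"
  assumes f: "L2_on S f" and S: "S \<in> sets borel"
  obtains g where "square_integrable lborel g" "\<And>z. z \<notin> S \<Longrightarrow> g z = 0"
    "AE z in lborel. z \<in> S \<longrightarrow> g z = f z"
proof -
  obtain g where g: "g \<in> borel_measurable borel" "\<And>z. z \<notin> S \<Longrightarrow> g z = 0"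
    "AE z in lborel. z \<in> S \<longrightarrow> g z = f z"
  proof (rule borel_representative[OF _ S])
    show "f \<in> borel_measurable (lebesgue_on S)" using f by (simp add: L2_on_def)
  qed blast
  have "(\<lambda>z. (g z)\<^sup>2) \<in> borel_measurable borel" using g(1) by measurable
  moreover have "AE z in lborel. z \<in> S \<longrightarrow> (g z)\<^sup>2 = (f z)\<^sup>2" using g(3) by eventually_elim simp
  ultimately have "integrable lborel (\<lambda>z. (g z)\<^sup>2)"
    using lebesgue_on_representative(2)[of "\<lambda>z. (g z)\<^sup>2" S "\<lambda>z. (f z)\<^sup>2"] g(2) S f by (simp add: L2_on_def)
  then show ?thesis using g by (intro that[of g]) (simp_all add: square_integrable_def)
qed

lemma L2_on_square_integrable: "L2_on S f \<longleftrightarrow> square_integrable (lebesgue_on S) f"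
  by (simp add: L2_on_def square_integrable_def)

lemma square_integrable_Pair:
  fixes f :: "real \<times> real \<Rightarrow> real"
  assumes f: "square_integrable lborel f"
  shows "AE s in lborel. square_integrable lborel (\<lambda>x. f (s, x))"
proof -
  have [measurable]: "f \<in> borel_measurable (lborel \<Otimes>\<^sub>M lborel)" using f by (simp add: square_integrable_def lborel_prod)
  have "AE s in lborel. integrable lborel (\<lambda>x. (f (s, x))\<^sup>2)"
    using lborel_pair.AE_integrable_fst'[of "\<lambda>z. (f z)\<^sup>2"] f by (simp add: square_integrable_def lborel_prod)
  then show ?thesis by eventually_elim (simp add: square_integrable_def)
qed

text \<open>The slab \<open>(r\<^sub>1, r\<^sub>2) \<times> \<Omega>\<close> has finite extent in time, so functions of \<open>x\<close> alone are
  square integrable on it.\<close>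

lemma pairing_slab:
  fixes P :: "real \<times> real \<Rightarrow> real" and v :: "real \<Rightarrow> real"
  assumes P: "square_integrable lborel P" and v: "square_integrable lborel v"
  shows "integrable lborel (\<lambda>z. indicator {r1<..<r2} (fst z) * (P z * v (snd z)))"
    "(\<integral>z. indicator {r1<..<r2} (fst z) * (P z * v (snd z)) \<partial>lborel)
      = (\<integral>x. (\<integral>r. indicator {r1<..<r2} r * P (r, x) \<partial>lborel) * v x \<partial>lborel)"
proof -
  have [measurable]: "v \<in> borel_measurable borel" "P \<in> borel_measurable (lborel \<Otimes>\<^sub>M lborel)"
    using v P by (simp_all add: square_integrable_def lborel_prod)
  have m: "(\<lambda>z. indicator {r1<..<r2} (fst z) * v (snd z)) \<in> borel_measurable (lborel \<Otimes>\<^sub>M lborel)" by measurable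
  have "integrable (lborel \<Otimes>\<^sub>M lborel) (\<lambda>z. (indicator {r1<..<r2} (fst z) * v (snd z))\<^sup>2)"
  proof (rule lborel_pair.Fubini_integrable)
    show "integrable lborel (\<lambda>s. \<integral>x. norm ((indicator {r1<..<r2} (fst (s, x)) * v (snd (s, x)))\<^sup>2) \<partial>lborel)"
    proof -
      have "(\<lambda>s. \<integral>x. norm ((indicator {r1<..<r2} (fst (s, x)) * v (snd (s, x)))\<^sup>2) \<partial>lborel)
         = (\<lambda>s. (\<integral>x. (v x)\<^sup>2 \<partial>lborel) * indicator {r1<..<r2} s)"
        by (auto simp: fun_eq_iff indicator_def)
      moreover have "integrable lborel (indicator {r1<..<r2} :: real \<Rightarrow> real)"
        by (cases "r1 \<le> r2") (auto intro!: integrable_real_indicator)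
      ultimately show ?thesis by simp
    qed
  qed (use v in \<open>auto simp: square_integrable_def indicator_def\<close>)
  then have sv: "square_integrable lborel (\<lambda>z. indicator {r1<..<r2} (fst z) * v (snd z))"
    using m by (simp add: square_integrable_def lborel_prod)
  have i: "integrable lborel (\<lambda>z. P z * (indicator {r1<..<r2} (fst z) * v (snd z)))"
    by (rule square_integrable_mult[OF P sv])
  then show "integrable lborel (\<lambda>z. indicator {r1<..<r2} (fst z) * (P z * v (snd z)))" by (simp add: mult_ac)
  have ci: "integrable (lborel \<Otimes>\<^sub>M lborel) (case_prod (\<lambda>r x. indicator {r1<..<r2} r * (P (r, x) * v x)))"
    using i by (simp add: lborel_prod split_def mult_ac)
  have "(\<integral>z. indicator {r1<..<r2} (fst z) * (P z * v (snd z)) \<partial>lborel)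
     = (\<integral>x. (\<integral>r. indicator {r1<..<r2} r * (P (r, x) * v x) \<partial>lborel) \<partial>lborel)"
    using lborel_pair.integral_snd[OF ci] by (simp add: lborel_prod split_def)
  also have "\<dots> = (\<integral>x. (\<integral>r. indicator {r1<..<r2} r * P (r, x) \<partial>lborel) * v x \<partial>lborel)"
  proof (rule Bochner_Integration.integral_cong[OF refl])
    fix x
    show "(\<integral>r. indicator {r1<..<r2} r * (P (r, x) * v x) \<partial>lborel) = (\<integral>r. indicator {r1<..<r2} r * P (r, x) \<partial>lborel) * v x"
      by (simp only: mult.assoc[symmetric] integral_mult_left_zero)
  qed
  finally show "(\<integral>z. indicator {r1<..<r2} (fst z) * (P z * v (snd z)) \<partial>lborel)
      = (\<integral>x. (\<integral>r. indicator {r1<..<r2} r * P (r, x) \<partial>lborel) * v x \<partial>lborel)" .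
qed

text \<open>Expanding the square around \<open>u t\<close> leaves the squared distance and a cross
  term, and Cauchy-Schwarz makes both small.\<close>

lemma continuous_on_L2_norm:
  assumes u: "\<And>t. t \<in> S \<Longrightarrow> square_integrable M (u t)"
    and c: "\<And>t. t \<in> S \<Longrightarrow> ((\<lambda>s. \<integral>x. (u s x - u t x)\<^sup>2 \<partial>M) \<longlongrightarrow> 0) (at t within S)"
  shows "continuous_on S (\<lambda>t. \<integral>x. (u t x)\<^sup>2 \<partial>M)"
  unfolding continuous_on_def
proof
  fix t assume t: "t \<in> S"
  let ?d = "\<lambda>s. \<integral>x. (u s x - u t x)\<^sup>2 \<partial>M" and ?N = "\<lambda>t. \<integral>x. (u t x)\<^sup>2 \<partial>M"
  have bound: "\<bar>?N s - ?N t\<bar> \<le> ?d s + 2 * (sqrt (?d s) * sqrt (?N t))" if s: "s \<in> S" for s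
  proof -
    note sd = square_integrable_diff[OF u[OF s] u[OF t]]
    have "?N s = (\<integral>x. (u s x - u t x)\<^sup>2 + 2 * ((u s x - u t x) * u t x) + (u t x)\<^sup>2 \<partial>M)"
      by (rule Bochner_Integration.integral_cong) (auto simp: power2_eq_square algebra_simps)
    also have "\<dots> = ?d s + 2 * (\<integral>x. (u s x - u t x) * u t x \<partial>M) + ?N t"
      using sd u[OF t] square_integrable_mult[OF sd u[OF t]] by (simp add: square_integrable_def)
    finally have eq: "?N s - ?N t = ?d s + 2 * (\<integral>x. (u s x - u t x) * u t x \<partial>M)" by simp
    have "\<bar>\<integral>x. (u s x - u t x) * u t x \<partial>M\<bar> \<le> (\<integral>x. \<bar>(u s x - u t x) * u t x\<bar> \<partial>M)"
      using integral_norm_bound[of M "\<lambda>x. (u s x - u t x) * u t x"] by simp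
    also have "\<dots> \<le> sqrt (?d s) * sqrt (?N t)" by (rule Cauchy_Schwarz_integral_abs[OF sd u[OF t]])
    finally have le: "\<bar>\<integral>x. (u s x - u t x) * u t x \<partial>M\<bar> \<le> sqrt (?d s) * sqrt (?N t)" .
    have "\<bar>?d s + 2 * (\<integral>x. (u s x - u t x) * u t x \<partial>M)\<bar> \<le> \<bar>?d s\<bar> + 2 * \<bar>\<integral>x. (u s x - u t x) * u t x \<partial>M\<bar>"
      by (rule order_trans[OF abs_triangle_ineq]) simp
    also have "\<dots> \<le> ?d s + 2 * (sqrt (?d s) * sqrt (?N t))"
      using le by simp
    finally show ?thesis unfolding eq .
  qed
  have "((\<lambda>s. ?d s + 2 * (sqrt (?d s) * sqrt (?N t))) \<longlongrightarrow> 0 + 2 * (sqrt 0 * sqrt (?N t))) (at t within S)"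
    by (intro tendsto_intros c[OF t])
  then have lim: "((\<lambda>s. ?d s + 2 * (sqrt (?d s) * sqrt (?N t))) \<longlongrightarrow> 0) (at t within S)"
    by (simp only: real_sqrt_zero mult_zero_left mult_zero_right add_0)
  have "((\<lambda>s. ?N s - ?N t) \<longlongrightarrow> 0) (at t within S)"
  proof (rule Lim_null_comparison[OF _ lim])
    have "eventually (\<lambda>s. s \<in> S) (at t within S)" by (simp add: eventually_at_filter)
    then show "eventually (\<lambda>s. norm (?N s - ?N t) \<le> ?d s + 2 * (sqrt (?d s) * sqrt (?N t))) (at t within S)"
      by eventually_elim (simp only: real_norm_def bound)
  qed
  then show "(?N \<longlongrightarrow> ?N t) (at t within S)" by (rule LIM_zero_cancel)
qed

section \<open>From the weak formulation to the energy identity\<close>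

lemma AE_lebesgue_on_iff:
  fixes S :: "'a::euclidean_space set"
  assumes "S \<in> sets borel"
  shows "(AE x in lebesgue_on S. R x) \<longleftrightarrow> (AE x in lborel. x \<in> S \<longrightarrow> R x)"
  using assms by (subst AE_restrict_space_iff) (auto simp: AE_completion_iff)

text \<open>\<open>f\<close> and \<open>g\<close> are left general because two cases arise: the
  representatives of the solution frozen at one time and read as functions of \<open>(r, x)\<close>,
  and the representatives themselves.\<close>

lemma slab_integral_representative:
  fixes P q :: "real \<Rightarrow> real \<Rightarrow> real"
  assumes Ph: "square_integrable lborel Ph" "\<And>z. z \<notin> cyl T \<Longrightarrow> Ph z = 0" "AE z in lborel. z \<in> cyl T \<longrightarrow> Ph z = case_prod P z"
    and Qh: "square_integrable lborel Qh" "\<And>z. z \<notin> cyl T \<Longrightarrow> Qh z = 0" "AE z in lborel. z \<in> cyl T \<longrightarrow> Qh z = case_prod q z"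
    and v: "f \<in> borel_measurable borel" "AE z in lborel. z \<in> cyl T \<longrightarrow> f z = f' z"
    and w: "g \<in> borel_measurable borel" "AE z in lborel. z \<in> cyl T \<longrightarrow> g z = g' z"
    and i: "integrable lborel (\<lambda>z. indicator {r1<..<r2} (fst z) * (Ph z * f z))"
       "integrable lborel (\<lambda>z. indicator {r1<..<r2} (fst z) * (Qh z * g z))"
    and r: "0 \<le> r1" "r2 \<le> T"
  shows "(LINT z|lebesgue_on ({r1<..<r2} \<times> Omega). case_prod P z * f' z + case_prod q z * g' z)
     = (\<integral>z. indicator {r1<..<r2} (fst z) * (Ph z * f z) \<partial>lborel) + (\<integral>z. indicator {r1<..<r2} (fst z) * (Qh z * g z) \<partial>lborel)"
    (is "?L = ?R")
proof -
  have "?L = (\<integral>z. indicator {r1<..<r2} (fst z) * (Ph z * f z) + indicator {r1<..<r2} (fst z) * (Qh z * g z) \<partial>lborel)"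
  proof (rule lebesgue_on_representative(3))
    show "(\<lambda>z. indicator {r1<..<r2} (fst z) * (Ph z * f z) + indicator {r1<..<r2} (fst z) * (Qh z * g z)) \<in> borel_measurable borel"
      using i by (intro borel_measurable_add) auto
    show "indicator {r1<..<r2} (fst z) * (Ph z * f z) + indicator {r1<..<r2} (fst z) * (Qh z * g z) = 0"
      if "z \<notin> {r1<..<r2} \<times> Omega" for z
    proof (cases "fst z \<in> {r1<..<r2}")
      case True
      then have "z \<notin> cyl T" using that by (cases z) (auto simp: cyl_def)
      then show ?thesis using Ph(2) Qh(2) by simp
    qed simp
    show "AE z in lborel. z \<in> {r1<..<r2} \<times> Omega \<longrightarrow>
       indicator {r1<..<r2} (fst z) * (Ph z * f z) + indicator {r1<..<r2} (fst z) * (Qh z * g z)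
         = case_prod P z * f' z + case_prod q z * g' z"
      using Ph(3) Qh(3) v(2) w(2)
    proof eventually_elim
      case (elim z)
      show ?case
      proof
        assume z: "z \<in> {r1<..<r2} \<times> Omega"
        then have "z \<in> cyl T" using r by (auto simp: cyl_def)
        then show "indicator {r1<..<r2} (fst z) * (Ph z * f z) + indicator {r1<..<r2} (fst z) * (Qh z * g z)
           = case_prod P z * f' z + case_prod q z * g' z" using elim z by auto
      qed
    qed
  qed simp
  also have "\<dots> = ?R" using i by simp
  finally show ?thesis .
qed

text \<open>For almost every \<open>s\<close> the slice \<open>u s\<close> lies in
  \<open>H1a a\<close> and is an admissible test function; this supplies the hypothesis of
  \<open>energy_identity\<close>. \<open>P\<close> is the flux and \<open>q\<close> the zero-order
  part, so that the forward and the backward equation are both covered.\<close>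

lemma solution_energy:
  fixes a :: "real \<Rightarrow> real" and u P q :: "real \<Rightarrow> real \<Rightarrow> real"
  assumes u: "u \<in> solution_space a T" and P: "L2_on (cyl T) (case_prod P)" and q: "L2_on (cyl T) (case_prod q)"
    and weak: "\<And>r1 r2 w. 0 \<le> r1 \<Longrightarrow> r1 \<le> r2 \<Longrightarrow> r2 \<le> T \<Longrightarrow> w \<in> H1a a \<Longrightarrow>
      (LINT x|lebesgue_on Omega. u r2 x * w x) - (LINT x|lebesgue_on Omega. u r1 x * w x)
       = - (LINT z|lebesgue_on ({r1<..<r2} \<times> Omega). (case z of (s, x) \<Rightarrow> P s x * (sqrt (a x) * deriv w x) + q s x * w x))"
    and t: "0 \<le> t1" "t1 < t2" "t2 \<le> T"
  shows "(LINT x|lebesgue_on Omega. (u t2 x)\<^sup>2) - (LINT x|lebesgue_on Omega. (u t1 x)\<^sup>2)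
     = - 2 * (LINT z|lebesgue_on ({t1<..<t2} \<times> Omega). (case z of (s, x) \<Rightarrow> P s x * (sqrt (a x) * deriv (u s) x) + q s x * u s x))"
proof -
  have uspace: "AE t in lebesgue_on {0<..<T}. u t \<in> H1a a"
    "L2_on (cyl T) (\<lambda>(t, x). u t x)" "L2_on (cyl T) (\<lambda>(t, x). sqrt (a x) * deriv (u t) x)"
    "\<And>t. t \<in> {0..T} \<Longrightarrow> L2_on Omega (u t)"
    "\<And>t. t \<in> {0..T} \<Longrightarrow> ((\<lambda>s. LINT x|lebesgue_on Omega. (u s x - u t x)\<^sup>2) \<longlongrightarrow> 0) (at t within {0..T})"
    using u by (simp_all add: solution_space_def)
  have cb: "cyl T \<in> sets borel" by (rule cyl_borel)
  from L2_on_representative[OF P cb] obtain Ph where Ph: "square_integrable lborel Ph" "\<And>z. z \<notin> cyl T \<Longrightarrow> Ph z = 0"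
    "AE z in lborel. z \<in> cyl T \<longrightarrow> Ph z = case_prod P z" by blast
  from L2_on_representative[OF q cb] obtain Qh where Qh: "square_integrable lborel Qh" "\<And>z. z \<notin> cyl T \<Longrightarrow> Qh z = 0"
    "AE z in lborel. z \<in> cyl T \<longrightarrow> Qh z = case_prod q z" by blast
  from L2_on_representative[OF uspace(2) cb] obtain Uh where Uh: "square_integrable lborel Uh" "\<And>z. z \<notin> cyl T \<Longrightarrow> Uh z = 0"
    "AE z in lborel. z \<in> cyl T \<longrightarrow> Uh z = (case z of (t, x) \<Rightarrow> u t x)" by blast
  from L2_on_representative[OF uspace(3) cb] obtain Vh where Vh: "square_integrable lborel Vh" "\<And>z. z \<notin> cyl T \<Longrightarrow> Vh z = 0"
    "AE z in lborel. z \<in> cyl T \<longrightarrow> Vh z = (case z of (t, x) \<Rightarrow> sqrt (a x) * deriv (u t) x)" by blast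
  define k where "k r s = (LINT x|lebesgue_on Omega. u r x * u s x)" for r s
  have kk: "k s s = (LINT x|lebesgue_on Omega. (u s x)\<^sup>2)" for s by (simp add: k_def power2_eq_square)
  have cont: "continuous_on {0..T} (\<lambda>t. LINT x|lebesgue_on Omega. (u t x)\<^sup>2)"
    using uspace(4,5) by (intro continuous_on_L2_norm) (simp_all add: L2_on_square_integrable)
  have conv: "(case z of (s, x) \<Rightarrow> P s x * f s x + q s x * g s x) = case_prod P z * case_prod f z + case_prod q z * case_prod g z"
    for z f g by (simp add: split_def)
  have m: "Uh \<in> borel_measurable borel" "Vh \<in> borel_measurable borel" using Uh(1) Vh(1) by (simp_all add: square_integrable_def)
  have "k t2 t2 - k t1 t1 = - 2 * ((\<integral>z. indicator {t1<..<t2} (fst z) * (Ph z * Vh z) \<partial>lborel)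
                                  + (\<integral>z. indicator {t1<..<t2} (fst z) * (Qh z * Uh z) \<partial>lborel))"
  proof (rule energy_identity[where k = k, OF Ph(1) Vh(1) Qh(1) Uh(1) t(2)])
    show "k r s = k s r" for r s by (simp add: k_def mult.commute)
    show "continuous_on {t1..t2} (\<lambda>t. k t t)" unfolding kk
      by (rule continuous_on_subset[OF cont]) (use t in auto)
    have "AE s in lborel. s \<in> {0<..<T} \<longrightarrow> u s \<in> H1a a"
      using uspace(1) by (subst (asm) AE_lebesgue_on_iff) auto
    with AE_lborel_Pair[OF Uh(3)] AE_lborel_Pair[OF Vh(3)] square_integrable_Pair[OF Uh(1)] square_integrable_Pair[OF Vh(1)]
    show "AE s in lborel. s \<in> {t1<..<t2} \<longrightarrow> (\<forall>r1 r2. t1 \<le> r1 \<longrightarrow> r1 \<le> r2 \<longrightarrow> r2 \<le> t2 \<longrightarrow>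
       k r2 s - k r1 s = - (\<integral>x. (\<integral>r. indicator {r1<..<r2} r * Ph (r, x) \<partial>lborel) * Vh (s, x) \<partial>lborel)
                         - (\<integral>x. (\<integral>r. indicator {r1<..<r2} r * Qh (r, x) \<partial>lborel) * Uh (s, x) \<partial>lborel))"
    proof eventually_elim
      case (elim s)
      show ?case
      proof (intro impI allI)
        fix r1 r2 assume s: "s \<in> {t1<..<t2}" and r: "t1 \<le> r1" "r1 \<le> r2" "r2 \<le> t2"
        have us: "u s \<in> H1a a" using elim(5) s t by auto
        \<comment> \<open>With \<open>s\<close> frozen, the representative agrees with the slice for
          almost every \<open>x\<close>, hence for almost every point \<open>(r, x)\<close> of the
          cylinder.\<close>
        have aeU: "AE z in (lborel :: (real \<times> real) measure). z \<in> cyl T \<longrightarrow> Uh (s, snd z) = case_prod (\<lambda>r x. u s x) z"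
          using AE_lborel_snd[OF elim(1)] by eventually_elim (use s t in \<open>auto simp: cyl_def\<close>)
        have aeV: "AE z in (lborel :: (real \<times> real) measure). z \<in> cyl T \<longrightarrow> Vh (s, snd z) = case_prod (\<lambda>r x. sqrt (a x) * deriv (u s) x) z"
          using AE_lborel_snd[OF elim(2)] by eventually_elim (use s t in \<open>auto simp: cyl_def\<close>)
        have ms: "(\<lambda>z::real \<times> real. Uh (s, snd z)) \<in> borel_measurable borel" "(\<lambda>z::real \<times> real. Vh (s, snd z)) \<in> borel_measurable borel"
          using elim(3,4) unfolding square_integrable_def borel_pair by auto
        have "(LINT z|lebesgue_on ({r1<..<r2} \<times> Omega). case_prod P z * case_prod (\<lambda>r x. sqrt (a x) * deriv (u s) x) z + case_prod q z * case_prod (\<lambda>r x. u s x) z)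
          = (\<integral>z. indicator {r1<..<r2} (fst z) * (Ph z * Vh (s, snd z)) \<partial>lborel) + (\<integral>z. indicator {r1<..<r2} (fst z) * (Qh z * Uh (s, snd z)) \<partial>lborel)"
          by (rule slab_integral_representative[OF Ph Qh ms(2) aeV ms(1) aeU
            pairing_slab(1)[OF Ph(1) elim(4)] pairing_slab(1)[OF Qh(1) elim(3)]]) (use r t in auto)
        also have "\<dots> = (\<integral>x. (\<integral>r. indicator {r1<..<r2} r * Ph (r, x) \<partial>lborel) * Vh (s, x) \<partial>lborel)
                  + (\<integral>x. (\<integral>r. indicator {r1<..<r2} r * Qh (r, x) \<partial>lborel) * Uh (s, x) \<partial>lborel)"
          by (simp only: pairing_slab(2)[OF Ph(1) elim(4)] pairing_slab(2)[OF Qh(1) elim(3)])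
        finally have "k r2 s - k r1 s = - ((\<integral>x. (\<integral>r. indicator {r1<..<r2} r * Ph (r, x) \<partial>lborel) * Vh (s, x) \<partial>lborel)
                  + (\<integral>x. (\<integral>r. indicator {r1<..<r2} r * Qh (r, x) \<partial>lborel) * Uh (s, x) \<partial>lborel))"
          using weak[of r1 r2 "u s"] us r t unfolding k_def conv by simp
        then show "k r2 s - k r1 s = - (\<integral>x. (\<integral>r. indicator {r1<..<r2} r * Ph (r, x) \<partial>lborel) * Vh (s, x) \<partial>lborel)
                         - (\<integral>x. (\<integral>r. indicator {r1<..<r2} r * Qh (r, x) \<partial>lborel) * Uh (s, x) \<partial>lborel)" by simp
      qed
    qed
  qed
  moreover have "(LINT z|lebesgue_on ({t1<..<t2} \<times> Omega). case_prod P z * case_prod (\<lambda>s x. sqrt (a x) * deriv (u s) x) z + case_prod q z * case_prod u z)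
     = (\<integral>z. indicator {t1<..<t2} (fst z) * (Ph z * Vh z) \<partial>lborel) + (\<integral>z. indicator {t1<..<t2} (fst z) * (Qh z * Uh z) \<partial>lborel)"
  proof (rule slab_integral_representative[OF Ph Qh m(2) _ m(1)])
    show "integrable lborel (\<lambda>z. indicator {t1<..<t2} (fst z) * (Ph z * Vh z))"
      using square_integrable_mult[OF square_integrable_indicator_fst[OF Ph(1)] Vh(1), of "{t1<..<t2}"] by (simp add: mult_ac)
    show "integrable lborel (\<lambda>z. indicator {t1<..<t2} (fst z) * (Qh z * Uh z))"
      using square_integrable_mult[OF square_integrable_indicator_fst[OF Qh(1)] Uh(1), of "{t1<..<t2}"] by (simp add: mult_ac)
  qed (use t Uh(3) Vh(3) in simp_all)
  ultimately show ?thesis unfolding kk conv by simp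
qed

section \<open>Energy inequalities for weak solutions\<close>

text \<open>\<open>x a' \<le> \<tau> a\<close> says that \<open>a y * y powr (- \<tau>)\<close> is
  nonincreasing; compare with its value at 1.\<close>

lemma hypothesis_A_lower_bound:
  assumes A: "hypothesis_A a \<tau>" and x: "0 < x" "x \<le> 1"
  shows "a 1 * x powr \<tau> \<le> a x"
proof -
  obtain a' where a': "\<And>x. x \<in> {0<..1} \<Longrightarrow> (a has_real_derivative a' x) (at x within {0..1})"
    "\<And>x. x \<in> {0<..1} \<Longrightarrow> x * a' x \<le> \<tau> * a x" and cont: "continuous_on {0..1} a"
    using A unfolding hypothesis_A_def by blast
  have "a x * x powr (- \<tau>) \<ge> a 1 * 1 powr (- \<tau>)"
  proof (rule DERIV_nonpos_imp_decreasing_open[OF x(2)])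
    fix y assume y: "x < y" "y < 1"
    have "at y within {0..1} = at y" using x y by (intro at_within_Icc_at) auto
    then have d: "(a has_real_derivative a' y) (at y)" using a'(1)[of y] x y by auto
    have "((\<lambda>y. a y * y powr (- \<tau>)) has_real_derivative a' y * y powr (- \<tau>) + a y * (- \<tau> * y powr (- \<tau> - 1))) (at y)"
      using x y by (auto intro!: derivative_eq_intros d)
    moreover have "a' y * y powr (- \<tau>) + a y * (- \<tau> * y powr (- \<tau> - 1)) = (y * a' y - \<tau> * a y) * y powr (- \<tau> - 1)"
      using x y by (simp add: powr_diff field_simps)
    moreover have "\<dots> \<le> 0" using a'(2)[of y] x y by (intro mult_nonpos_nonneg) auto
    ultimately show "\<exists>d. ((\<lambda>y. a y * y powr (- \<tau>)) has_real_derivative d) (at y) \<and> d \<le> 0" by metis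
  next
    show "continuous_on {x..1} (\<lambda>y. a y * y powr (- \<tau>))"
      using x by (intro continuous_intros continuous_on_subset[OF cont]) auto
  qed
  then show ?thesis using x by (simp add: powr_minus field_simps)
qed

text \<open>Keeps \<open>x / sqrt (a x)\<close> below \<open>1 / sqrt (a 1)\<close>, which is what a
  drift of order \<open>x\<close> needs at the degenerate end.\<close>

lemma hypothesis_A_square_bound:
  assumes A: "hypothesis_A a \<tau>" and x: "0 < x" "x \<le> 1"
  shows "a 1 * x\<^sup>2 \<le> a x"
proof -
  have "x powr 2 \<le> x powr \<tau>" using A x by (intro powr_mono') (auto simp: hypothesis_A_def)
  moreover have "0 < a 1" using A by (simp add: hypothesis_A_def)
  ultimately have "a 1 * x\<^sup>2 \<le> a 1 * x powr \<tau>" using x by (simp add: powr_numeral)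
  then show ?thesis using hypothesis_A_lower_bound[OF A x] by simp
qed

lemma hypothesis_A_pos: "hypothesis_A a \<tau> \<Longrightarrow> x \<in> Omega \<Longrightarrow> 0 < a x"
  by (simp add: hypothesis_A_def)

section \<open>Integrals over slabs of the cylinder\<close>

lemma AE_lborel_fst:
  fixes R :: "real \<Rightarrow> bool"
  assumes "AE x in lborel. R x"
  shows "AE z in (lborel :: (real \<times> real) measure). R (fst z)"
proof -
  obtain N where N: "N \<in> null_sets lborel" "\<And>x. x \<in> space lborel - N \<Longrightarrow> R x"
    by (rule AE_E3[OF assms]) blast
  have "emeasure lborel (N \<times> (UNIV :: real set)) = 0"
    using lborel.emeasure_pair_measure_Times[of N lborel UNIV] N(1) by (simp add: lborel_prod null_sets_def)
  then have "N \<times> (UNIV :: real set) \<in> null_sets lborel"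
    using N(1) by (auto simp: null_sets_def lborel_prod[symmetric])
  from AE_not_in[OF this] show ?thesis
  proof eventually_elim
    fix z :: "real \<times> real" assume "z \<notin> N \<times> UNIV"
    then have "fst z \<notin> N" by (cases z) auto
    then show "R (fst z)" using N(2)[of "fst z"] by simp
  qed
qed

lemma integrable_lebesgue_on_subset:
  fixes f :: "'a::euclidean_space \<Rightarrow> real"
  assumes "integrable (lebesgue_on S) f" "S' \<subseteq> S" "S \<in> sets borel" "S' \<in> sets borel"
  shows "integrable (lebesgue_on S') f"
proof -
  have "set_integrable lebesgue S f"
    unfolding set_integrable_def using assms(1,3) by (subst (asm) integrable_restrict_space) auto
  then have "set_integrable lebesgue S' f"
    by (rule set_integrable_subset) (use assms in auto)
  then show ?thesis
    unfolding set_integrable_def using assms(4) by (subst integrable_restrict_space) auto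
qed

lemma measurable_lebesgue_on_snd:
  fixes f :: "real \<Rightarrow> real"
  assumes f: "f \<in> borel_measurable (lebesgue_on Omega)"
  shows "(\<lambda>z. f (snd z)) \<in> borel_measurable (lebesgue_on (cyl T))"
proof -
  obtain g where g: "g \<in> borel_measurable borel" "\<And>z. z \<notin> Omega \<Longrightarrow> g z = 0" "AE z in lborel. z \<in> Omega \<longrightarrow> g z = f z"
    using borel_representative[OF f cyl_borel(2)] by blast
  show ?thesis
  proof (rule lebesgue_on_representative(1))
    have "(\<lambda>z. indicator {0<..<T} (fst z) * g (snd z)) \<in> borel_measurable (lborel \<Otimes>\<^sub>M lborel)"
      using g(1) by measurable
    then show "(\<lambda>z. indicator {0<..<T} (fst z) * g (snd z)) \<in> borel_measurable borel" by (simp add: borel_pair)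
    show "indicator {0<..<T} (fst z) * g (snd z) = 0" if "z \<notin> cyl T" for z
      using that g(2) by (cases z) (auto simp: cyl_def indicator_def)
    show "AE z in lborel. z \<in> cyl T \<longrightarrow> indicator {0<..<T} (fst z) * g (snd z) = f (snd z)"
      using AE_lborel_snd[OF g(3)] by eventually_elim (auto simp: cyl_def)
  qed (rule cyl_borel)
qed

lemma L2_on_snd:
  fixes f :: "real \<Rightarrow> real"
  assumes f: "L2_on Omega f"
  shows "L2_on (cyl T) (\<lambda>z. f (snd z))"
proof -
  obtain g where g: "square_integrable lborel g" "\<And>z. z \<notin> Omega \<Longrightarrow> g z = 0" "AE z in lborel. z \<in> Omega \<longrightarrow> g z = f z"
    using L2_on_representative[OF f cyl_borel(2)] by blast
  let ?g = "\<lambda>z. indicator {0<..<T} (fst z) * (g (snd z))\<^sup>2"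
  have [measurable]: "g \<in> borel_measurable borel" using g(1) by (simp add: square_integrable_def)
  have gm: "?g \<in> borel_measurable (lborel \<Otimes>\<^sub>M lborel)" by measurable
  have "integrable (lborel \<Otimes>\<^sub>M lborel) ?g"
  proof (rule lborel_pair.Fubini_integrable[OF gm])
    have "(\<lambda>s. \<integral>x. norm (indicator {0<..<T} (fst (s, x)) * (g (snd (s, x)))\<^sup>2) \<partial>lborel)
       = (\<lambda>s. (\<integral>x. (g x)\<^sup>2 \<partial>lborel) * indicator {0<..<T} s)"
      by (auto simp: fun_eq_iff indicator_def)
    moreover have "integrable lborel (indicator {0<..<T} :: real \<Rightarrow> real)"
      by (cases "0 \<le> T") (auto intro!: integrable_real_indicator)
    ultimately show "integrable lborel (\<lambda>s. \<integral>x. norm (indicator {0<..<T} (fst (s, x)) * (g (snd (s, x)))\<^sup>2) \<partial>lborel)" by simp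
  qed (use g(1) in \<open>auto simp: square_integrable_def\<close>)
  then have gi: "integrable lborel ?g" by (simp add: lborel_prod)
  have "integrable (lebesgue_on (cyl T)) (\<lambda>z. (f (snd z))\<^sup>2)"
  proof (subst lebesgue_on_representative(2))
    show "?g \<in> borel_measurable borel" using gm by (simp add: borel_pair)
    show "indicator {0<..<T} (fst z) * (g (snd z))\<^sup>2 = 0" if "z \<notin> cyl T" for z
      using that g(2) by (cases z) (auto simp: cyl_def indicator_def)
    show "AE z in lborel. z \<in> cyl T \<longrightarrow> indicator {0<..<T} (fst z) * (g (snd z))\<^sup>2 = (f (snd z))\<^sup>2"
      using AE_lborel_snd[OF g(3)] by eventually_elim (auto simp: cyl_def)
  qed (use gi cyl_borel in auto)
  then show ?thesis using measurable_lebesgue_on_snd[of f T] f by (simp add: L2_on_def)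
qed

text \<open>The slice at \<open>r2\<close> missing from the open slabs is a null set. The weak
  formulations are anchored at 0 or at \<open>T\<close>; this additivity moves them to arbitrary
  slabs.\<close>

lemma slab_integral_diff:
  fixes H :: "real \<times> real \<Rightarrow> real"
  assumes H: "integrable (lebesgue_on (cyl T)) H" and r: "0 \<le> r1" "r1 \<le> r2" "r2 \<le> r3" "r3 \<le> T"
  shows "(LINT z|lebesgue_on ({r1<..<r3} \<times> Omega). H z)
     = (LINT z|lebesgue_on ({r1<..<r2} \<times> Omega). H z) + (LINT z|lebesgue_on ({r2<..<r3} \<times> Omega). H z)"
proof -
  obtain h where h: "h \<in> borel_measurable borel" "\<And>z. z \<notin> cyl T \<Longrightarrow> h z = 0" "AE z in lborel. z \<in> cyl T \<longrightarrow> h z = H z"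
    using borel_representative[OF borel_measurable_integrable[OF H] cyl_borel(1)] by blast
  have hi: "integrable lborel h" using lebesgue_on_representative(2)[OF h cyl_borel(1)] H by simp
  have slab: "(LINT z|lebesgue_on ({s1<..<s2} \<times> Omega). H z) = (\<integral>z. indicator ({s1<..<s2} \<times> Omega) z * h z \<partial>lborel)"
    if "0 \<le> s1" "s2 \<le> T" for s1 s2
  proof (rule lebesgue_on_representative(3))
    have "{s1<..<s2} \<times> Omega \<in> sets borel" by (rule cyl_borel)
    then show "(\<lambda>z. indicator ({s1<..<s2} \<times> Omega) z * h z) \<in> borel_measurable borel" using h(1) by auto
    show "AE z in lborel. z \<in> {s1<..<s2} \<times> Omega \<longrightarrow> indicator ({s1<..<s2} \<times> Omega) z * h z = H z"
      using h(3) by eventually_elim (use that in \<open>auto simp: cyl_def\<close>)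
  qed (auto simp: cyl_borel)
  have i: "integrable lborel (\<lambda>z. indicator ({s1<..<s2} \<times> Omega) z * h z)" for s1 s2
    using integrable_mult_indicator[OF _ hi, of "{s1<..<s2} \<times> Omega"] cyl_borel(3)[of s1 s2] by simp
  have "(\<integral>z. indicator ({r1<..<r3} \<times> Omega) z * h z \<partial>lborel)
     = (\<integral>z. indicator ({r1<..<r2} \<times> Omega) z * h z + indicator ({r2<..<r3} \<times> Omega) z * h z \<partial>lborel)"
  proof (rule integral_cong_AE)
    have "AE z in (lborel :: (real \<times> real) measure). fst z \<noteq> r2"
      by (rule AE_lborel_fst) (rule AE_lborel_singleton)
    then show "AE z in lborel. indicator ({r1<..<r3} \<times> Omega) z * h z
        = indicator ({r1<..<r2} \<times> Omega) z * h z + indicator ({r2<..<r3} \<times> Omega) z * h z"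
    proof eventually_elim
      case (elim z)
      obtain s x where z: "z = (s, x)" by (cases z)
      show ?case
      proof (cases "x \<in> Omega")
        case True
        then show ?thesis using elim r z by (cases "s < r2") (auto simp: indicator_def)
      qed (simp add: z)
    qed
    show "(\<lambda>z. indicator ({r1<..<r3} \<times> Omega) z * h z) \<in> borel_measurable lborel"
      by (rule borel_measurable_integrable[OF i])
    show "(\<lambda>z. indicator ({r1<..<r2} \<times> Omega) z * h z + indicator ({r2<..<r3} \<times> Omega) z * h z) \<in> borel_measurable lborel"
      by (intro borel_measurable_add borel_measurable_integrable[OF i])
  qed
  then show ?thesis using r i by (simp add: slab)
qed

section \<open>Bounded coefficients and energy inequalities\<close>

lemma Linf_on_AE:
  assumes f: "Linf_on S f" and S: "S \<in> sets borel"
  shows "f \<in> borel_measurable (lebesgue_on S)" "AE z in lborel. z \<in> S \<longrightarrow> \<bar>f z\<bar> \<le> \<bar>Linf_norm S f\<bar>"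
proof -
  show "f \<in> borel_measurable (lebesgue_on S)" using f by (simp add: Linf_on_def)
  let ?e = "esssup (lebesgue_on S) (\<lambda>z. ereal \<bar>f z\<bar>)"
  have "AE z in lebesgue_on S. ereal \<bar>f z\<bar> \<le> ?e" by (rule esssup_AE)
  \<comment> \<open>A finite essential supremum is read off from the pointwise bound, which excludes
    the value -\<infinity>; the absolute value makes the bound nonnegative at once.\<close>
  then have "AE z in lebesgue_on S. \<bar>f z\<bar> \<le> \<bar>Linf_norm S f\<bar>"
  proof eventually_elim
    fix z assume z: "ereal \<bar>f z\<bar> \<le> ?e"
    have "?e < \<infinity>" using f by (simp add: Linf_on_def)
    with z obtain e where "?e = ereal e" by (cases ?e) auto
    then show "\<bar>f z\<bar> \<le> \<bar>Linf_norm S f\<bar>" using z by (simp add: Linf_norm_def)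
  qed
  then show "AE z in lborel. z \<in> S \<longrightarrow> \<bar>f z\<bar> \<le> \<bar>Linf_norm S f\<bar>" by (simp add: AE_lebesgue_on_iff[OF S])
qed

text \<open>The drift \<open>\<beta> g u_x\<close> is \<open>\<beta> g / sqrt a\<close> times
  \<open>sqrt a u_x\<close>. The quotient is bounded although \<open>a\<close> vanishes at 0, since
  it equals \<open>\<beta> / x\<close> times \<open>g\<close> times
  \<open>x / sqrt a\<close>.\<close>

lemma drift_coefficient:
  fixes g :: "real \<Rightarrow> real \<Rightarrow> real"
  assumes A: "hypothesis_A a \<tau>" and \<beta>: "Linf_on Omega (\<lambda>x. \<beta> x / x)" and g: "Linf_on (cyl T) (case_prod g)"
  shows "(\<lambda>z. \<beta> (snd z) * case_prod g z / sqrt (a (snd z))) \<in> borel_measurable (lebesgue_on (cyl T))"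
    "AE z in lborel. z \<in> cyl T \<longrightarrow> \<bar>\<beta> (snd z) * case_prod g z / sqrt (a (snd z))\<bar>
       \<le> \<bar>Linf_norm Omega (\<lambda>x. \<beta> x / x)\<bar> * \<bar>Linf_norm (cyl T) (case_prod g)\<bar> / sqrt (a 1)"
proof -
  have eq: "\<beta> (snd z) * case_prod g z / sqrt (a (snd z)) = \<beta> (snd z) / snd z * case_prod g z * (snd z / sqrt (a (snd z)))"
    if "z \<in> cyl T" for z using that by (auto simp: cyl_def)
  have "continuous_on Omega (\<lambda>x. x / sqrt (a x))"
  proof (intro continuous_intros)
    show "continuous_on Omega a" using A by (auto simp: hypothesis_A_def intro: continuous_on_subset)
    show "\<forall>x\<in>Omega. sqrt (a x) \<noteq> 0" using hypothesis_A_pos[OF A] by fastforce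
  qed
  then have "(\<lambda>x. x / sqrt (a x)) \<in> borel_measurable (lebesgue_on Omega)"
    by (rule continuous_imp_measurable_on_sets_lebesgue) auto
  then have "(\<lambda>z. snd z / sqrt (a (snd z))) \<in> borel_measurable (lebesgue_on (cyl T))"
    by (rule measurable_lebesgue_on_snd)
  moreover have "(\<lambda>z. \<beta> (snd z) / snd z) \<in> borel_measurable (lebesgue_on (cyl T))"
    by (rule measurable_lebesgue_on_snd) (rule Linf_on_AE(1)[OF \<beta> cyl_borel(2)])
  moreover note Linf_on_AE(1)[OF g cyl_borel(1)]
  ultimately have "(\<lambda>z. \<beta> (snd z) / snd z * case_prod g z * (snd z / sqrt (a (snd z)))) \<in> borel_measurable (lebesgue_on (cyl T))"
    by measurable
  then show "(\<lambda>z. \<beta> (snd z) * case_prod g z / sqrt (a (snd z))) \<in> borel_measurable (lebesgue_on (cyl T))"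
    using eq by (subst measurable_cong) (auto simp del: times_divide_eq_left times_divide_eq_right)
  have a1: "0 < a 1" using A by (simp add: hypothesis_A_def)
  let ?b = "\<bar>Linf_norm Omega (\<lambda>x. \<beta> x / x)\<bar>" and ?g = "\<bar>Linf_norm (cyl T) (case_prod g)\<bar>"
  show "AE z in lborel. z \<in> cyl T \<longrightarrow> \<bar>\<beta> (snd z) * case_prod g z / sqrt (a (snd z))\<bar> \<le> ?b * ?g / sqrt (a 1)"
    using AE_lborel_snd[OF Linf_on_AE(2)[OF \<beta> cyl_borel(2)]] Linf_on_AE(2)[OF g cyl_borel(1)]
  proof eventually_elim
    case (elim z)
    show ?case
    proof
      assume z: "z \<in> cyl T"
      then have x: "snd z \<in> Omega" by (auto simp: cyl_def)
      have "sqrt (a 1) * snd z = sqrt (a 1 * (snd z)\<^sup>2)" using x by (simp add: real_sqrt_mult)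
      also have "\<dots> \<le> sqrt (a (snd z))" using hypothesis_A_square_bound[OF A, of "snd z"] x by simp
      finally have "snd z / sqrt (a (snd z)) \<le> 1 / sqrt (a 1)"
        using hypothesis_A_pos[OF A x] a1 by (simp add: field_simps)
      moreover have "0 \<le> snd z / sqrt (a (snd z))" using x hypothesis_A_pos[OF A x] by simp
      ultimately have "\<bar>\<beta> (snd z) / snd z\<bar> * \<bar>case_prod g z\<bar> * \<bar>snd z / sqrt (a (snd z))\<bar> \<le> ?b * ?g * (1 / sqrt (a 1))"
        using elim x z by (intro mult_mono) auto
      then show "\<bar>\<beta> (snd z) * case_prod g z / sqrt (a (snd z))\<bar> \<le> ?b * ?g / sqrt (a 1)"
        unfolding eq[OF z] abs_mult by simp
    qed
  qed
qed

text \<open>Completing squares: \<open>2 (v + \<gamma> u / 2)^2\<close> absorbs the gradient and the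
  drift, \<open>(f - u)^2\<close> the source, which explains the constants \<open>G^2 / 2\<close>
  and 1.\<close>

lemma energy_density_bound:
  fixes v u c \<gamma> f B G :: real
  assumes "\<bar>c\<bar> \<le> B" "\<bar>\<gamma>\<bar> \<le> G"
  shows "- 2 * (v\<^sup>2 + c * u\<^sup>2 + \<gamma> * v * u - f * u) \<le> (2 * B + G\<^sup>2 / 2 + 1) * u\<^sup>2 + f\<^sup>2"
proof -
  have G: "\<gamma>\<^sup>2 \<le> G\<^sup>2" using assms(2) by (metis abs_le_square_iff abs_of_nonneg abs_ge_zero order_trans)
  have "0 \<le> 2 * (v + \<gamma> * u / 2)\<^sup>2 + (f - u)\<^sup>2" by simp
  also have "\<dots> = 2 * v\<^sup>2 + 2 * \<gamma> * v * u + \<gamma>\<^sup>2 / 2 * u\<^sup>2 + f\<^sup>2 - 2 * f * u + u\<^sup>2"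
    by (simp add: power2_eq_square field_simps)
  also have "\<dots> \<le> 2 * v\<^sup>2 + 2 * \<gamma> * v * u + G\<^sup>2 / 2 * u\<^sup>2 + f\<^sup>2 - 2 * f * u + u\<^sup>2"
    using mult_right_mono[OF G, of "u\<^sup>2"] by simp
  finally have 1: "0 \<le> 2 * v\<^sup>2 + 2 * \<gamma> * v * u + G\<^sup>2 / 2 * u\<^sup>2 + f\<^sup>2 - 2 * f * u + u\<^sup>2" .
  have "- c * u\<^sup>2 \<le> B * u\<^sup>2" using assms(1) by (intro mult_right_mono) auto
  then show ?thesis using 1 by (simp add: algebra_simps)
qed

lemma slab_energy_inequality:
  fixes a :: "real \<Rightarrow> real" and u c \<gamma> F P q :: "real \<Rightarrow> real \<Rightarrow> real"
  assumes u: "u \<in> solution_space a T"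
    and c: "case_prod c \<in> borel_measurable (lebesgue_on (cyl T))" "AE z in lborel. z \<in> cyl T \<longrightarrow> \<bar>case_prod c z\<bar> \<le> B"
    and \<gamma>: "case_prod \<gamma> \<in> borel_measurable (lebesgue_on (cyl T))" "AE z in lborel. z \<in> cyl T \<longrightarrow> \<bar>case_prod \<gamma> z\<bar> \<le> G"
    and F: "L2_on (cyl T) (case_prod F)"
    and t: "0 \<le> t1" "t2 \<le> T"
  shows "- 2 * (LINT z|lebesgue_on ({t1<..<t2} \<times> Omega). (case z of (s, x) \<Rightarrow> (sqrt (a x) * deriv (u s) x)\<^sup>2
         + c s x * (u s x)\<^sup>2 + \<gamma> s x * (sqrt (a x) * deriv (u s) x) * u s x - F s x * u s x))
     \<le> (2 * B + G\<^sup>2 / 2 + 1) * (LINT z|lebesgue_on ({t1<..<t2} \<times> Omega). (case z of (s, x) \<Rightarrow> (u s x)\<^sup>2))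
       + (LINT z|lebesgue_on ({t1<..<t2} \<times> Omega). (case z of (s, x) \<Rightarrow> (F s x)\<^sup>2))"
proof -
  let ?S = "{t1<..<t2} \<times> Omega" and ?M = "lebesgue_on (cyl T)"
  let ?V = "\<lambda>z. sqrt (a (snd z)) * deriv (u (fst z)) (snd z)" and ?U = "\<lambda>z. u (fst z) (snd z)"
    and ?F = "\<lambda>z. F (fst z) (snd z)" and ?c = "\<lambda>z. c (fst z) (snd z)" and ?\<gamma> = "\<lambda>z. \<gamma> (fst z) (snd z)"
  have sU: "square_integrable ?M ?U" and sV: "square_integrable ?M ?V" and sF: "square_integrable ?M ?F"
    using u F by (auto simp: solution_space_def L2_on_square_integrable split_def)
  have cm: "?c \<in> borel_measurable ?M" "AE z in ?M. \<bar>?c z\<bar> \<le> B"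
    and \<gamma>m: "?\<gamma> \<in> borel_measurable ?M" "AE z in ?M. \<bar>?\<gamma> z\<bar> \<le> G"
    using c \<gamma> by (auto simp: split_def AE_lebesgue_on_iff cyl_borel)
  have sub: "?S \<subseteq> cyl T" using t by (auto simp: cyl_def)
  have i: "integrable ?M (\<lambda>z. (?V z)\<^sup>2)" "integrable ?M (\<lambda>z. ?c z * (?U z)\<^sup>2)" "integrable ?M (\<lambda>z. ?\<gamma> z * ?V z * ?U z)"
    "integrable ?M (\<lambda>z. ?F z * ?U z)" "integrable ?M (\<lambda>z. (?U z)\<^sup>2)" "integrable ?M (\<lambda>z. (?F z)\<^sup>2)"
    using square_integrable_mult[OF square_integrable_mult_bounded[OF sU cm] sU]
      square_integrable_mult[OF square_integrable_mult_bounded[OF sV \<gamma>m] sU]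
      square_integrable_mult[OF sF sU] sU sV sF
    by (simp_all add: square_integrable_def power2_eq_square mult.assoc)
  have iS: "integrable (lebesgue_on ?S) h" if "integrable ?M h" for h :: "real \<times> real \<Rightarrow> real"
    by (rule integrable_lebesgue_on_subset[OF that sub]) (rule cyl_borel)+
  note i' = i[THEN iS]
  have "(\<integral>z. - 2 * ((?V z)\<^sup>2 + ?c z * (?U z)\<^sup>2 + ?\<gamma> z * ?V z * ?U z - ?F z * ?U z) \<partial>lebesgue_on ?S)
     \<le> (\<integral>z. (2 * B + G\<^sup>2 / 2 + 1) * (?U z)\<^sup>2 + (?F z)\<^sup>2 \<partial>lebesgue_on ?S)"
  proof (rule integral_mono_AE)
    have "AE z in lebesgue_on ?S. \<bar>?c z\<bar> \<le> B \<and> \<bar>?\<gamma> z\<bar> \<le> G"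
      unfolding AE_lebesgue_on_iff[OF cyl_borel(3)] using c(2) \<gamma>(2)
      by eventually_elim (use sub in \<open>auto simp: split_def\<close>)
    then show "AE z in lebesgue_on ?S. - 2 * ((?V z)\<^sup>2 + ?c z * (?U z)\<^sup>2 + ?\<gamma> z * ?V z * ?U z - ?F z * ?U z)
       \<le> (2 * B + G\<^sup>2 / 2 + 1) * (?U z)\<^sup>2 + (?F z)\<^sup>2"
      by eventually_elim (rule energy_density_bound, auto)
  qed (use i' in \<open>auto intro!: Bochner_Integration.integrable_add Bochner_Integration.integrable_diff integrable_mult_right\<close>)
  then show ?thesis using i' by (simp add: split_def)
qed

text \<open>Required before the integrals of the weak formulation may be split or subtracted. In the
  drift term the derivative falls on the solution in the forward equation and on the test function
  in the backward one, whence two versions; every product has two square integrable factors.\<close>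

lemma weak_integrand_integrable:
  fixes a :: "real \<Rightarrow> real" and u c g F :: "real \<Rightarrow> real \<Rightarrow> real"
  assumes A: "hypothesis_A a \<tau>" and u: "u \<in> solution_space a T" and w: "w \<in> H1a a"
    and c: "Linf_on (cyl T) (case_prod c)" and \<beta>: "Linf_on Omega (\<lambda>x. \<beta> x / x)" and g: "Linf_on (cyl T) (case_prod g)"
    and F: "L2_on (cyl T) (case_prod F)"
  shows "integrable (lebesgue_on (cyl T)) (\<lambda>z. case z of (s, x) \<Rightarrow> a x * deriv (u s) x * deriv w x + c s x * u s x * w x + \<beta> x * g s x * deriv (u s) x * w x)"
    "integrable (lebesgue_on (cyl T)) (\<lambda>z. case z of (s, x) \<Rightarrow> a x * deriv (u s) x * deriv w x + c s x * u s x * w x + \<beta> x * g s x * u s x * deriv w x)"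
    "integrable (lebesgue_on (cyl T)) (\<lambda>z. case z of (s, x) \<Rightarrow> F s x * w x)"
proof -
  let ?M = "lebesgue_on (cyl T)"
  let ?V = "\<lambda>z. sqrt (a (snd z)) * deriv (u (fst z)) (snd z)" and ?U = "\<lambda>z. u (fst z) (snd z)"
    and ?F = "\<lambda>z. F (fst z) (snd z)" and ?c = "\<lambda>z. c (fst z) (snd z)"
    and ?\<gamma> = "\<lambda>z. \<beta> (snd z) * g (fst z) (snd z) / sqrt (a (snd z))"
    and ?w = "\<lambda>z. w (snd z)" and ?w' = "\<lambda>z. sqrt (a (snd z)) * deriv w (snd z)"
  have sU: "square_integrable ?M ?U" and sV: "square_integrable ?M ?V" and sF: "square_integrable ?M ?F"
    using u F by (auto simp: solution_space_def L2_on_square_integrable split_def)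
  have sw: "square_integrable ?M ?w" "square_integrable ?M ?w'"
    using w L2_on_snd[of w T] L2_on_snd[of "\<lambda>x. sqrt (a x) * deriv w x" T]
    by (auto simp: H1a_def L2_on_square_integrable)
  have cm: "?c \<in> borel_measurable ?M" "AE z in ?M. \<bar>?c z\<bar> \<le> \<bar>Linf_norm (cyl T) (case_prod c)\<bar>"
    using Linf_on_AE[OF c cyl_borel(1)] by (simp_all add: split_def AE_lebesgue_on_iff cyl_borel)
  have \<gamma>m: "?\<gamma> \<in> borel_measurable ?M" "AE z in ?M. \<bar>?\<gamma> z\<bar> \<le> \<bar>Linf_norm Omega (\<lambda>x. \<beta> x / x)\<bar> * \<bar>Linf_norm (cyl T) (case_prod g)\<bar> / sqrt (a 1)"
    using drift_coefficient[OF A \<beta> g] by (simp_all add: split_def AE_lebesgue_on_iff cyl_borel)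
  have pos: "sqrt (a (snd z)) > 0" "sqrt (a (snd z)) * sqrt (a (snd z)) = a (snd z)" if "z \<in> cyl T" for z
    using that hypothesis_A_pos[OF A, of "snd z"] by (auto simp: cyl_def)
  have "integrable ?M (\<lambda>z. ?V z * ?w' z + (?c z * ?U z) * ?w z + (?\<gamma> z * ?V z) * ?w z)"
    by (intro Bochner_Integration.integrable_add square_integrable_mult sV sw
        square_integrable_mult_bounded[OF sU cm] square_integrable_mult_bounded[OF sV \<gamma>m])
  also have "?this \<longleftrightarrow> integrable ?M (\<lambda>z. case z of (s, x) \<Rightarrow> a x * deriv (u s) x * deriv w x + c s x * u s x * w x + \<beta> x * g s x * deriv (u s) x * w x)"
  proof (rule Bochner_Integration.integrable_cong[OF refl])
    fix z assume "z \<in> space ?M"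
    then have z: "z \<in> cyl T" by simp
    show "?V z * ?w' z + (?c z * ?U z) * ?w z + (?\<gamma> z * ?V z) * ?w z = (case z of (s, x) \<Rightarrow> a x * deriv (u s) x * deriv w x + c s x * u s x * w x + \<beta> x * g s x * deriv (u s) x * w x)"
      using pos(1)[OF z] pos(2)[OF z, symmetric] by (simp add: split_def field_simps)
  qed
  finally show "integrable ?M (\<lambda>z. case z of (s, x) \<Rightarrow> a x * deriv (u s) x * deriv w x + c s x * u s x * w x + \<beta> x * g s x * deriv (u s) x * w x)" .
  have "integrable ?M (\<lambda>z. ?V z * ?w' z + (?c z * ?U z) * ?w z + (?\<gamma> z * ?U z) * ?w' z)"
    by (intro Bochner_Integration.integrable_add square_integrable_mult sV sw
        square_integrable_mult_bounded[OF sU cm] square_integrable_mult_bounded[OF sU \<gamma>m])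
  also have "?this \<longleftrightarrow> integrable ?M (\<lambda>z. case z of (s, x) \<Rightarrow> a x * deriv (u s) x * deriv w x + c s x * u s x * w x + \<beta> x * g s x * u s x * deriv w x)"
  proof (rule Bochner_Integration.integrable_cong[OF refl])
    fix z assume "z \<in> space ?M"
    then have z: "z \<in> cyl T" by simp
    show "?V z * ?w' z + (?c z * ?U z) * ?w z + (?\<gamma> z * ?U z) * ?w' z = (case z of (s, x) \<Rightarrow> a x * deriv (u s) x * deriv w x + c s x * u s x * w x + \<beta> x * g s x * u s x * deriv w x)"
      using pos(1)[OF z] pos(2)[OF z, symmetric] by (simp add: split_def field_simps)
  qed
  finally show "integrable ?M (\<lambda>z. case z of (s, x) \<Rightarrow> a x * deriv (u s) x * deriv w x + c s x * u s x * w x + \<beta> x * g s x * u s x * deriv w x)" .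
  show "integrable (lebesgue_on (cyl T)) (\<lambda>z. case z of (s, x) \<Rightarrow> F s x * w x)"
    using square_integrable_mult[OF sF sw(1)] by (simp add: split_def)
qed

text \<open>\<open>b\<close> and \<open>d\<close> stand for the \<open>L\<^sup>\<infinity>\<close> norms of the zeroth-order and first-order coefficients.\<close>

definition growth_rate :: "(real \<Rightarrow> real) \<Rightarrow> (real \<Rightarrow> real) \<Rightarrow> real \<Rightarrow> real \<Rightarrow> real" where
  "growth_rate a \<beta> b d = 2 * \<bar>b\<bar> + (\<bar>Linf_norm Omega (\<lambda>x. \<beta> x / x)\<bar> * \<bar>d\<bar> / sqrt (a 1))\<^sup>2 / 2 + 1"

text \<open>With flux \<open>V = sqrt a u_x\<close> the equation takes the form required by
  \<open>solution_energy\<close>; the drift is a bounded multiple of \<open>V\<close> and belongs to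
  the zero-order part \<open>q\<close>.\<close>

lemma forward_energy:
  fixes a \<beta> :: "real \<Rightarrow> real" and u c g F :: "real \<Rightarrow> real \<Rightarrow> real"
  assumes sol: "weak_sol_forward a T c (\<lambda>t x. \<beta> x * g t x) F u0 u"
    and A: "hypothesis_A a \<tau>"
    and c: "Linf_on (cyl T) (case_prod c)" and \<beta>: "Linf_on Omega (\<lambda>x. \<beta> x / x)" and g: "Linf_on (cyl T) (case_prod g)"
    and F: "L2_on (cyl T) (case_prod F)" and t: "0 \<le> t1" "t1 < t2" "t2 \<le> T"
  shows "(LINT x|lebesgue_on Omega. (u t2 x)\<^sup>2) - (LINT x|lebesgue_on Omega. (u t1 x)\<^sup>2)
     \<le> growth_rate a \<beta> (Linf_norm (cyl T) (case_prod c)) (Linf_norm (cyl T) (case_prod g)) * (LINT z|lebesgue_on ({t1<..<t2} \<times> Omega). (case z of (s, x) \<Rightarrow> (u s x)\<^sup>2))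
       + (LINT z|lebesgue_on ({t1<..<t2} \<times> Omega). (case z of (s, x) \<Rightarrow> (F s x)\<^sup>2))"
proof -
  have u: "u \<in> solution_space a T" using sol by (simp add: weak_sol_forward_def)
  let ?M = "lebesgue_on (cyl T)"
  define V where "V s x = sqrt (a x) * deriv (u s) x" for s x
  define \<gamma> where "\<gamma> s x = \<beta> x * g s x / sqrt (a x)" for s x
  define q where "q s x = c s x * u s x + \<gamma> s x * V s x - F s x" for s x
  have sU: "square_integrable ?M (case_prod u)" and sV: "square_integrable ?M (case_prod V)" and sF: "square_integrable ?M (case_prod F)"
    using u F by (auto simp: solution_space_def L2_on_square_integrable split_def V_def)
  have cm: "case_prod c \<in> borel_measurable ?M" "AE z in ?M. \<bar>case_prod c z\<bar> \<le> \<bar>Linf_norm (cyl T) (case_prod c)\<bar>"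
    using Linf_on_AE[OF c cyl_borel(1)] by (simp_all add: AE_lebesgue_on_iff cyl_borel)
  let ?G = "\<bar>Linf_norm Omega (\<lambda>x. \<beta> x / x)\<bar> * \<bar>Linf_norm (cyl T) (case_prod g)\<bar> / sqrt (a 1)"
  have \<gamma>b: "case_prod \<gamma> \<in> borel_measurable ?M" "AE z in lborel. z \<in> cyl T \<longrightarrow> \<bar>case_prod \<gamma> z\<bar> \<le> ?G"
    using drift_coefficient[OF A \<beta> g] by (simp_all add: split_def \<gamma>_def)
  then have \<gamma>m: "AE z in ?M. \<bar>case_prod \<gamma> z\<bar> \<le> ?G" by (simp add: AE_lebesgue_on_iff cyl_borel)
  have "square_integrable ?M (\<lambda>z. case_prod c z * case_prod u z + case_prod \<gamma> z * case_prod V z - case_prod F z)"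
    by (intro square_integrable_diff square_integrable_add sF
        square_integrable_mult_bounded[OF sU cm] square_integrable_mult_bounded[OF sV \<gamma>b(1) \<gamma>m])
  then have q: "L2_on (cyl T) (case_prod q)" by (simp add: L2_on_square_integrable q_def split_def)
  have V: "L2_on (cyl T) (case_prod V)" using sV by (simp add: L2_on_square_integrable)
  have pos: "sqrt (a x) > 0" "sqrt (a x) * sqrt (a x) = a x" if "x \<in> Omega" for x
    using hypothesis_A_pos[OF A that] by auto
  have "(LINT x|lebesgue_on Omega. (u t2 x)\<^sup>2) - (LINT x|lebesgue_on Omega. (u t1 x)\<^sup>2)
     = - 2 * (LINT z|lebesgue_on ({t1<..<t2} \<times> Omega). (case z of (s, x) \<Rightarrow> V s x * (sqrt (a x) * deriv (u s) x) + q s x * u s x))"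
  proof (rule solution_energy[OF u V q _ t])
    fix r1 r2 w assume r: "0 \<le> r1" "r1 \<le> r2" "r2 \<le> T" and w: "w \<in> H1a a"
    let ?H = "\<lambda>z. case z of (s, x) \<Rightarrow> a x * deriv (u s) x * deriv w x + c s x * u s x * w x + \<beta> x * g s x * deriv (u s) x * w x"
      and ?K = "\<lambda>z. case z of (s, x) \<Rightarrow> F s x * w x"
    let ?I = "\<lambda>r1 r2 H. LINT z|lebesgue_on ({r1<..<r2} \<times> Omega). H z"
    note ints = weak_integrand_integrable(1,3)[OF A u w c \<beta> g F]
    have eq: "(LINT x|lebesgue_on Omega. u r x * w x) - (LINT x|lebesgue_on Omega. u 0 x * w x) + ?I 0 r ?H = ?I 0 r ?K"
      if "r \<in> {0..T}" for r using sol that w unfolding weak_sol_forward_def by blast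
    \<comment> \<open>The formulation is anchored at time 0: its instance at \<open>r1\<close> is
      subtracted from the one at \<open>r2\<close>.\<close>
    have "?I 0 r2 ?H = ?I 0 r1 ?H + ?I r1 r2 ?H" "?I 0 r2 ?K = ?I 0 r1 ?K + ?I r1 r2 ?K"
      using slab_integral_diff[OF ints(1), of 0 r1 r2] slab_integral_diff[OF ints(2), of 0 r1 r2] r by auto
    then have "(LINT x|lebesgue_on Omega. u r2 x * w x) - (LINT x|lebesgue_on Omega. u r1 x * w x) = - (?I r1 r2 ?H - ?I r1 r2 ?K)"
      using eq[of r1] eq[of r2] r by simp
    also have "?I r1 r2 ?H - ?I r1 r2 ?K = ?I r1 r2 (\<lambda>z. ?H z - ?K z)"
    proof (rule Bochner_Integration.integral_diff[symmetric])
      have "{r1<..<r2} \<times> Omega \<subseteq> cyl T" using r by (auto simp: cyl_def)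
      from integrable_lebesgue_on_subset[OF _ this cyl_borel(1,3)] ints
      show "integrable (lebesgue_on ({r1<..<r2} \<times> Omega)) ?H" "integrable (lebesgue_on ({r1<..<r2} \<times> Omega)) ?K" by blast+
    qed
    also have "\<dots> = ?I r1 r2 (\<lambda>z. case z of (s, x) \<Rightarrow> V s x * (sqrt (a x) * deriv w x) + q s x * w x)"
    proof (rule Bochner_Integration.integral_cong[OF refl])
      fix z assume "z \<in> space (lebesgue_on ({r1<..<r2} \<times> Omega))"
      then have x: "snd z \<in> Omega" by auto
      show "?H z - ?K z = (case z of (s, x) \<Rightarrow> V s x * (sqrt (a x) * deriv w x) + q s x * w x)"
        using pos(1)[OF x] pos(2)[OF x, symmetric] by (simp add: split_def V_def q_def \<gamma>_def field_simps)
    qed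
    finally show "(LINT x|lebesgue_on Omega. u r2 x * w x) - (LINT x|lebesgue_on Omega. u r1 x * w x)
       = - (LINT z|lebesgue_on ({r1<..<r2} \<times> Omega). (case z of (s, x) \<Rightarrow> V s x * (sqrt (a x) * deriv w x) + q s x * w x))" .
  qed
  also have "\<dots> = - 2 * (LINT z|lebesgue_on ({t1<..<t2} \<times> Omega). (case z of (s, x) \<Rightarrow> (sqrt (a x) * deriv (u s) x)\<^sup>2
         + c s x * (u s x)\<^sup>2 + \<gamma> s x * (sqrt (a x) * deriv (u s) x) * u s x - F s x * u s x))"
    by (simp add: split_def V_def q_def power2_eq_square algebra_simps)
  also have "\<dots> \<le> growth_rate a \<beta> (Linf_norm (cyl T) (case_prod c)) (Linf_norm (cyl T) (case_prod g)) * (LINT z|lebesgue_on ({t1<..<t2} \<times> Omega). (case z of (s, x) \<Rightarrow> (u s x)\<^sup>2))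
       + (LINT z|lebesgue_on ({t1<..<t2} \<times> Omega). (case z of (s, x) \<Rightarrow> (F s x)\<^sup>2))"
    unfolding growth_rate_def
    by (rule slab_energy_inequality[OF u Linf_on_AE[OF c cyl_borel(1)] \<gamma>b F]) (use t in auto)
  finally show ?thesis .
qed

text \<open>The drift is in divergence form and joins the flux. Time runs backwards, so flux and
  zero-order part change sign; tested with \<open>u\<close> they yield the same quadratic form as in
  the forward case, hence the same bound with \<open>t1\<close> and \<open>t2\<close>
  exchanged.\<close>

lemma backward_energy:
  fixes a \<beta> :: "real \<Rightarrow> real" and u c g F :: "real \<Rightarrow> real \<Rightarrow> real"
  assumes sol: "weak_sol_backward a T c (\<lambda>t x. \<beta> x * g t x) F uT u"
    and A: "hypothesis_A a \<tau>"
    and c: "Linf_on (cyl T) (case_prod c)" and \<beta>: "Linf_on Omega (\<lambda>x. \<beta> x / x)" and g: "Linf_on (cyl T) (case_prod g)"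
    and F: "L2_on (cyl T) (case_prod F)" and t: "0 \<le> t1" "t1 < t2" "t2 \<le> T"
  shows "(LINT x|lebesgue_on Omega. (u t1 x)\<^sup>2) - (LINT x|lebesgue_on Omega. (u t2 x)\<^sup>2)
     \<le> growth_rate a \<beta> (Linf_norm (cyl T) (case_prod c)) (Linf_norm (cyl T) (case_prod g)) * (LINT z|lebesgue_on ({t1<..<t2} \<times> Omega). (case z of (s, x) \<Rightarrow> (u s x)\<^sup>2))
       + (LINT z|lebesgue_on ({t1<..<t2} \<times> Omega). (case z of (s, x) \<Rightarrow> (F s x)\<^sup>2))"
proof -
  have u: "u \<in> solution_space a T" using sol by (simp add: weak_sol_backward_def)
  let ?M = "lebesgue_on (cyl T)"
  define V where "V s x = sqrt (a x) * deriv (u s) x" for s x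
  define \<gamma> where "\<gamma> s x = \<beta> x * g s x / sqrt (a x)" for s x
  define p where "p s x = - (V s x + \<gamma> s x * u s x)" for s x
  define q where "q s x = F s x - c s x * u s x" for s x
  have sU: "square_integrable ?M (case_prod u)" and sV: "square_integrable ?M (case_prod V)" and sF: "square_integrable ?M (case_prod F)"
    using u F by (auto simp: solution_space_def L2_on_square_integrable split_def V_def)
  have cm: "case_prod c \<in> borel_measurable ?M" "AE z in ?M. \<bar>case_prod c z\<bar> \<le> \<bar>Linf_norm (cyl T) (case_prod c)\<bar>"
    using Linf_on_AE[OF c cyl_borel(1)] by (simp_all add: AE_lebesgue_on_iff cyl_borel)
  let ?G = "\<bar>Linf_norm Omega (\<lambda>x. \<beta> x / x)\<bar> * \<bar>Linf_norm (cyl T) (case_prod g)\<bar> / sqrt (a 1)"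
  have \<gamma>b: "case_prod \<gamma> \<in> borel_measurable ?M" "AE z in lborel. z \<in> cyl T \<longrightarrow> \<bar>case_prod \<gamma> z\<bar> \<le> ?G"
    using drift_coefficient[OF A \<beta> g] by (simp_all add: split_def \<gamma>_def)
  then have \<gamma>m: "AE z in ?M. \<bar>case_prod \<gamma> z\<bar> \<le> ?G" by (simp add: AE_lebesgue_on_iff cyl_borel)
  have "square_integrable ?M (\<lambda>z. case_prod F z - case_prod c z * case_prod u z)"
    by (intro square_integrable_diff sF square_integrable_mult_bounded[OF sU cm])
  then have q: "L2_on (cyl T) (case_prod q)" by (simp add: L2_on_square_integrable q_def split_def)
  have "square_integrable ?M (\<lambda>z. (- 1) * (case_prod V z + case_prod \<gamma> z * case_prod u z))"
    by (intro square_integrable_cmult square_integrable_add sV square_integrable_mult_bounded[OF sU \<gamma>b(1) \<gamma>m])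
  then have p: "L2_on (cyl T) (case_prod p)" by (simp add: L2_on_square_integrable p_def split_def)
  have pos: "sqrt (a x) > 0" "sqrt (a x) * sqrt (a x) = a x" if "x \<in> Omega" for x
    using hypothesis_A_pos[OF A that] by auto
  have "(LINT x|lebesgue_on Omega. (u t2 x)\<^sup>2) - (LINT x|lebesgue_on Omega. (u t1 x)\<^sup>2)
     = - 2 * (LINT z|lebesgue_on ({t1<..<t2} \<times> Omega). (case z of (s, x) \<Rightarrow> p s x * (sqrt (a x) * deriv (u s) x) + q s x * u s x))"
  proof (rule solution_energy[OF u p q _ t])
    fix r1 r2 w assume r: "0 \<le> r1" "r1 \<le> r2" "r2 \<le> T" and w: "w \<in> H1a a"
    let ?H = "\<lambda>z. case z of (s, x) \<Rightarrow> a x * deriv (u s) x * deriv w x + c s x * u s x * w x + \<beta> x * g s x * u s x * deriv w x"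
      and ?K = "\<lambda>z. case z of (s, x) \<Rightarrow> F s x * w x"
    let ?I = "\<lambda>r1 r2 H. LINT z|lebesgue_on ({r1<..<r2} \<times> Omega). H z"
    note ints = weak_integrand_integrable(2,3)[OF A u w c \<beta> g F]
    have eq: "(LINT x|lebesgue_on Omega. u r x * w x) - (LINT x|lebesgue_on Omega. u T x * w x) + ?I r T ?H = ?I r T ?K"
      if "r \<in> {0..T}" for r using sol that w unfolding weak_sol_backward_def by blast
    have "?I r1 T ?H = ?I r1 r2 ?H + ?I r2 T ?H" "?I r1 T ?K = ?I r1 r2 ?K + ?I r2 T ?K"
      using slab_integral_diff[OF ints(1), of r1 r2 T] slab_integral_diff[OF ints(2), of r1 r2 T] r by auto
    then have "(LINT x|lebesgue_on Omega. u r2 x * w x) - (LINT x|lebesgue_on Omega. u r1 x * w x) = - (?I r1 r2 ?K - ?I r1 r2 ?H)"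
      using eq[of r1] eq[of r2] r by simp
    also have "?I r1 r2 ?K - ?I r1 r2 ?H = ?I r1 r2 (\<lambda>z. ?K z - ?H z)"
    proof (rule Bochner_Integration.integral_diff[symmetric])
      have "{r1<..<r2} \<times> Omega \<subseteq> cyl T" using r by (auto simp: cyl_def)
      from integrable_lebesgue_on_subset[OF _ this cyl_borel(1,3)] ints
      show "integrable (lebesgue_on ({r1<..<r2} \<times> Omega)) ?K" "integrable (lebesgue_on ({r1<..<r2} \<times> Omega)) ?H" by blast+
    qed
    also have "\<dots> = ?I r1 r2 (\<lambda>z. case z of (s, x) \<Rightarrow> p s x * (sqrt (a x) * deriv w x) + q s x * w x)"
    proof (rule Bochner_Integration.integral_cong[OF refl])
      fix z assume "z \<in> space (lebesgue_on ({r1<..<r2} \<times> Omega))"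
      then have x: "snd z \<in> Omega" by auto
      show "?K z - ?H z = (case z of (s, x) \<Rightarrow> p s x * (sqrt (a x) * deriv w x) + q s x * w x)"
        using pos(1)[OF x] pos(2)[OF x, symmetric] by (simp add: split_def V_def p_def q_def \<gamma>_def field_simps)
    qed
    finally show "(LINT x|lebesgue_on Omega. u r2 x * w x) - (LINT x|lebesgue_on Omega. u r1 x * w x)
       = - (LINT z|lebesgue_on ({r1<..<r2} \<times> Omega). (case z of (s, x) \<Rightarrow> p s x * (sqrt (a x) * deriv w x) + q s x * w x))" .
  qed
  moreover have "- (LINT z|lebesgue_on ({t1<..<t2} \<times> Omega). (case z of (s, x) \<Rightarrow> p s x * (sqrt (a x) * deriv (u s) x) + q s x * u s x))
     = (LINT z|lebesgue_on ({t1<..<t2} \<times> Omega). (case z of (s, x) \<Rightarrow> (sqrt (a x) * deriv (u s) x)\<^sup>2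
         + c s x * (u s x)\<^sup>2 + \<gamma> s x * (sqrt (a x) * deriv (u s) x) * u s x - F s x * u s x))"
    unfolding Bochner_Integration.integral_minus[symmetric]
    by (intro Bochner_Integration.integral_cong[OF refl]) (simp add: split_def V_def p_def q_def power2_eq_square algebra_simps)
  moreover have "- 2 * (LINT z|lebesgue_on ({t1<..<t2} \<times> Omega). (case z of (s, x) \<Rightarrow> (sqrt (a x) * deriv (u s) x)\<^sup>2
         + c s x * (u s x)\<^sup>2 + \<gamma> s x * (sqrt (a x) * deriv (u s) x) * u s x - F s x * u s x))
     \<le> growth_rate a \<beta> (Linf_norm (cyl T) (case_prod c)) (Linf_norm (cyl T) (case_prod g)) * (LINT z|lebesgue_on ({t1<..<t2} \<times> Omega). (case z of (s, x) \<Rightarrow> (u s x)\<^sup>2))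
       + (LINT z|lebesgue_on ({t1<..<t2} \<times> Omega). (case z of (s, x) \<Rightarrow> (F s x)\<^sup>2))"
    unfolding growth_rate_def
    by (rule slab_energy_inequality[OF u Linf_on_AE[OF c cyl_borel(1)] \<gamma>b F]) (use t in auto)
  ultimately show ?thesis by linarith
qed

section \<open>Slab integrals as time integrals of slice norms\<close>

lemma slab_fubini:
  fixes f :: "real \<Rightarrow> real \<Rightarrow> real"
  assumes f: "L2_on (cyl T) (case_prod f)" and t: "0 \<le> t1" "t2 \<le> T"
  shows "\<exists>n. integrable lborel n \<and> (LINT z|lebesgue_on ({t1<..<t2} \<times> Omega). (case z of (s, x) \<Rightarrow> (f s x)\<^sup>2)) = (\<integral>s. n s \<partial>lborel)
      \<and> (AE s in lborel. n s = indicator {t1<..<t2} s * (LINT x|lebesgue_on Omega. (f s x)\<^sup>2))"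
proof -
  obtain h where h: "square_integrable lborel h" "\<And>z. z \<notin> cyl T \<Longrightarrow> h z = 0" "AE z in lborel. z \<in> cyl T \<longrightarrow> h z = case_prod f z"
    using L2_on_representative[OF f cyl_borel(1)] by blast
  have hm: "h \<in> borel_measurable borel" using h(1) by (simp add: square_integrable_def)
  have hm'[measurable]: "h \<in> borel_measurable (lborel \<Otimes>\<^sub>M lborel)" using hm by (simp add: borel_pair)
  let ?k = "\<lambda>z. indicator {t1<..<t2} (fst z) * (h z)\<^sup>2"
  have "(\<lambda>z. (indicator {t1<..<t2} (fst z) * h z)\<^sup>2) = ?k"
    by (auto simp: fun_eq_iff indicator_def)
  then have ki: "integrable lborel ?k"
    using square_integrable_integrable[OF square_integrable_indicator_fst[OF h(1), of "{t1<..<t2}"]] by simp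
  have "(LINT z|lebesgue_on ({t1<..<t2} \<times> Omega). (case z of (s, x) \<Rightarrow> (f s x)\<^sup>2)) = (\<integral>z. ?k z \<partial>lborel)"
  proof (rule lebesgue_on_representative(3))
    show "?k \<in> borel_measurable borel" using ki by auto
    show "?k z = 0" if "z \<notin> {t1<..<t2} \<times> Omega" for z
    proof (cases "fst z \<in> {t1<..<t2}")
      case True
      then have "z \<notin> cyl T" using that by (cases z) (auto simp: cyl_def)
      then show ?thesis using h(2) by simp
    qed simp
    show "AE z in lborel. z \<in> {t1<..<t2} \<times> Omega \<longrightarrow> ?k z = (case z of (s, x) \<Rightarrow> (f s x)\<^sup>2)"
      using h(3) by eventually_elim (use t in \<open>auto simp: cyl_def\<close>)
  qed (rule cyl_borel)
  also have "\<dots> = (\<integral>s. (\<integral>x. ?k (s, x) \<partial>lborel) \<partial>lborel)"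
    using lborel_pair.integral_fst'[of ?k] ki by (simp add: lborel_prod)
  finally have eq: "(LINT z|lebesgue_on ({t1<..<t2} \<times> Omega). (case z of (s, x) \<Rightarrow> (f s x)\<^sup>2)) = (\<integral>s. (\<integral>x. ?k (s, x) \<partial>lborel) \<partial>lborel)" .
  have i: "integrable lborel (\<lambda>s. \<integral>x. ?k (s, x) \<partial>lborel)"
    using lborel_pair.integrable_fst'[of ?k] ki by (simp add: lborel_prod)
  \<comment> \<open>The slice norm is only known to agree almost everywhere with a measurable
    function of time; hence the auxiliary function in the statement.\<close>
  have "AE s in lborel. (\<integral>x. ?k (s, x) \<partial>lborel) = indicator {t1<..<t2} s * (LINT x|lebesgue_on Omega. (f s x)\<^sup>2)"
    using AE_lborel_Pair[OF h(3)]
  proof eventually_elim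
    case (elim s)
    show ?case
    proof (cases "s \<in> {t1<..<t2}")
      case True
      have "(LINT x|lebesgue_on Omega. (f s x)\<^sup>2) = (\<integral>x. (h (s, x))\<^sup>2 \<partial>lborel)"
      proof (rule lebesgue_on_representative(3))
        show "(\<lambda>x. (h (s, x))\<^sup>2) \<in> borel_measurable borel" by measurable
        show "(h (s, x))\<^sup>2 = 0" if "x \<notin> Omega" for x using h(2)[of "(s, x)"] that by (auto simp: cyl_def)
        show "AE x in lborel. x \<in> Omega \<longrightarrow> (h (s, x))\<^sup>2 = (f s x)\<^sup>2"
          using elim by eventually_elim (use True t in \<open>auto simp: cyl_def\<close>)
      qed (rule cyl_borel)
      then show ?thesis using True by simp
    qed simp
  qed
  with eq i show ?thesis by blast
qed

text \<open>Continuity of the slice norm makes the time integral a Henstock-Kurzweil integral over a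
  closed interval, to which differential calculus and the Gronwall inequality apply.\<close>

lemma slab_time_integral:
  fixes f :: "real \<Rightarrow> real \<Rightarrow> real"
  assumes f: "L2_on (cyl T) (case_prod f)" and N: "\<And>t. t \<in> {0..T} \<Longrightarrow> N t = (LINT x|lebesgue_on Omega. (f t x)\<^sup>2)"
    and c: "continuous_on {0..T} N" and t: "0 \<le> t1" "t1 \<le> t2" "t2 \<le> T"
  shows "(LINT z|lebesgue_on ({t1<..<t2} \<times> Omega). (case z of (s, x) \<Rightarrow> (f s x)\<^sup>2)) = integral {t1..t2} N"
proof -
  obtain n where n: "integrable lborel n"
    "(LINT z|lebesgue_on ({t1<..<t2} \<times> Omega). (case z of (s, x) \<Rightarrow> (f s x)\<^sup>2)) = (\<integral>s. n s \<partial>lborel)"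
    "AE s in lborel. n s = indicator {t1<..<t2} s * (LINT x|lebesgue_on Omega. (f s x)\<^sup>2)"
    using slab_fubini[OF f t(1,3)] by blast
  note n(2)
  also have "(\<integral>s. n s \<partial>lborel) = (\<integral>s. indicator {t1<..<t2} s * N s \<partial>lborel)"
  proof (rule integral_cong_AE)
    show "n \<in> borel_measurable lborel" using n(1) by auto
    have "(\<lambda>s. indicator {t1<..<t2} s *\<^sub>R N s) \<in> borel_measurable borel"
      by (rule borel_measurable_continuous_on_indicator) (use t in \<open>auto intro: continuous_on_subset[OF c]\<close>)
    then show "(\<lambda>s. indicator {t1<..<t2} s * N s) \<in> borel_measurable lborel" by simp
    show "AE s in lborel. n s = indicator {t1<..<t2} s * N s"
      using n(3) by eventually_elim (use N t in \<open>auto simp: indicator_def\<close>)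
  qed
  also have "\<dots> = integral {t1<..<t2} N"
  proof -
    have "set_integrable lborel {t1..t2} N"
      by (rule borel_integrable_atLeastAtMost') (use t in \<open>auto intro: continuous_on_subset[OF c]\<close>)
    then have "set_integrable lborel {t1<..<t2} N" by (rule set_integrable_subset) auto
    from set_borel_integral_eq_integral(2)[OF this] show ?thesis by (simp add: set_lebesgue_integral_def)
  qed
  also have "\<dots> = integral {t1..t2} N" by (rule integral_open_interval_real[symmetric])
  finally show ?thesis .
qed

section \<open>The Poincare inequality\<close>

text \<open>The integral of \<open>x powr (- \<tau>) / a 1\<close> over
  \<open>(0,1)\<close>.\<close>

definition poincare_constant :: "(real \<Rightarrow> real) \<Rightarrow> real \<Rightarrow> real" where
  "poincare_constant a \<tau> = 1 / (a 1 * (1 - \<tau>))"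

text \<open>Comparison with \<open>x powr (- \<tau>) / a 1\<close>, integrable at 0 because \<tau> <
  1: this weak degeneracy is what the Poincare inequality rests on.\<close>

lemma hypothesis_A_integral_inverse:
  assumes A: "hypothesis_A a \<tau>"
  shows "integrable (lebesgue_on Omega) (\<lambda>x. 1 / a x)"
    "(LINT x|lebesgue_on Omega. 1 / a x) \<le> poincare_constant a \<tau>"
proof -
  have a1: "0 < a 1" and \<tau>: "0 \<le> \<tau>" "\<tau> < 1" using A by (auto simp: hypothesis_A_def)
  let ?p = "\<lambda>x::real. x powr (- \<tau>) / a 1"
  have "((\<lambda>x. x powr (- \<tau>)) has_integral (1 powr (- \<tau> + 1) / (- \<tau> + 1))) {0..1}"
    by (rule has_integral_powr_from_0) (use \<tau> in auto)
  from has_integral_divide[OF this, of "a 1"]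
  have pI: "(?p has_integral poincare_constant a \<tau>) {0..1}"
    using a1 \<tau> by (simp add: poincare_constant_def mult.commute)
  have "?p absolutely_integrable_on {0..1}"
    using pI a1 by (intro nonnegative_absolutely_integrable_1) (auto simp: integrable_on_def)
  then have i: "integrable (lebesgue_on {0..1}) ?p"
    by (subst integrable_restrict_space) (auto simp: set_integrable_def)
  have iO: "integrable (lebesgue_on Omega) ?p"
    by (rule integrable_lebesgue_on_subset[OF i]) auto
  have le: "\<bar>1 / a x\<bar> \<le> ?p x" if x: "x \<in> Omega" for x
  proof -
    have "0 < a 1 * x powr \<tau>" using a1 x by simp
    then have "1 / a x \<le> 1 / (a 1 * x powr \<tau>)"
      using hypothesis_A_lower_bound[OF A, of x] hypothesis_A_pos[OF A x] x by (intro divide_left_mono) auto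
    then show ?thesis using hypothesis_A_pos[OF A x] x a1 by (simp add: powr_minus field_simps)
  qed
  have "continuous_on Omega (\<lambda>x. 1 / a x)"
  proof (intro continuous_intros)
    show "continuous_on Omega a" using A by (auto simp: hypothesis_A_def intro: continuous_on_subset)
    show "\<forall>x\<in>Omega. a x \<noteq> 0" using hypothesis_A_pos[OF A] by fastforce
  qed
  then have m: "(\<lambda>x. 1 / a x) \<in> borel_measurable (lebesgue_on Omega)"
    by (rule continuous_imp_measurable_on_sets_lebesgue) auto
  show int: "integrable (lebesgue_on Omega) (\<lambda>x. 1 / a x)"
    by (rule Bochner_Integration.integrable_bound[OF iO m]) (intro AE_I2, use le order_trans[OF _ abs_ge_self] in force)
  have "(LINT x|lebesgue_on Omega. 1 / a x) \<le> (LINT x|lebesgue_on Omega. ?p x)"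
    by (rule integral_mono[OF int iO]) (rule order_trans[OF abs_ge_self le], simp)
  also have "\<dots> = integral Omega ?p" by (rule lebesgue_integral_eq_integral[OF iO]) auto
  also have "\<dots> = integral {0..1} ?p" by (rule integral_open_interval_real[symmetric])
  also have "\<dots> = poincare_constant a \<tau>" by (rule integral_unique[OF pI])
  finally show "(LINT x|lebesgue_on Omega. 1 / a x) \<le> poincare_constant a \<tau>" .
qed

text \<open>Since \<open>u 1 = 0\<close>, \<open>u y\<close> is minus the integral of
  \<open>u_x\<close> over \<open>{y..1}\<close>. Writing \<open>u_x\<close> as
  \<open>1 / sqrt a\<close> times \<open>sqrt a u_x\<close>, Cauchy-Schwarz bounds \<open>u\<close>
  pointwise, and \<open>Omega\<close> has length 1.\<close>

lemma H1a_poincare: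
  assumes A: "hypothesis_A a \<tau>" and u: "u \<in> H1a a"
  shows "(LINT x|lebesgue_on Omega. (u x)\<^sup>2) \<le> poincare_constant a \<tau> * (LINT x|lebesgue_on Omega. (sqrt (a x) * deriv u x)\<^sup>2)"
proof -
  let ?M = "lebesgue_on Omega" and ?V = "LINT x|lebesgue_on Omega. (sqrt (a x) * deriv u x)\<^sup>2"
  have ac: "abs_cont_on 0 1 u" and u1: "u 1 = 0" and u2: "square_integrable ?M u"
    and v2: "square_integrable ?M (\<lambda>x. sqrt (a x) * deriv u x)"
    using u by (auto simp: H1a_def L2_on_square_integrable)
  have w2: "square_integrable ?M (\<lambda>x. 1 / sqrt (a x))"
    unfolding square_integrable_def
  proof
    have "continuous_on Omega (\<lambda>x. 1 / sqrt (a x))"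
    proof (intro continuous_intros)
      show "continuous_on Omega a" using A by (auto simp: hypothesis_A_def intro: continuous_on_subset)
      show "\<forall>x\<in>Omega. sqrt (a x) \<noteq> 0" using hypothesis_A_pos[OF A] by fastforce
    qed
    then show "(\<lambda>x. 1 / sqrt (a x)) \<in> borel_measurable ?M"
      by (rule continuous_imp_measurable_on_sets_lebesgue) auto
    have "integrable ?M (\<lambda>x. 1 / a x) \<longleftrightarrow> integrable ?M (\<lambda>x. (1 / sqrt (a x))\<^sup>2)"
      by (rule Bochner_Integration.integrable_cong) (use hypothesis_A_pos[OF A] in \<open>auto simp: power_divide less_imp_le\<close>)
    then show "integrable ?M (\<lambda>x. (1 / sqrt (a x))\<^sup>2)" using hypothesis_A_integral_inverse(1)[OF A] by simp
  qed
  have w: "(LINT x|?M. (1 / sqrt (a x))\<^sup>2) \<le> poincare_constant a \<tau>"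
  proof -
    have "(LINT x|?M. (1 / sqrt (a x))\<^sup>2) = (LINT x|?M. 1 / a x)"
      by (rule Bochner_Integration.integral_cong) (use hypothesis_A_pos[OF A] in \<open>auto simp: power_divide less_imp_le\<close>)
    then show ?thesis using hypothesis_A_integral_inverse(2)[OF A] by simp
  qed
  have V0: "0 \<le> ?V" by simp
  have abs: "(\<lambda>x. \<bar>deriv u x\<bar>) integrable_on {0..1}"
    using abs_cont_on_deriv_has_integral(1)[OF ac] by (auto simp: absolutely_integrable_on_def)
  have iabs: "integrable ?M (\<lambda>x. \<bar>deriv u x\<bar>)"
  proof -
    have "integrable (lebesgue_on {0..1}) (deriv u)"
      using abs_cont_on_deriv_has_integral(1)[OF ac] by (subst integrable_restrict_space) (auto simp: set_integrable_def)
    then have "integrable ?M (deriv u)" by (rule integrable_lebesgue_on_subset) auto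
    then show ?thesis by simp
  qed
  have I: "integral {0..1} (\<lambda>x. \<bar>deriv u x\<bar>) \<le> sqrt (poincare_constant a \<tau>) * sqrt ?V"
  proof -
    have "integral {0..1} (\<lambda>x. \<bar>deriv u x\<bar>) = integral Omega (\<lambda>x. \<bar>deriv u x\<bar>)" by (rule integral_open_interval_real)
    also have "\<dots> = (LINT x|?M. \<bar>deriv u x\<bar>)" by (rule lebesgue_integral_eq_integral[symmetric, OF iabs]) auto
    also have "\<dots> = (LINT x|?M. \<bar>1 / sqrt (a x) * (sqrt (a x) * deriv u x)\<bar>)"
    proof (rule Bochner_Integration.integral_cong[OF refl])
      fix x assume "x \<in> space ?M"
      then have "sqrt (a x) > 0" using hypothesis_A_pos[OF A, of x] by simp
      then show "\<bar>deriv u x\<bar> = \<bar>1 / sqrt (a x) * (sqrt (a x) * deriv u x)\<bar>" by simp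
    qed
    also have "\<dots> \<le> sqrt (LINT x|?M. (1 / sqrt (a x))\<^sup>2) * sqrt ?V" by (rule Cauchy_Schwarz_integral_abs[OF w2 v2])
    also have "\<dots> \<le> sqrt (poincare_constant a \<tau>) * sqrt ?V" using w V0 by (intro mult_right_mono) auto
    finally show ?thesis .
  qed
  have pt: "(u y)\<^sup>2 \<le> poincare_constant a \<tau> * ?V" if y: "y \<in> Omega" for y
  proof -
    have "abs_cont_on y 1 u" using abs_cont_on_subinterval[OF ac] y by auto
    from abs_cont_on_deriv_has_integral[OF this] y
    have d: "deriv u absolutely_integrable_on {y..1}" "(deriv u has_integral (u 1 - u y)) {y..1}" by auto
    have iy: "(\<lambda>x. \<bar>deriv u x\<bar>) integrable_on {y..1}" using d(1) by (auto simp: absolutely_integrable_on_def)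
    have "\<bar>u y\<bar> = \<bar>integral {y..1} (deriv u)\<bar>" using integral_unique[OF d(2)] u1 by simp
    also have "\<dots> \<le> integral {y..1} (\<lambda>x. \<bar>deriv u x\<bar>)"
      using integral_norm_bound_integral[of "deriv u" "{y..1}" "\<lambda>x. \<bar>deriv u x\<bar>"] d(2) iy by (auto simp: integrable_on_def)
    also have "\<dots> \<le> integral {0..1} (\<lambda>x. \<bar>deriv u x\<bar>)"
      by (rule integral_subset_le[OF _ iy abs]) (use y in auto)
    also note I
    finally have "(u y)\<^sup>2 \<le> (sqrt (poincare_constant a \<tau>) * sqrt ?V)\<^sup>2"
      by (metis abs_ge_zero power2_abs power_mono)
    moreover have "0 < a 1" "\<tau> < 1" using A by (simp_all add: hypothesis_A_def)
    then have "0 \<le> poincare_constant a \<tau>" by (simp add: poincare_constant_def)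
    ultimately show ?thesis using V0 by (simp add: power_mult_distrib)
  qed
  have fin: "emeasure lebesgue Omega = 1" by simp
  have "(LINT x|?M. (u x)\<^sup>2) \<le> (LINT x|?M. poincare_constant a \<tau> * ?V)"
  proof (rule integral_mono)
    show "integrable ?M (\<lambda>x. poincare_constant a \<tau> * ?V)"
      by (intro finite_measure.integrable_const finite_measure_lebesgue_on) auto
  qed (use u2 pt in \<open>auto simp: square_integrable_def\<close>)
  also have "\<dots> = poincare_constant a \<tau> * ?V"
    by (simp add: measure_restrict_space)
  finally show ?thesis .
qed

lemma slab_poincare:
  assumes A: "hypothesis_A a \<tau>" and u: "u \<in> solution_space a T" and t: "0 \<le> t1" "t2 \<le> T"
  shows "(LINT z|lebesgue_on ({t1<..<t2} \<times> Omega). (case z of (s, x) \<Rightarrow> (u s x)\<^sup>2))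
    \<le> poincare_constant a \<tau> * (LINT z|lebesgue_on ({t1<..<t2} \<times> Omega). (case z of (s, x) \<Rightarrow> (sqrt (a x) * deriv (u s) x)\<^sup>2))"
proof -
  have uH: "AE s in lebesgue_on {0<..<T}. u s \<in> H1a a" and uL: "L2_on (cyl T) (case_prod u)"
    and vL: "L2_on (cyl T) (case_prod (\<lambda>s x. sqrt (a x) * deriv (u s) x))"
    using u by (auto simp: solution_space_def)
  obtain n where n: "integrable lborel n" "(LINT z|lebesgue_on ({t1<..<t2} \<times> Omega). (case z of (s, x) \<Rightarrow> (u s x)\<^sup>2)) = (\<integral>s. n s \<partial>lborel)"
    "AE s in lborel. n s = indicator {t1<..<t2} s * (LINT x|lebesgue_on Omega. (u s x)\<^sup>2)" using slab_fubini[OF uL t] by blast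
  obtain v where v: "integrable lborel v" "(LINT z|lebesgue_on ({t1<..<t2} \<times> Omega). (case z of (s, x) \<Rightarrow> (sqrt (a x) * deriv (u s) x)\<^sup>2)) = (\<integral>s. v s \<partial>lborel)"
    "AE s in lborel. v s = indicator {t1<..<t2} s * (LINT x|lebesgue_on Omega. (sqrt (a x) * deriv (u s) x)\<^sup>2)" using slab_fubini[OF vL t] by blast
  have "AE s in lborel. s \<in> {0<..<T} \<longrightarrow> u s \<in> H1a a" using uH by (subst (asm) AE_lebesgue_on_iff) auto
  with n(3) v(3) have "AE s in lborel. n s \<le> poincare_constant a \<tau> * v s"
  proof eventually_elim
    case (elim s)
    then show ?case using H1a_poincare[OF A, of "u s"] t by (auto simp: indicator_def)
  qed
  then have "(\<integral>s. n s \<partial>lborel) \<le> (\<integral>s. poincare_constant a \<tau> * v s \<partial>lborel)"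
    using n(1) v(1) by (intro integral_mono_AE) auto
  then show ?thesis using n(2) v(2) by simp
qed

section \<open>The Carleman weight\<close>

text \<open>\<open>y / a y\<close> is at most \<open>y powr (1 - \<tau>) / a 1\<close>, whose
  integral over \<open>{0..1}\<close> is \<open>1 / (a 1 * (2 - \<tau>))\<close>. Once
  \<open>d\<close> exceeds this number, \<open>\<Phi> - d\<close> stays between \<open>- d\<close>
  and a negative constant.\<close>

lemma weight_primitive:
  assumes A: "hypothesis_A a \<tau>"
  defines "\<Phi> \<equiv> \<lambda>x. LINT y|lebesgue_on {0..x}. y / a y"
  shows "\<Phi> \<in> borel_measurable (lebesgue_on Omega)"
    "\<And>x. x \<in> Omega \<Longrightarrow> 0 \<le> \<Phi> x" "\<And>x. x \<in> Omega \<Longrightarrow> \<Phi> x \<le> 1 / (a 1 * (2 - \<tau>))"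
proof -
  have a1: "0 < a 1" and \<tau>: "0 \<le> \<tau>" "\<tau> < 1" and ac: "continuous_on {0..1} a"
    using A by (simp_all add: hypothesis_A_def)
  let ?f = "\<lambda>y. y / a y" and ?p = "\<lambda>y::real. y powr (1 - \<tau>) / a 1"
  have f: "0 \<le> ?f y" "?f y \<le> ?p y" if y: "y \<in> {0..1}" for y
  proof -
    \<comment> \<open>At \<open>y = 0\<close> both quotients are 0, the first one as
      \<open>0 / 0\<close> by convention.\<close>
    have "0 \<le> ?f y \<and> ?f y \<le> ?p y"
    proof (cases "y = 0")
      case False
      then have y0: "0 < y" "y \<le> 1" using y by auto
      have "0 < a 1 * y powr \<tau>" using a1 y0 by simp
      moreover have "0 < a y" using A y0 by (simp add: hypothesis_A_def)
      ultimately have "?f y \<le> y / (a 1 * y powr \<tau>)"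
        using hypothesis_A_lower_bound[OF A y0] y0 by (intro divide_left_mono) auto
      also have "\<dots> = ?p y" using y0 by (simp add: powr_diff)
      finally show ?thesis using \<open>0 < a y\<close> y0 by simp
    qed simp
    then show "0 \<le> ?f y" "?f y \<le> ?p y" by auto
  qed
  have pI: "(?p has_integral (x powr (2 - \<tau>) / (2 - \<tau>) / a 1)) {0..x}" if "0 \<le> x" for x
  proof -
    have "((\<lambda>y. y powr (1 - \<tau>)) has_integral (x powr (1 - \<tau> + 1) / (1 - \<tau> + 1))) {0..x}"
      by (rule has_integral_powr_from_0) (use \<tau> that in auto)
    from has_integral_divide[OF this, of "a 1"] show ?thesis by simp
  qed
  have "?p absolutely_integrable_on {0..1}"
    using pI[of 1] a1 by (intro nonnegative_absolutely_integrable_1) (auto simp: integrable_on_def)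
  then have pi: "integrable (lebesgue_on {0..1}) ?p"
    by (subst integrable_restrict_space) (auto simp: set_integrable_def)
  have fm: "?f \<in> borel_measurable (lebesgue_on {0..1})"
    by (intro borel_measurable_divide continuous_imp_measurable_on_sets_lebesgue ac continuous_intros) auto
  have fi: "integrable (lebesgue_on {0..1}) ?f"
  proof (rule Bochner_Integration.integrable_bound[OF pi fm], rule AE_I2)
    fix y assume "y \<in> space (lebesgue_on {0..1::real})"
    then have "y \<in> {0..1}" by simp
    from f[OF this] show "norm (?f y) \<le> norm (?p y)"
      unfolding real_norm_def by (metis abs_of_nonneg order_trans)
  qed
  have "continuous_on {0..1} \<Phi>" unfolding \<Phi>_def by (rule indefinite_integral_continuous_real[OF fi])
  then have "continuous_on Omega \<Phi>" by (rule continuous_on_subset) auto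
  then show "\<Phi> \<in> borel_measurable (lebesgue_on Omega)" by (rule continuous_imp_measurable_on_sets_lebesgue) auto
  fix x assume x: "x \<in> Omega"
  show "0 \<le> \<Phi> x" unfolding \<Phi>_def by (rule Bochner_Integration.integral_nonneg) (use f x in auto)
  have i: "integrable (lebesgue_on {0..x}) ?f" "integrable (lebesgue_on {0..x}) ?p"
    using x by (auto intro: integrable_lebesgue_on_subset[OF fi] integrable_lebesgue_on_subset[OF pi])
  have "\<Phi> x \<le> (LINT y|lebesgue_on {0..x}. ?p y)"
    unfolding \<Phi>_def by (rule integral_mono[OF i]) (use f x in auto)
  also have "\<dots> = integral {0..x} ?p" by (rule lebesgue_integral_eq_integral[OF i(2)]) auto
  also have "\<dots> = x powr (2 - \<tau>) / (2 - \<tau>) / a 1" using x by (intro integral_unique pI) auto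
  also have "\<dots> \<le> 1 / (2 - \<tau>) / a 1"
  proof -
    have "x powr (2 - \<tau>) \<le> 1 powr (2 - \<tau>)" using x \<tau> by (intro powr_mono2) auto
    then show ?thesis using \<tau> a1 by (intro divide_right_mono) auto
  qed
  finally show "\<Phi> x \<le> 1 / (a 1 * (2 - \<tau>))" by (simp add: mult.commute)
qed

text \<open>Positivity of \<open>lam\<close> comes from its lower bound: the exponent
  \<open>2 * r * sup_norm \<sigma>\<close> is positive because \<sigma> is positive at
  \<open>1/2\<close>, and the denominator is at least 4 because
  \<open>d * a 1 * (2 - \<tau>) \<ge> 5\<close>. The bound on \<open>d\<close> makes the exponent of
  the Carleman weight negative.\<close>

lemma carleman_parameters_bounds:
  assumes A: "hypothesis_A a \<tau>" and C: "carleman_parameters a \<tau> U O0 O1 \<sigma> r d lam"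
  shows "0 < lam" "1 / (a 1 * (2 - \<tau>)) < d" "0 < d"
proof -
  have a1: "0 < a 1" and \<tau>: "0 \<le> \<tau>" "\<tau> < 1" using A by (simp_all add: hypothesis_A_def)
  then have q: "0 < a 1 * (2 - \<tau>)" by simp
  have d: "5 / (a 1 * (2 - \<tau>)) \<le> d" using C by (simp add: carleman_parameters_def)
  have "1 / (a 1 * (2 - \<tau>)) < 5 / (a 1 * (2 - \<tau>))" using q by (simp add: divide_strict_right_mono)
  then show d1: "1 / (a 1 * (2 - \<tau>)) < d" using d by linarith
  then show "0 < d" using q by (meson divide_pos_pos less_trans zero_less_one)
  have sig: "sigma_function O0 \<sigma>" using C by (simp add: carleman_parameters_def)
  then have "continuous_on {0..1} \<sigma>"
    unfolding sigma_function_def by (meson has_field_derivative_imp_has_derivative has_derivative_continuous_on has_field_derivative_def)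
  then have "bdd_above ((\<lambda>x. \<bar>\<sigma> x\<bar>) ` {0..1})"
    by (intro bounded_imp_bdd_above compact_imp_bounded compact_continuous_image continuous_intros) auto
  then have "\<bar>\<sigma> (1/2)\<bar> \<le> sup_norm \<sigma>" unfolding sup_norm_def by (rule cSUP_upper[rotated]) auto
  moreover have "0 < \<sigma> (1/2)" using sig by (simp add: sigma_function_def)
  ultimately have s: "0 < sup_norm \<sigma>" by linarith
  have "0 < 4 * ln 2 / sup_norm \<sigma>" using s by simp
  also have "\<dots> \<le> r" using C by (simp add: carleman_parameters_def)
  finally have "0 < 2 * r * sup_norm \<sigma>" using s by simp
  then have e: "0 < exp (2 * r * sup_norm \<sigma>) - 1" by simp
  have "5 \<le> d * (a 1 * (2 - \<tau>))" using d q by (simp add: pos_divide_le_eq)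
  then have "0 < d * a 1 * (2 - \<tau>) - 1" by (simp add: mult.assoc)
  then have "0 < a 1 * (2 - \<tau>) * (exp (2 * r * sup_norm \<sigma>) - 1) / (d * a 1 * (2 - \<tau>) - 1)"
    using q e by (intro divide_pos_pos mult_pos_pos[of "a 1 * (2 - \<tau>)"]) auto
  also have "\<dots> \<le> lam" using C by (simp add: carleman_parameters_def)
  finally show "0 < lam" .
qed

text \<open>\<open>x \<le> exp x\<close>, cubed at \<open>x = k * y / 3\<close>. Applied to
  \<open>y = s * Theta T t\<close>, it lets the exponential weight beat the powers of \<Theta>,
  which blow up at both ends of the time interval.\<close>

lemma cube_exp_bound:
  fixes y k :: real
  assumes "0 \<le> y" "0 < k"
  shows "y ^ 3 * exp (- (k * y)) \<le> (3 / k) ^ 3" "y * exp (- (k * y)) \<le> 1 / k"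
proof -
  have "k * y / 3 \<le> exp (k * y / 3)" using exp_ge_add_one_self[of "k * y / 3"] by linarith
  then have "(k * y / 3) ^ 3 \<le> exp (k * y / 3) ^ 3" using assms by (intro power_mono) auto
  also have "\<dots> = exp (k * y)" by (simp add: exp_of_nat_mult[symmetric])
  finally have "y ^ 3 \<le> (3 / k) ^ 3 * exp (k * y)" using assms by (simp add: field_simps)
  then show "y ^ 3 * exp (- (k * y)) \<le> (3 / k) ^ 3" by (simp add: exp_minus field_simps)
  have "k * y \<le> exp (k * y)" using exp_ge_add_one_self[of "k * y"] by linarith
  then show "y * exp (- (k * y)) \<le> 1 / k" using assms by (simp add: exp_minus field_simps)
qed

section \<open>Bounds for the Carleman integrand\<close>

lemma Theta_pos: "0 < t \<Longrightarrow> t < T \<Longrightarrow> 0 < Theta T t"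
  by (simp add: Theta_def)

lemma Theta_measurable [measurable]: "Theta T \<in> borel_measurable borel"
  unfolding Theta_def by measurable

context
  fixes a :: "real \<Rightarrow> real" and \<tau> d lam s T :: real
  assumes A: "hypothesis_A a \<tau>" and lam: "0 < lam" and d: "1 / (a 1 * (2 - \<tau>)) < d" and s: "0 < s"
begin

definition carleman_integrand :: "(real \<Rightarrow> real \<Rightarrow> real) \<Rightarrow> real \<times> real \<Rightarrow> real" where
  "carleman_integrand z p = (case p of (t, x) \<Rightarrow>
        (s ^ 3 * Theta T t ^ 3 * (x\<^sup>2 / a x) * (z t x)\<^sup>2 + s * Theta T t * a x * (deriv (z t) x)\<^sup>2)
        * exp (2 * s * phi a d lam T t x))"

lemma carleman_integrand_nonneg: "p \<in> cyl T \<Longrightarrow> 0 \<le> carleman_integrand z p"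
  using hypothesis_A_pos[OF A] Theta_pos s
  by (auto simp: carleman_integrand_def cyl_def less_imp_le intro!: mult_nonneg_nonneg add_nonneg_nonneg)

text \<open>Without integrability \<open>carleman_I\<close> would have the default value 0 and the
  Carleman estimate would carry no information. The integrand is a sum of bounded coefficients times
  \<open>u^2\<close> and \<open>a u_x^2\<close>.\<close>

lemma carleman_integrand_integrable:
  assumes u: "u \<in> solution_space a T"
  shows "integrable (lebesgue_on (cyl T)) (carleman_integrand u)"
proof -
  let ?M = "lebesgue_on (cyl T)"
  let ?V = "\<lambda>z. sqrt (a (snd z)) * deriv (u (fst z)) (snd z)" and ?U = "\<lambda>z. u (fst z) (snd z)"
  define \<Phi> where "\<Phi> x = (LINT y|lebesgue_on {0..x}. y / a y)" for x
  note \<Phi> = weight_primitive[OF A, folded \<Phi>_def]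
  let ?e = "\<lambda>z. exp (2 * s * (Theta T (fst z) * (lam * (\<Phi> (snd z) - d))))"
  let ?c1 = "\<lambda>z. (s * Theta T (fst z)) ^ 3 * ((snd z)\<^sup>2 / a (snd z)) * ?e z" and ?c2 = "\<lambda>z. s * Theta T (fst z) * ?e z"
  have sU: "square_integrable ?M ?U" and sV: "square_integrable ?M ?V"
    using u by (auto simp: solution_space_def L2_on_square_integrable split_def)
  have a1: "0 < a 1" using A by (simp add: hypothesis_A_def)
  have "(\<lambda>z::real \<times> real. Theta T (fst z)) \<in> borel_measurable (lborel \<Otimes>\<^sub>M lborel)" by measurable
  then have "(\<lambda>z::real \<times> real. Theta T (fst z)) \<in> borel_measurable lebesgue"
    by (intro measurable_completion) (simp add: lborel_prod)
  then have mT[measurable]: "(\<lambda>z. Theta T (fst z)) \<in> borel_measurable ?M" by (rule measurable_restrict_space1)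
  have "continuous_on Omega (\<lambda>x. x\<^sup>2 / a x)"
  proof (intro continuous_intros)
    show "continuous_on Omega a" using A by (auto simp: hypothesis_A_def intro: continuous_on_subset)
    show "\<forall>x\<in>Omega. a x \<noteq> 0" using hypothesis_A_pos[OF A] by fastforce
  qed
  then have "(\<lambda>x. x\<^sup>2 / a x) \<in> borel_measurable (lebesgue_on Omega)"
    by (rule continuous_imp_measurable_on_sets_lebesgue) auto
  from measurable_lebesgue_on_snd[OF this] have mq[measurable]: "(\<lambda>z. (snd z)\<^sup>2 / a (snd z)) \<in> borel_measurable ?M" .
  from measurable_lebesgue_on_snd[OF \<Phi>(1)] have m\<Phi>[measurable]: "(\<lambda>z. \<Phi> (snd z)) \<in> borel_measurable ?M" .
  have mc: "?c1 \<in> borel_measurable ?M" "?c2 \<in> borel_measurable ?M" by measurable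
  \<comment> \<open>The upper bound on \<open>\<Phi>\<close> gives
    \<open>2 s \<phi> \<le> - k s \<Theta>\<close>, and \<open>k\<close> is positive because
    \<open>d\<close> exceeds that bound.\<close>
  define k where "k = 2 * lam * (d - 1 / (a 1 * (2 - \<tau>)))"
  have k: "0 < k" using lam d by (simp add: k_def)
  have bd: "0 \<le> ?c1 z \<and> ?c1 z \<le> (3 / k) ^ 3 * (1 / a 1) \<and> 0 \<le> ?c2 z \<and> ?c2 z \<le> 1 / k" if z: "z \<in> cyl T" for z
  proof -
    have x: "snd z \<in> Omega" and \<theta>: "0 < Theta T (fst z)" using z Theta_pos by (auto simp: cyl_def)
    let ?y = "s * Theta T (fst z)"
    have y: "0 \<le> ?y" using \<theta> s by simp
    have "2 * lam * ?y * (\<Phi> (snd z) - d) \<le> 2 * lam * ?y * (1 / (a 1 * (2 - \<tau>)) - d)"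
      using \<Phi>(3)[OF x] lam y by (intro mult_left_mono) auto
    then have e: "?e z \<le> exp (- (k * ?y))" by (simp add: k_def algebra_simps)
    have ax: "0 < a (snd z)" by (rule hypothesis_A_pos[OF A x])
    have q: "(snd z)\<^sup>2 / a (snd z) \<le> 1 / a 1"
      using hypothesis_A_square_bound[OF A, of "snd z"] x ax a1 by (simp add: field_simps)
    have "?y ^ 3 * ?e z \<le> ?y ^ 3 * exp (- (k * ?y))" using e y by (intro mult_left_mono) auto
    also have "\<dots> \<le> (3 / k) ^ 3" by (rule cube_exp_bound(1)[OF y k])
    finally have 1: "?y ^ 3 * ?e z \<le> (3 / k) ^ 3" .
    have "(?y ^ 3 * ?e z) * ((snd z)\<^sup>2 / a (snd z)) \<le> (3 / k) ^ 3 * (1 / a 1)"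
      using 1 q k ax by (intro mult_mono) auto
    moreover have "?y * ?e z \<le> ?y * exp (- (k * ?y))" using e y by (intro mult_left_mono) auto
    then have "?y * ?e z \<le> 1 / k" using cube_exp_bound(2)[OF y k] by linarith
    moreover have "0 \<le> ?c1 z" "0 \<le> ?c2 z" using y ax by (auto intro!: mult_nonneg_nonneg divide_nonneg_pos)
    ultimately show ?thesis by (simp add: mult_ac)
  qed
  have "AE z in ?M. \<bar>?c1 z\<bar> \<le> (3 / k) ^ 3 * (1 / a 1)" "AE z in ?M. \<bar>?c2 z\<bar> \<le> 1 / k"
    using bd by (intro AE_I2, metis abs_of_nonneg space_lebesgue_on)+
  with mc have "integrable ?M (\<lambda>z. ?c1 z * ?U z * ?U z + ?c2 z * ?V z * ?V z)"
    by (intro Bochner_Integration.integrable_add square_integrable_mult square_integrable_mult_bounded sU sV)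
  also have "?this \<longleftrightarrow> integrable ?M (carleman_integrand u)"
  proof (rule Bochner_Integration.integrable_cong[OF refl])
    fix z assume "z \<in> space ?M"
    then have "0 < a (snd z)" using hypothesis_A_pos[OF A, of "snd z"] by (auto simp: cyl_def)
    then have "a (snd z) = sqrt (a (snd z)) * sqrt (a (snd z))" by simp
    then show "?c1 z * ?U z * ?U z + ?c2 z * ?V z * ?V z = carleman_integrand u z"
      by (simp add: carleman_integrand_def split_def phi_def \<Phi>_def power2_eq_square power_mult_distrib algebra_simps)
  qed
  finally show ?thesis .
qed

text \<open>Both terms of the integrand are nonnegative, so its integral dominates that of the
  gradient term over any slab. As \<open>\<Phi> \<ge> 0\<close>, the exponent is at least
  \<open>- 2 s \<Theta> lam d\<close>, a bound independent of \<open>x\<close>: hence the condition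
  on \<open>w\<close>.\<close>

lemma carleman_lower_bound:
  assumes u: "u \<in> solution_space a T" and t: "0 \<le> t1" "t1 \<le> t2" "t2 \<le> T"
    and w: "\<And>t. t \<in> {t1<..<t2} \<Longrightarrow> w \<le> s * Theta T t * exp (- (2 * s * Theta T t * lam * d))"
  shows "w * (LINT z|lebesgue_on ({t1<..<t2} \<times> Omega). (case z of (t, x) \<Rightarrow> (sqrt (a x) * deriv (u t) x)\<^sup>2)) \<le> carleman_I a d lam T s u"
proof -
  let ?S = "{t1<..<t2} \<times> Omega"
  have sub: "?S \<subseteq> cyl T" using t by (auto simp: cyl_def)
  have iV: "integrable (lebesgue_on ?S) (\<lambda>z. case z of (t, x) \<Rightarrow> (sqrt (a x) * deriv (u t) x)\<^sup>2)"
    by (rule integrable_lebesgue_on_subset[OF _ sub cyl_borel(1,3)]) (use u in \<open>auto simp: solution_space_def L2_on_def split_def\<close>)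
  note iI = carleman_integrand_integrable[OF u]
  have "w * (LINT z|lebesgue_on ?S. (case z of (t, x) \<Rightarrow> (sqrt (a x) * deriv (u t) x)\<^sup>2))
     = (LINT z|lebesgue_on ?S. w * (case z of (t, x) \<Rightarrow> (sqrt (a x) * deriv (u t) x)\<^sup>2))" by simp
  also have "\<dots> \<le> (LINT z|lebesgue_on ?S. carleman_integrand u z)"
  proof (rule integral_mono)
    show "integrable (lebesgue_on ?S) (\<lambda>z. w * (case z of (t, x) \<Rightarrow> (sqrt (a x) * deriv (u t) x)\<^sup>2))"
      using iV by simp
    show "integrable (lebesgue_on ?S) (carleman_integrand u)"
      by (rule integrable_lebesgue_on_subset[OF iI sub cyl_borel(1,3)])
    fix z assume "z \<in> space (lebesgue_on ?S)"
    then obtain r x where z: "z = (r, x)" "r \<in> {t1<..<t2}" "x \<in> Omega" by (cases z) auto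
    have ax: "0 < a x" by (rule hypothesis_A_pos[OF A z(3)])
    have \<theta>: "0 < Theta T r" using z t by (intro Theta_pos) auto
    have "- (Theta T r * (lam * d)) \<le> phi a d lam T r x"
      using weight_primitive(2)[OF A z(3)] lam \<theta> by (simp add: phi_def algebra_simps)
    then have "2 * s * - (Theta T r * (lam * d)) \<le> 2 * s * phi a d lam T r x" using s by (intro mult_left_mono) auto
    then have e: "exp (- (2 * s * Theta T r * lam * d)) \<le> exp (2 * s * phi a d lam T r x)" by (simp add: mult.assoc)
    have "w \<le> s * Theta T r * exp (- (2 * s * Theta T r * lam * d))" by (rule w[OF z(2)])
    also have "\<dots> \<le> s * Theta T r * exp (2 * s * phi a d lam T r x)" using e s \<theta> by (intro mult_left_mono) auto
    finally have "w * (a x * (deriv (u r) x)\<^sup>2) \<le> s * Theta T r * exp (2 * s * phi a d lam T r x) * (a x * (deriv (u r) x)\<^sup>2)"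
      using ax by (intro mult_right_mono) auto
    also have "\<dots> \<le> carleman_integrand u z"
      using s \<theta> ax by (simp add: z carleman_integrand_def distrib_right mult_ac)
    finally show "w * (case z of (t, x) \<Rightarrow> (sqrt (a x) * deriv (u t) x)\<^sup>2) \<le> carleman_integrand u z"
      using z ax by (simp add: power_mult_distrib)
  qed
  also have "\<dots> \<le> (LINT z|lebesgue_on (cyl T). carleman_integrand u z)"
  proof -
    let ?I = "\<lambda>p q. LINT z|lebesgue_on ({p<..<q} \<times> Omega). carleman_integrand u z"
    have "?I 0 T = ?I 0 t1 + (?I t1 t2 + ?I t2 T)"
      using slab_integral_diff[OF iI, of 0 t1 T] slab_integral_diff[OF iI, of t1 t2 T] t by simp
    moreover have "0 \<le> ?I 0 t1" "0 \<le> ?I t2 T"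
      using t by (auto intro!: Bochner_Integration.integral_nonneg carleman_integrand_nonneg simp: cyl_def)
    ultimately show ?thesis by (simp add: cyl_def)
  qed
  also have "\<dots> = carleman_I a d lam T s u" by (simp add: carleman_I_def carleman_integrand_def)
  finally show ?thesis .
qed

text \<open>A nonnegative integrand has a nonnegative Bochner integral whether integrable or not, so
  no regularity of \<open>z\<close> is asked; it will be the combination of the two states.\<close>

lemma carleman_I_nonneg: "0 \<le> carleman_I a d lam T s z"
proof -
  have "carleman_I a d lam T s z = (LINT p|lebesgue_on (cyl T). carleman_integrand z p)"
    by (simp add: carleman_I_def carleman_integrand_def)
  also have "0 \<le> \<dots>" by (rule Bochner_Integration.integral_nonneg) (simp add: carleman_integrand_nonneg)
  finally show ?thesis .
qed

end

section \<open>The observability inequality\<close>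

text \<open>\<open>?y\<close> decreases: in its derivative the hypothesis makes the terms with
  \<open>K\<close> nonpositive, and \<open>exp (- K * s) \<le> 1\<close> disposes of those with
  \<open>f\<close>.\<close>

lemma gronwall:
  fixes n f :: "real \<Rightarrow> real"
  assumes n: "continuous_on {0..T} n" "\<And>t. t \<in> {0..T} \<Longrightarrow> 0 \<le> n t" and f: "continuous_on {0..T} f" "\<And>t. t \<in> {0..T} \<Longrightarrow> 0 \<le> f t"
    and le: "\<And>t. 0 < t \<Longrightarrow> t \<le> T \<Longrightarrow> n t \<le> integral {0..t} (\<lambda>s. K * n s + f s)" and K: "0 \<le> K"
    and t: "0 < t" "t \<le> T"
  shows "n t \<le> exp (K * t) * integral {0..t} f"
proof -
  let ?g = "\<lambda>s. K * n s + f s"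
  let ?y = "\<lambda>s. exp (- K * s) * integral {0..s} ?g - integral {0..s} f"
  have g: "continuous_on {0..T} ?g" using n f by (intro continuous_intros)
  have D: "((\<lambda>s. integral {0..s} h) has_real_derivative h s) (at s)" if "continuous_on {0..T} h" "0 < s" "s < T" for h s
  proof -
    have "((\<lambda>s. integral {0..s} h) has_real_derivative h s) (at s within {0..T})"
      by (rule integral_has_real_derivative) (use that in auto)
    then show ?thesis using that by (simp add: at_within_Icc_at)
  qed
  have C: "continuous_on {0..T} (\<lambda>s. integral {0..s} h)" if "continuous_on {0..T} h" for h :: "real \<Rightarrow> real"
    by (intro indefinite_integral_continuous_1 integrable_continuous_real that)
  have "?y t \<le> ?y 0"
  proof (rule DERIV_nonpos_imp_decreasing_open[where f = ?y])
    show "0 \<le> t" using t by simp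
    show "continuous_on {0..t} ?y"
      by (intro continuous_intros continuous_on_subset[OF C[OF g]] continuous_on_subset[OF C[OF f(1)]]) (use t in auto)
    fix s assume s: "0 < s" "s < t"
    let ?d = "exp (- K * s) * (- K) * integral {0..s} ?g + exp (- K * s) * ?g s - f s"
    have "(?y has_real_derivative ?d) (at s)"
      by (rule derivative_eq_intros D[OF g] D[OF f(1)] refl | use s t in force)+
    moreover have "?d \<le> 0"
    proof -
      have "K * n s \<le> K * integral {0..s} ?g" using le[of s] s t K by (intro mult_left_mono) auto
      then have "exp (- K * s) * (K * n s - K * integral {0..s} ?g) \<le> 0" by (intro mult_nonneg_nonpos) auto
      moreover have "exp (- K * s) * f s \<le> 1 * f s" using K s t f(2)[of s] by (intro mult_right_mono) auto
      ultimately show ?thesis by (simp add: algebra_simps)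
    qed
    ultimately show "\<exists>d. (?y has_real_derivative d) (at s) \<and> d \<le> 0" by blast
  qed
  then have "exp (- K * t) * integral {0..t} ?g \<le> integral {0..t} f" by simp
  then have "exp (K * t) * (exp (- K * t) * integral {0..t} ?g) \<le> exp (K * t) * integral {0..t} f"
    by (intro mult_left_mono) auto
  then have "integral {0..t} ?g \<le> exp (K * t) * integral {0..t} f"
    by (simp add: mult.assoc[symmetric] exp_add[symmetric])
  then show ?thesis using le[OF t] by simp
qed

section \<open>Absorption of the coupling near the initial time\<close>

lemma integral_le_const:
  fixes f :: "real \<Rightarrow> real"
  assumes "continuous_on {p..q} f" "\<And>x. x \<in> {p..q} \<Longrightarrow> f x \<le> B" "p \<le> q"
  shows "integral {p..q} f \<le> B * (q - p)"
proof -
  have "integral {p..q} f \<le> integral {p..q} (\<lambda>_. B)"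
    using assms by (intro integral_le integrable_continuous_real) auto
  then show ?thesis using assms(3) by (simp add: mult.commute)
qed

lemma integral_ge_const:
  fixes f :: "real \<Rightarrow> real"
  assumes "continuous_on {p..q} f" "\<And>x. x \<in> {p..q} \<Longrightarrow> B \<le> f x" "p \<le> q"
  shows "B * (q - p) \<le> integral {p..q} f"
proof -
  have "integral {p..q} (\<lambda>_. B) \<le> integral {p..q} f"
    using assms by (intro integral_le integrable_continuous_real) auto
  then show ?thesis using assms(3) by (simp add: mult.commute)
qed

text \<open>The scalar core: \<open>N\<close>, \<open>n1\<close>, \<open>n2\<close> are the squared
  slice norms of \<rho>, \<psi>1, \<psi>2, and \<open>m\<close> is a decreasing weight with which
  the Carleman estimate bounds \<open>N\<close> from \<delta> on. \<open>L\<close> is the effective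
  backward rate once Gronwall has replaced each forward state by its factor \<open>c1\<close> or
  \<open>c2\<close>, times \<open>exp (K * T) * T\<close>, times the maximum of \<open>N\<close>.
  The choice of \<delta> guarantees \<open>2 * \<delta> < T\<close> and
  \<open>2 * \<delta> * L \<le> 1/2\<close>.\<close>

lemma coupled_energy_estimate:
  fixes N n1 n2 m :: "real \<Rightarrow> real"
  assumes T: "0 < T" and K: "0 \<le> K" "0 \<le> K'" and c: "0 \<le> c1" "0 \<le> c2" and A: "0 \<le> A1" "0 \<le> A2"
    and N: "continuous_on {0..T} N" "\<And>t. t \<in> {0..T} \<Longrightarrow> 0 \<le> N t"
    and n1: "continuous_on {0..T} n1" "\<And>t. t \<in> {0..T} \<Longrightarrow> 0 \<le> n1 t"
    and n2: "continuous_on {0..T} n2" "\<And>t. t \<in> {0..T} \<Longrightarrow> 0 \<le> n2 t"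
    and fwd1: "\<And>t. 0 < t \<Longrightarrow> t \<le> T \<Longrightarrow> n1 t \<le> integral {0..t} (\<lambda>s. K * n1 s + c1 * N s)"
    and fwd2: "\<And>t. 0 < t \<Longrightarrow> t \<le> T \<Longrightarrow> n2 t \<le> integral {0..t} (\<lambda>s. K * n2 s + c2 * N s)"
    and bwd: "\<And>t1 t2. 0 \<le> t1 \<Longrightarrow> t1 < t2 \<Longrightarrow> t2 \<le> T \<Longrightarrow>
       N t1 \<le> N t2 + integral {t1..t2} (\<lambda>s. K' * N s + (A1 * n1 s + A2 * n2 s))"
  defines "L \<equiv> K' + (A1 * c1 + A2 * c2) * exp (K * T) * T"
  defines "\<delta> \<equiv> T / (4 * (1 + T * L))"
  assumes m: "\<And>t. t < T \<Longrightarrow> 0 < m t" "\<And>s t. s \<le> t \<Longrightarrow> t < T \<Longrightarrow> m t \<le> m s"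
    and carleman: "\<And>t. \<delta> < t \<Longrightarrow> t < T \<Longrightarrow> m t * integral {\<delta>..t} N \<le> X"
  shows "N 0 \<le> 2 / (\<delta> * m (2 * \<delta>)) * X"
    "\<And>t. 0 < t \<Longrightarrow> t < T \<Longrightarrow> m t * n1 t \<le> exp (K * T) * c1 * (3 * m 0 / m (2 * \<delta>)) * X"
    "\<And>t. 0 < t \<Longrightarrow> t < T \<Longrightarrow> m t * n2 t \<le> exp (K * T) * c2 * (3 * m 0 / m (2 * \<delta>)) * X"
proof -
  have contS: "continuous_on {p..q} h" if "continuous_on {0..T} h" "0 \<le> p" "q \<le> T" for p q and h :: "real \<Rightarrow> real"
    by (rule continuous_on_subset[OF that(1)]) (use that in auto)
  have L: "0 \<le> L" using K c A T by (simp add: L_def)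
  then have TL: "0 \<le> T * L" using T by simp
  have \<delta>: "0 < \<delta>" "2 * \<delta> < T" "2 * \<delta> * L \<le> 1/2"
  proof -
    show "0 < \<delta>" using T TL by (simp add: \<delta>_def)
    have "\<delta> \<le> T / (4 * 1)" unfolding \<delta>_def using T TL by (intro divide_left_mono) auto
    then show "2 * \<delta> < T" using T by simp
    have "2 * \<delta> * L = 2 * (T * L) / (4 * (1 + T * L))" by (simp add: \<delta>_def)
    also have "\<dots> \<le> 1/2" using TL by (subst pos_divide_le_eq) auto
    finally show "2 * \<delta> * L \<le> 1/2" .
  qed
  have Nint0: "0 \<le> integral {p..q} N" if "0 \<le> p" "q \<le> T" for p q
    using that N(2) by (intro integral_nonneg integrable_continuous_real contS[OF N(1)]) auto
  have gr: "n t \<le> exp (K * T) * ci * integral {0..t} N"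
    if n: "continuous_on {0..T} n" "\<And>t. t \<in> {0..T} \<Longrightarrow> 0 \<le> n t" "0 \<le> ci"
      and fwd: "\<And>t. 0 < t \<Longrightarrow> t \<le> T \<Longrightarrow> n t \<le> integral {0..t} (\<lambda>s. K * n s + ci * N s)" and t: "0 < t" "t \<le> T" for n ci t
  proof -
    have "n t \<le> exp (K * t) * integral {0..t} (\<lambda>s. ci * N s)"
      by (rule gronwall[OF n(1,2) _ _ fwd K(1) t]) (use n(3) N in \<open>auto intro!: continuous_intros\<close>)
    also have "\<dots> = exp (K * t) * (ci * integral {0..t} N)" by simp
    also have "\<dots> \<le> exp (K * T) * (ci * integral {0..t} N)"
      using K t n(3) Nint0[of 0 t] by (intro mult_right_mono) (auto intro: mult_left_mono)
    finally show ?thesis by simp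
  qed
  have g1: "n1 t \<le> exp (K * T) * c1 * integral {0..t} N" if "0 < t" "t \<le> T" for t
    using that by (intro gr n1 c(1) fwd1)
  have g2: "n2 t \<le> exp (K * T) * c2 * integral {0..t} N" if "0 < t" "t \<le> T" for t
    using that by (intro gr n2 c(2) fwd2)
  \<comment> \<open>Take \<open>x\<close> where \<open>N\<close> is largest on
    \<open>{0..r}\<close>. The backward inequality from \<open>x\<close> to \<open>r\<close> gives
    \<open>N x \<le> N r + L * N x * r\<close>, and as \<open>L * r \<le> 1/2\<close> the last term
    is absorbed. The maximum is taken over \<open>{0..r}\<close> and not \<open>{x..r}\<close>
    because the forward states depend on all times since 0.\<close>
  have double: "N t \<le> 2 * N r" if t: "0 \<le> t" "t \<le> r" and r: "0 < r" "r \<le> 2 * \<delta>" for t r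
  proof -
    obtain x where x: "x \<in> {0..r}" "\<And>y. y \<in> {0..r} \<Longrightarrow> N y \<le> N x"
      using continuous_attains_sup[of "{0..r}" N] contS[OF N(1), of 0 r] r \<delta> by auto
    have Nx: "0 \<le> N x" using N(2)[of x] x(1) r \<delta> by auto
    have "N x \<le> N r + L * N x * r"
    proof (cases "x = r")
      case True
      then show ?thesis using L Nx r by simp
    next
      case False
      then have xr: "0 \<le> x" "x < r" "r \<le> T" using x(1) r \<delta> by auto
      have "integral {x..r} (\<lambda>s. K' * N s + (A1 * n1 s + A2 * n2 s)) \<le> L * N x * (r - x)"
      proof (rule integral_le_const)
        show "continuous_on {x..r} (\<lambda>s. K' * N s + (A1 * n1 s + A2 * n2 s))"
          using xr by (intro continuous_intros contS[OF N(1)] contS[OF n1(1)] contS[OF n2(1)]) auto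
        fix s assume s: "s \<in> {x..r}"
        have Is: "integral {0..s} N \<le> N x * T"
        proof -
          have "integral {0..s} N \<le> N x * (s - 0)"
            using s xr x(2) by (intro integral_le_const contS[OF N(1)]) auto
          also have "\<dots> \<le> N x * T" using Nx s xr by (intro mult_left_mono) auto
          finally show ?thesis .
        qed
        have ni: "Ai * n s \<le> Ai * ci * exp (K * T) * T * N x"
          if "0 \<le> Ai" "0 \<le> ci" "0 < s \<Longrightarrow> n s \<le> exp (K * T) * ci * integral {0..s} N" "s = 0 \<Longrightarrow> n s = 0" for Ai ci n
        proof (cases "s = 0")
          case True
          then show ?thesis using that Nx T by simp
        next
          case False
          then have "n s \<le> exp (K * T) * ci * integral {0..s} N" using that(3) s xr by auto
          also have "\<dots> \<le> exp (K * T) * ci * (N x * T)" using Is that by (intro mult_left_mono) auto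
          finally have "Ai * n s \<le> Ai * (exp (K * T) * ci * (N x * T))" using that(1) by (rule mult_left_mono)
          then show ?thesis by (simp add: mult_ac)
        qed
        \<comment> \<open>The forward inequality is available for positive times only; the value at
          0 follows by continuity.\<close>
        have zero: "n 0 = 0" if n: "continuous_on {0..T} n" "\<And>t. t \<in> {0..T} \<Longrightarrow> 0 \<le> n t"
          "\<And>t. 0 < t \<Longrightarrow> t \<le> T \<Longrightarrow> n t \<le> exp (K * T) * ci * integral {0..t} N" for n ci
        proof -
          have "continuous_on {0..T} (\<lambda>t. integral {0..t} N)"
            by (intro indefinite_integral_continuous_1 integrable_continuous_real N)
          from bspec[OF this[unfolded continuous_on_def], of 0]
          have "((\<lambda>t. integral {0..t} N) \<longlongrightarrow> integral {0..0} N) (at 0 within {0..T})"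
            using T by simp
          then have "((\<lambda>t. exp (K * T) * ci * integral {0..t} N) \<longlongrightarrow> exp (K * T) * ci * integral {0..0} N) (at 0 within {0..T})"
            by (intro tendsto_intros)
          moreover have "(n \<longlongrightarrow> n 0) (at 0 within {0..T})" using n(1) T by (auto simp: continuous_on_def)
          moreover have "eventually (\<lambda>t. n t \<le> exp (K * T) * ci * integral {0..t} N) (at 0 within {0..T})"
            unfolding eventually_at_filter by (intro always_eventually) (use n(3) in auto)
          moreover have "at 0 within {0..T} \<noteq> bot" using T by (simp add: at_within_Icc_at_right)
          ultimately have "n 0 \<le> exp (K * T) * ci * integral {0..0} N" by (intro tendsto_le)
          then show ?thesis using n(2)[of 0] T by simp
        qed
        have "A1 * n1 s \<le> A1 * c1 * exp (K * T) * T * N x"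
          using ni[OF A(1) c(1), of n1] g1[of s] zero[OF n1 g1] s xr by auto
        moreover have "A2 * n2 s \<le> A2 * c2 * exp (K * T) * T * N x"
          using ni[OF A(2) c(2), of n2] g2[of s] zero[OF n2 g2] s xr by auto
        moreover have "K' * N s \<le> K' * N x" using K(2) x(2)[of s] s xr by (intro mult_left_mono) auto
        ultimately show "K' * N s + (A1 * n1 s + A2 * n2 s) \<le> L * N x"
          by (simp add: L_def algebra_simps)
      qed (use xr in simp)
      also have "\<dots> \<le> L * N x * r" using L Nx xr by (intro mult_left_mono) auto
      finally show ?thesis using bwd[of x r] xr by simp
    qed
    also have "L * N x * r \<le> 1/2 * N x"
    proof -
      have "L * r \<le> L * (2 * \<delta>)" using L r by (intro mult_left_mono) auto
      also have "\<dots> \<le> 1/2" using \<delta>(3) by (simp add: mult_ac)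
      finally have "L * r * N x \<le> 1/2 * N x" using Nx by (rule mult_right_mono)
      then show ?thesis by (simp add: mult_ac)
    qed
    finally have "N x \<le> 2 * N r" by simp
    then show ?thesis using x(2)[of t] t by auto
  qed
  let ?J = "integral {\<delta>..2*\<delta>} N"
  \<comment> \<open>\<open>N t \<le> 2 * N r\<close> for every \<open>r\<close> in
    \<open>{\<delta>..2*\<delta>}\<close>, integrated over \<open>r\<close>: values before \<delta>
    are bounded by an integral that the Carleman estimate controls.\<close>
  have early: "\<delta> * N t \<le> 2 * ?J" if "0 \<le> t" "t \<le> \<delta>" for t
  proof -
    have "N t / 2 * (2 * \<delta> - \<delta>) \<le> ?J"
      using \<delta> that double[of t] by (intro integral_ge_const contS[OF N(1)]) (auto simp: field_simps)
    then show ?thesis by (simp add: field_simps)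
  qed
  have JX: "m (2 * \<delta>) * ?J \<le> X" using carleman[of "2 * \<delta>"] \<delta> by simp
  have mpos: "0 < m (2 * \<delta>)" using m(1) \<delta> by simp
  have J: "?J \<le> X / m (2 * \<delta>)" using JX mpos by (simp add: field_simps)
  have "\<delta> * N 0 \<le> 2 * (X / m (2 * \<delta>))" using early[of 0] \<delta> J by simp
  then show "N 0 \<le> 2 / (\<delta> * m (2 * \<delta>)) * X" using \<delta> mpos by (simp add: field_simps)
  have split: "integral {p..q} N + integral {q..r} N = integral {p..r} N" if "0 \<le> p" "p \<le> q" "q \<le> r" "r \<le> T" for p q r
    using that by (intro Henstock_Kurzweil_Integration.integral_combine integrable_continuous_real contS[OF N(1)]) auto
  have I\<delta>: "integral {0..\<delta>} N \<le> 2 * ?J"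
  proof -
    have "integral {0..\<delta>} N \<le> 2 * ?J / \<delta> * (\<delta> - 0)"
      using \<delta> early by (intro integral_le_const contS[OF N(1)]) (auto simp: field_simps)
    then show ?thesis using \<delta> by simp
  qed
  have X: "0 \<le> X" using JX mpos Nint0[of \<delta> "2 * \<delta>"] \<delta> by (meson less_imp_le mult_nonneg_nonneg order_trans)
  \<comment> \<open>Lets the bound for late times share the constant of the one for early
    times.\<close>
  have m0: "1 \<le> m 0 / m (2 * \<delta>)" using m(2)[of 0 "2 * \<delta>"] mpos \<delta> by simp
  \<comment> \<open>Past \<open>2 * \<delta>\<close> the integral from 0 is at most three times the
    one from \<delta>, to which the estimate at time \<open>t\<close> applies. Before
    \<open>2 * \<delta>\<close> the domain is enlarged to \<open>{0..2*\<delta>}\<close> and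
    \<open>m t\<close> to \<open>m 0\<close>.\<close>
  have main: "m t * integral {0..t} N \<le> 3 * m 0 / m (2 * \<delta>) * X" if t: "0 < t" "t < T" for t
  proof (cases "2 * \<delta> \<le> t")
    case True
    have "?J \<le> integral {\<delta>..t} N" using split[of \<delta> "2 * \<delta>" t] Nint0[of "2 * \<delta>" t] \<delta> True t by simp
    then have "integral {0..t} N \<le> 3 * integral {\<delta>..t} N"
      using split[of 0 \<delta> t] I\<delta> \<delta> True t by simp
    then have "m t * integral {0..t} N \<le> m t * (3 * integral {\<delta>..t} N)"
      using m(1)[of t] t by (intro mult_left_mono) auto
    also have "\<dots> \<le> 3 * X" using carleman[of t] True \<delta> t by simp
    also have "\<dots> \<le> m 0 / m (2 * \<delta>) * (3 * X)" using mult_right_mono[OF m0, of "3 * X"] X by simp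
    finally show ?thesis by (simp add: mult_ac)
  next
    case False
    have "integral {0..t} N \<le> integral {0..2*\<delta>} N" using split[of 0 t "2 * \<delta>"] Nint0[of t "2 * \<delta>"] \<delta> False t by simp
    also have "\<dots> \<le> 3 * ?J" using split[of 0 \<delta> "2 * \<delta>"] I\<delta> \<delta> by simp
    finally have "integral {0..t} N \<le> 3 * (X / m (2 * \<delta>))" using J by simp
    then have "m t * integral {0..t} N \<le> m 0 * (3 * (X / m (2 * \<delta>)))"
      using m(1)[of t] m(2)[of 0 t] t Nint0[of 0 t] m(1)[of 0] by (intro mult_mono) auto
    then show ?thesis by (simp add: mult_ac)
  qed
  have fin: "m t * n t \<le> exp (K * T) * ci * (3 * m 0 / m (2 * \<delta>)) * X"
    if "0 \<le> ci" "n t \<le> exp (K * T) * ci * integral {0..t} N" "0 < t" "t < T" for n ci t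
  proof -
    have "m t * n t \<le> m t * (exp (K * T) * ci * integral {0..t} N)"
      using that m(1)[of t] by (intro mult_left_mono) auto
    also have "\<dots> = exp (K * T) * ci * (m t * integral {0..t} N)" by simp
    also have "\<dots> \<le> exp (K * T) * ci * (3 * m 0 / m (2 * \<delta>) * X)"
      using main[OF that(3,4)] that(1) by (intro mult_left_mono) auto
    finally show ?thesis by (simp add: mult_ac)
  qed
  show "m t * n1 t \<le> exp (K * T) * c1 * (3 * m 0 / m (2 * \<delta>)) * X" if "0 < t" "t < T" for t
    using fin[where n = n1, OF c(1) g1 that] that by simp
  show "m t * n2 t \<le> exp (K * T) * c2 * (3 * m 0 / m (2 * \<delta>)) * X" if "0 < t" "t < T" for t
    using fin[where n = n2, OF c(2) g2 that] that by simp
qed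

text \<open>The \<open>L\<close> of \<open>coupled_energy_estimate\<close>. The factors
  \<open>2 * \<alpha>1\<^sup>2\<close> and \<open>2 * \<alpha>2\<^sup>2\<close> come from squaring a
  sum of two sources in the backward equation, \<open>1 / \<mu>1\<^sup>2\<close> and
  \<open>1 / \<mu>2\<^sup>2\<close> from squaring the sources of the forward ones.\<close>

definition coupling_rate :: "real \<Rightarrow> real \<Rightarrow> real \<Rightarrow> real \<Rightarrow> real \<Rightarrow> real \<Rightarrow> real \<Rightarrow> real" where
  "coupling_rate K K' \<alpha>1 \<alpha>2 \<mu>1 \<mu>2 T =
     K' + (2 * \<alpha>1\<^sup>2 * (1 / \<mu>1\<^sup>2) + 2 * \<alpha>2\<^sup>2 * (1 / \<mu>2\<^sup>2)) * exp (K * T) * T"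

text \<open>The \<delta> of \<open>coupled_energy_estimate\<close>.\<close>

definition absorption_time :: "real \<Rightarrow> real \<Rightarrow> real" where
  "absorption_time T L = T / (4 * (1 + T * L))"

text \<open>A decreasing minorant on \<open>(\<delta>, T)\<close> of the Carleman weight: it uses
  \<open>(4 / T\<^sup>2)\<^sup>4 \<le> \<Theta>(r) \<le> (\<delta> (T - t))\<^sup>-\<^sup>4\<close> for \<open>\<delta> < r < t < T\<close>.\<close>

definition time_weight :: "real \<Rightarrow> real \<Rightarrow> real \<Rightarrow> real \<Rightarrow> real \<Rightarrow> real" where
  "time_weight s l \<delta> T t = s * (4 / T\<^sup>2) ^ 4 * exp (- (2 * s * l / (\<delta> * (T - t)) ^ 4))"

lemma time_weight_pos: "0 < s \<Longrightarrow> 0 < T \<Longrightarrow> 0 < time_weight s l \<delta> T t"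
  by (simp add: time_weight_def)

lemma time_weight_antimono:
  assumes "0 < s" "0 < l" "0 < \<delta>" "0 < T" "t1 \<le> t2" "t2 < T"
  shows "time_weight s l \<delta> T t2 \<le> time_weight s l \<delta> T t1"
proof -
  have "2 * s * l / (\<delta> * (T - t1)) ^ 4 \<le> 2 * s * l / (\<delta> * (T - t2)) ^ 4"
    using assms by (intro divide_left_mono power_mono mult_left_mono mult_pos_pos zero_less_power) auto
  then show ?thesis unfolding time_weight_def using assms by (intro mult_left_mono) auto
qed

lemma time_weight_le:
  assumes s: "0 < s" and l: "0 < l" and \<delta>: "0 < \<delta>" and r: "\<delta> < r" "r < t" "t < T"
  shows "time_weight s l \<delta> T t \<le> s * Theta T r * exp (- (2 * s * Theta T r * l))"
proof -
  have T: "0 < T" using \<delta> r by simp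
  have rT: "0 < r * (T - r)" using \<delta> r by simp
  have "0 \<le> (T - 2 * r)\<^sup>2" by simp
  then have "4 * (r * (T - r)) \<le> T\<^sup>2" by (simp add: power2_eq_square algebra_simps)
  then have "4 / T\<^sup>2 \<le> 1 / (r * (T - r))" using rT T by (simp add: field_simps)
  then have "(4 / T\<^sup>2) ^ 4 \<le> (1 / (r * (T - r))) ^ 4" by (intro power_mono) auto
  then have 1: "(4 / T\<^sup>2) ^ 4 \<le> Theta T r" by (simp add: Theta_def power_divide)
  have "\<delta> * (T - t) \<le> r * (T - r)" using \<delta> r by (intro mult_mono) auto
  then have "Theta T r \<le> 1 / (\<delta> * (T - t)) ^ 4"
    unfolding Theta_def using \<delta> r by (intro divide_left_mono power_mono mult_pos_pos zero_less_power) auto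
  then have "2 * s * l * Theta T r \<le> 2 * s * l * (1 / (\<delta> * (T - t)) ^ 4)" using s l by (intro mult_left_mono) auto
  then have "exp (- (2 * s * l / (\<delta> * (T - t)) ^ 4)) \<le> exp (- (2 * s * Theta T r * l))" by (simp add: mult_ac)
  then have "(4 / T\<^sup>2) ^ 4 * exp (- (2 * s * l / (\<delta> * (T - t)) ^ 4)) \<le> Theta T r * exp (- (2 * s * Theta T r * l))"
    using 1 order_trans[OF _ 1, of 0] by (intro mult_mono) auto
  then show ?thesis using s by (simp add: time_weight_def mult.assoc)
qed

section \<open>Growth of the slice norms\<close>

lemma solution_slice_norm:
  assumes u: "u \<in> solution_space a T"
  shows "continuous_on {0..T} (\<lambda>t. LINT x|lebesgue_on Omega. (u t x)\<^sup>2)"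
  using u by (intro continuous_on_L2_norm) (simp_all add: solution_space_def L2_on_square_integrable)

lemma slab_integral_square_le:
  fixes f :: "real \<Rightarrow> real \<Rightarrow> real" and g :: "real \<times> real \<Rightarrow> real"
  assumes f: "L2_on (cyl T) (case_prod f)" and g: "integrable (lebesgue_on (cyl T)) g"
    and le: "\<And>s x. (f s x)\<^sup>2 \<le> g (s, x)" and t: "0 \<le> t1" "t2 \<le> T"
  shows "(LINT z|lebesgue_on ({t1<..<t2} \<times> Omega). (case z of (s, x) \<Rightarrow> (f s x)\<^sup>2)) \<le> (LINT z|lebesgue_on ({t1<..<t2} \<times> Omega). g z)"
proof (rule integral_mono)
  have sub: "{t1<..<t2} \<times> Omega \<subseteq> cyl T" using t by (auto simp: cyl_def)
  show "integrable (lebesgue_on ({t1<..<t2} \<times> Omega)) g"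
    by (rule integrable_lebesgue_on_subset[OF g sub cyl_borel(1,3)])
  show "integrable (lebesgue_on ({t1<..<t2} \<times> Omega)) (\<lambda>z. case z of (s, x) \<Rightarrow> (f s x)\<^sup>2)"
    by (rule integrable_lebesgue_on_subset[OF _ sub cyl_borel(1,3)]) (use f in \<open>simp add: L2_on_def split_def\<close>)
qed (use le in auto)

lemma L2_on_indicator_snd:
  fixes f :: "real \<Rightarrow> real \<Rightarrow> real"
  assumes f: "L2_on (cyl T) (case_prod f)" and S: "open S"
  shows "L2_on (cyl T) (case_prod (\<lambda>t x. c * f t x * indicator S x))"
proof -
  have "(indicator S :: real \<Rightarrow> real) \<in> borel_measurable lebesgue"
    using S by (intro measurable_completion) auto
  then have "(indicator S :: real \<Rightarrow> real) \<in> borel_measurable (lebesgue_on Omega)" by (rule measurable_restrict_space1)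
  from measurable_lebesgue_on_snd[OF this]
  have "(\<lambda>z. c * indicator S (snd z)) \<in> borel_measurable (lebesgue_on (cyl T))" by measurable
  moreover have "AE z in lebesgue_on (cyl T). \<bar>c * indicator S (snd z)\<bar> \<le> \<bar>c\<bar>" by (intro AE_I2) (auto simp: indicator_def)
  ultimately have "square_integrable (lebesgue_on (cyl T)) (\<lambda>z. (c * indicator S (snd z)) * case_prod f z)"
    using f by (intro square_integrable_mult_bounded) (simp_all add: L2_on_square_integrable)
  then show ?thesis by (simp add: L2_on_square_integrable split_def mult_ac)
qed

text \<open>\<open>forward_energy\<close> from time 0, where \<psi> vanishes. The source is \<rho>
  cut to \<open>S\<close> and divided by \<mu>; removing the cut leaves
  \<open>N \<rho> / \<mu>^2\<close>.\<close>

lemma forward_growth: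
  fixes a \<beta> :: "real \<Rightarrow> real" and \<rho> \<psi> c g :: "real \<Rightarrow> real \<Rightarrow> real"
  assumes A: "hypothesis_A a \<tau>" and \<beta>: "Linf_on Omega (\<lambda>x. \<beta> x / x)"
    and c: "Linf_on (cyl T) (case_prod c)" and g: "Linf_on (cyl T) (case_prod g)"
    and \<rho>: "\<rho> \<in> solution_space a T" and S: "open S"
    and sol: "weak_sol_forward a T c (\<lambda>t x. \<beta> x * g t x) (\<lambda>t x. - (1 / \<mu>) * \<rho> t x * indicator S x) (\<lambda>x. 0) \<psi>"
    and t: "0 < t" "t \<le> T"
  defines "K \<equiv> growth_rate a \<beta> (Linf_norm (cyl T) (case_prod c)) (Linf_norm (cyl T) (case_prod g))"
    and "N \<equiv> \<lambda>u t. LINT x|lebesgue_on Omega. (u t x)\<^sup>2"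
  shows "N \<psi> t \<le> integral {0..t} (\<lambda>s. K * N \<psi> s + 1 / \<mu>\<^sup>2 * N \<rho> s)"
proof -
  let ?F = "\<lambda>t x. - (1 / \<mu>) * \<rho> t x * indicator S x"
  have \<psi>: "\<psi> \<in> solution_space a T" using sol by (simp add: weak_sol_forward_def)
  have L\<rho>: "L2_on (cyl T) (case_prod \<rho>)" and L\<psi>: "L2_on (cyl T) (case_prod \<psi>)"
    using \<rho> \<psi> by (auto simp: solution_space_def)
  have F: "L2_on (cyl T) (case_prod ?F)" by (rule L2_on_indicator_snd[OF L\<rho> S])
  have cont: "continuous_on {0..T} (N \<psi>)" "continuous_on {0..T} (N \<rho>)"
    unfolding N_def by (rule solution_slice_norm, rule \<psi> \<rho>)+
  have "AE x in lebesgue_on Omega. \<psi> 0 x = 0" using sol by (simp add: weak_sol_forward_def)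
  then have "AE x in lebesgue_on Omega. (\<psi> 0 x)\<^sup>2 = 0" by eventually_elim simp
  then have N0: "N \<psi> 0 = 0" unfolding N_def by (rule integral_eq_zero_AE)
  have "N \<psi> t - N \<psi> 0 \<le> K * (LINT z|lebesgue_on ({0<..<t} \<times> Omega). (case z of (s, x) \<Rightarrow> (\<psi> s x)\<^sup>2))
       + (LINT z|lebesgue_on ({0<..<t} \<times> Omega). (case z of (s, x) \<Rightarrow> (?F s x)\<^sup>2))"
    unfolding N_def K_def by (rule forward_energy[OF sol A c \<beta> g F]) (use t in auto)
  also have "(LINT z|lebesgue_on ({0<..<t} \<times> Omega). (case z of (s, x) \<Rightarrow> (?F s x)\<^sup>2))
      \<le> (LINT z|lebesgue_on ({0<..<t} \<times> Omega). 1 / \<mu>\<^sup>2 * (case z of (s, x) \<Rightarrow> (\<rho> s x)\<^sup>2))"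
    by (rule slab_integral_square_le[OF F])
      (use L\<rho> t in \<open>auto simp: L2_on_def split_def indicator_def power_mult_distrib power_divide\<close>)
  also have "\<dots> = 1 / \<mu>\<^sup>2 * integral {0..t} (N \<rho>)"
    using slab_time_integral[OF L\<rho> _ cont(2), of 0 t] t by (simp add: N_def)
  also have "(LINT z|lebesgue_on ({0<..<t} \<times> Omega). (case z of (s, x) \<Rightarrow> (\<psi> s x)\<^sup>2)) = integral {0..t} (N \<psi>)"
    using slab_time_integral[OF L\<psi> _ cont(1), of 0 t] t by (simp add: N_def)
  also have "K * integral {0..t} (N \<psi>) + 1 / \<mu>\<^sup>2 * integral {0..t} (N \<rho>) = integral {0..t} (\<lambda>s. K * N \<psi> s + 1 / \<mu>\<^sup>2 * N \<rho> s)"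
  proof -
    have i: "N \<psi> integrable_on {0..t}" "N \<rho> integrable_on {0..t}"
      using t by (auto intro!: integrable_continuous_real continuous_on_subset[OF cont(1)] continuous_on_subset[OF cont(2)])
    have "(\<lambda>s. K * N \<psi> s) integrable_on {0..t}" "(\<lambda>s. 1 / \<mu>\<^sup>2 * N \<rho> s) integrable_on {0..t}"
      using i by (auto intro!: integrable_on_mult_right integrable_on_divide)
    from Henstock_Kurzweil_Integration.integral_add[OF this] show ?thesis by simp
  qed
  finally show ?thesis using N0 by simp
qed

text \<open>\<open>backward_energy\<close> with a source made of both states;
  \<open>square_sum2\<close> separates them at the price of the factor 2.\<close>

lemma backward_growth:
  fixes a \<beta> :: "real \<Rightarrow> real" and \<rho> \<psi>1 \<psi>2 c g :: "real \<Rightarrow> real \<Rightarrow> real"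
  assumes A: "hypothesis_A a \<tau>" and \<beta>: "Linf_on Omega (\<lambda>x. \<beta> x / x)"
    and c: "Linf_on (cyl T) (case_prod c)" and g: "Linf_on (cyl T) (case_prod g)"
    and \<psi>: "\<psi>1 \<in> solution_space a T" "\<psi>2 \<in> solution_space a T" and S: "open S"
    and sol: "weak_sol_backward a T c (\<lambda>t x. \<beta> x * g t x)
       (\<lambda>t x. \<alpha>1 * \<psi>1 t x * indicator S x + \<alpha>2 * \<psi>2 t x * indicator S x) \<rho>T \<rho>"
    and t: "0 \<le> t1" "t1 < t2" "t2 \<le> T"
  defines "K \<equiv> growth_rate a \<beta> (Linf_norm (cyl T) (case_prod c)) (Linf_norm (cyl T) (case_prod g))"
    and "N \<equiv> \<lambda>u t. LINT x|lebesgue_on Omega. (u t x)\<^sup>2"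
  shows "N \<rho> t1 \<le> N \<rho> t2 + integral {t1..t2} (\<lambda>s. K * N \<rho> s + (2 * \<alpha>1\<^sup>2 * N \<psi>1 s + 2 * \<alpha>2\<^sup>2 * N \<psi>2 s))"
proof -
  let ?F = "\<lambda>t x. \<alpha>1 * \<psi>1 t x * indicator S x + \<alpha>2 * \<psi>2 t x * indicator S x"
  have \<rho>: "\<rho> \<in> solution_space a T" using sol by (simp add: weak_sol_backward_def)
  have L\<rho>: "L2_on (cyl T) (case_prod \<rho>)" and L1: "L2_on (cyl T) (case_prod \<psi>1)" and L2: "L2_on (cyl T) (case_prod \<psi>2)"
    using \<rho> \<psi> by (auto simp: solution_space_def)
  have F: "L2_on (cyl T) (case_prod ?F)"
    using square_integrable_add[OF L2_on_indicator_snd[OF L1 S, unfolded L2_on_square_integrable]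
      L2_on_indicator_snd[OF L2 S, unfolded L2_on_square_integrable], of \<alpha>1 \<alpha>2]
    by (simp add: L2_on_square_integrable split_def)
  have cont: "continuous_on {0..T} (N \<rho>)" "continuous_on {0..T} (N \<psi>1)" "continuous_on {0..T} (N \<psi>2)"
    unfolding N_def by (rule solution_slice_norm, rule \<rho> \<psi>)+
  have sub: "{t1<..<t2} \<times> Omega \<subseteq> cyl T" using t by (auto simp: cyl_def)
  have iC: "integrable (lebesgue_on (cyl T)) (\<lambda>z. case z of (s, x) \<Rightarrow> (\<psi>1 s x)\<^sup>2)"
    "integrable (lebesgue_on (cyl T)) (\<lambda>z. case z of (s, x) \<Rightarrow> (\<psi>2 s x)\<^sup>2)"
    using L1 L2 by (simp_all add: L2_on_def split_def)
  note iS = iC[THEN integrable_lebesgue_on_subset, OF sub cyl_borel(1,3)]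
  have "N \<rho> t1 - N \<rho> t2 \<le> K * (LINT z|lebesgue_on ({t1<..<t2} \<times> Omega). (case z of (s, x) \<Rightarrow> (\<rho> s x)\<^sup>2))
       + (LINT z|lebesgue_on ({t1<..<t2} \<times> Omega). (case z of (s, x) \<Rightarrow> (?F s x)\<^sup>2))"
    unfolding N_def K_def by (rule backward_energy[OF sol A c \<beta> g F t])
  also have "(LINT z|lebesgue_on ({t1<..<t2} \<times> Omega). (case z of (s, x) \<Rightarrow> (?F s x)\<^sup>2))
      \<le> (LINT z|lebesgue_on ({t1<..<t2} \<times> Omega). 2 * \<alpha>1\<^sup>2 * (case z of (s, x) \<Rightarrow> (\<psi>1 s x)\<^sup>2) + 2 * \<alpha>2\<^sup>2 * (case z of (s, x) \<Rightarrow> (\<psi>2 s x)\<^sup>2))"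
  proof (rule slab_integral_square_le[OF F])
    show "(?F s x)\<^sup>2 \<le> 2 * \<alpha>1\<^sup>2 * (case (s, x) of (s, x) \<Rightarrow> (\<psi>1 s x)\<^sup>2) + 2 * \<alpha>2\<^sup>2 * (case (s, x) of (s, x) \<Rightarrow> (\<psi>2 s x)\<^sup>2)" for s x
      using square_sum2[of "\<alpha>1 * \<psi>1 s x" "\<alpha>2 * \<psi>2 s x"] by (auto simp: indicator_def power_mult_distrib algebra_simps)
  qed (use iC t in auto)
  also have "\<dots> = 2 * \<alpha>1\<^sup>2 * integral {t1..t2} (N \<psi>1) + 2 * \<alpha>2\<^sup>2 * integral {t1..t2} (N \<psi>2)"
    using slab_time_integral[OF L1 _ cont(2), of t1 t2] slab_time_integral[OF L2 _ cont(3), of t1 t2] t iS by (simp add: N_def)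
  also have "(LINT z|lebesgue_on ({t1<..<t2} \<times> Omega). (case z of (s, x) \<Rightarrow> (\<rho> s x)\<^sup>2)) = integral {t1..t2} (N \<rho>)"
    using slab_time_integral[OF L\<rho> _ cont(1), of t1 t2] t by (simp add: N_def)
  also have "K * integral {t1..t2} (N \<rho>) + (2 * \<alpha>1\<^sup>2 * integral {t1..t2} (N \<psi>1) + 2 * \<alpha>2\<^sup>2 * integral {t1..t2} (N \<psi>2))
     = integral {t1..t2} (\<lambda>s. K * N \<rho> s + (2 * \<alpha>1\<^sup>2 * N \<psi>1 s + 2 * \<alpha>2\<^sup>2 * N \<psi>2 s))"
  proof -
    have i: "N \<rho> integrable_on {t1..t2}" "N \<psi>1 integrable_on {t1..t2}" "N \<psi>2 integrable_on {t1..t2}"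
      using t by (auto intro!: integrable_continuous_real continuous_on_subset[OF cont(1)] continuous_on_subset[OF cont(2)] continuous_on_subset[OF cont(3)])
    have "(\<lambda>s. K * N \<rho> s) integrable_on {t1..t2}" "(\<lambda>s. 2 * \<alpha>1\<^sup>2 * N \<psi>1 s) integrable_on {t1..t2}" "(\<lambda>s. 2 * \<alpha>2\<^sup>2 * N \<psi>2 s) integrable_on {t1..t2}"
      using i by (auto intro!: integrable_on_mult_right)
    then show ?thesis
      by (subst Henstock_Kurzweil_Integration.integral_add, simp, simp add: integrable_add)
         (subst Henstock_Kurzweil_Integration.integral_add, simp_all)
  qed
  finally show ?thesis by simp
qed

text \<open>The factor is kept in the form \<open>(sqrt (m t))\<^sup>2\<close> because \<kappa> will
  be \<open>sqrt m\<close>. Boundedness of \<open>m\<close> gives integrability, and integrating the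
  bound \<open>Y\<close>, valid at each time, over \<open>(0,T)\<close> costs the factor
  \<open>T\<close>.\<close>

lemma weighted_integral_le:
  fixes f :: "real \<Rightarrow> real \<Rightarrow> real"
  assumes f: "L2_on (cyl T) (case_prod f)" and T: "0 < T"
    and m: "m \<in> borel_measurable borel" "\<And>t. t \<in> {0<..<T} \<Longrightarrow> 0 \<le> m t" "\<And>t. t \<in> {0<..<T} \<Longrightarrow> m t \<le> B"
    and le: "\<And>t. t \<in> {0<..<T} \<Longrightarrow> m t * (LINT x|lebesgue_on Omega. (f t x)\<^sup>2) \<le> Y"
  shows "integrable (lebesgue_on (cyl T)) (\<lambda>(t, x). (sqrt (m t))\<^sup>2 * (f t x)\<^sup>2)"
    "(LINT z|lebesgue_on (cyl T). (case z of (t, x) \<Rightarrow> (sqrt (m t))\<^sup>2 * (f t x)\<^sup>2)) \<le> T * Y"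
proof -
  let ?g = "\<lambda>t x. sqrt (m t) * f t x"
  have [measurable]: "m \<in> borel_measurable borel" by (rule m(1))
  have "(\<lambda>z::real \<times> real. sqrt (m (fst z))) \<in> borel_measurable (lborel \<Otimes>\<^sub>M lborel)" by measurable
  then have "(\<lambda>z::real \<times> real. sqrt (m (fst z))) \<in> borel_measurable lebesgue"
    by (intro measurable_completion) (simp add: lborel_prod)
  then have "(\<lambda>z. sqrt (m (fst z))) \<in> borel_measurable (lebesgue_on (cyl T))" by (rule measurable_restrict_space1)
  moreover have "AE z in lebesgue_on (cyl T). \<bar>sqrt (m (fst z))\<bar> \<le> sqrt B"
    using m(2,3) by (intro AE_I2) (auto simp: cyl_def)
  ultimately have "square_integrable (lebesgue_on (cyl T)) (\<lambda>z. sqrt (m (fst z)) * case_prod f z)"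
    using f by (intro square_integrable_mult_bounded) (simp_all add: L2_on_square_integrable)
  then have g: "L2_on (cyl T) (case_prod ?g)" by (simp add: L2_on_square_integrable split_def)
  then show "integrable (lebesgue_on (cyl T)) (\<lambda>(t, x). (sqrt (m t))\<^sup>2 * (f t x)\<^sup>2)"
    by (simp add: L2_on_def split_def power_mult_distrib)
  obtain n where n: "integrable lborel n" "(LINT z|lebesgue_on ({0<..<T} \<times> Omega). (case z of (s, x) \<Rightarrow> (?g s x)\<^sup>2)) = (\<integral>s. n s \<partial>lborel)"
    "AE s in lborel. n s = indicator {0<..<T} s * (LINT x|lebesgue_on Omega. (?g s x)\<^sup>2)"
    using slab_fubini[OF g, of 0 T] by auto
  have "(LINT z|lebesgue_on (cyl T). (case z of (t, x) \<Rightarrow> (sqrt (m t))\<^sup>2 * (f t x)\<^sup>2)) = (\<integral>s. n s \<partial>lborel)"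
    using n(2) by (simp add: cyl_def power_mult_distrib)
  also have "\<dots> \<le> (\<integral>s. indicator {0<..<T} s * Y \<partial>lborel)"
  proof (rule integral_mono_AE[OF n(1)])
    show "integrable lborel (\<lambda>s. indicator {0<..<T} s * Y)" using T by (intro integrable_mult_left integrable_real_indicator) auto
    show "AE s in lborel. n s \<le> indicator {0<..<T} s * Y"
      using n(3)
    proof eventually_elim
      case (elim s)
      then show ?case using le[of s] m(2)[of s] by (cases "s \<in> {0<..<T}") (auto simp: power_mult_distrib)
    qed
  qed
  also have "\<dots> = T * Y" using T by simp
  finally show "(LINT z|lebesgue_on (cyl T). (case z of (t, x) \<Rightarrow> (sqrt (m t))\<^sup>2 * (f t x)\<^sup>2)) \<le> T * Y" .
qed

text \<open>The three summands belong to \<rho>(0), \<psi>1 and \<psi>2. \<open>cp\<close> is the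
  Poincare constant, \<open>l\<close> the product \<open>lam * d\<close>, \<open>w\<close> the time
  weight at \<open>2 * \<delta>\<close>, and \<open>cp * (C2 * s ^ 7)\<close> the factor with which
  the Carleman estimate bounds the weighted time integral of the norm of \<rho>. The final 1 lets
  positivity follow from nonnegativity.\<close>

definition observability_constant ::
  "real \<Rightarrow> real \<Rightarrow> real \<Rightarrow> real \<Rightarrow> real \<Rightarrow> real \<Rightarrow> real \<Rightarrow> real \<Rightarrow> real \<Rightarrow> real \<Rightarrow> real" where
  "observability_constant C2 s cp l \<delta> K c1 c2 T w =
     (2 / (\<delta> * w) + T * (exp (K * T) * c1 * (3 * time_weight s l \<delta> T 0 / w))
        + T * (exp (K * T) * c2 * (3 * time_weight s l \<delta> T 0 / w))) * (cp * (C2 * s ^ 7)) + 1"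

theorem proposition5p6:
  fixes a \<beta> \<sigma> :: "real \<Rightarrow> real"
    and \<omega> \<omega>1 \<omega>2 \<omega>d O0 O1 :: "real set"
    and \<tau> \<alpha>1 \<alpha>2 r d lam :: real
    and s0 :: "real \<Rightarrow> real \<Rightarrow> real \<Rightarrow> real \<Rightarrow> real \<Rightarrow> real \<Rightarrow> real \<Rightarrow> real \<Rightarrow> real"
  assumes "hypothesis_A a \<tau>"
    and "Linf_on Omega (\<lambda>x. \<beta> x / x)"
    and "open \<omega>" "\<omega> \<noteq> {}" "\<omega> \<subseteq> Omega"
    and "open \<omega>1" "\<omega>1 \<noteq> {}" "\<omega>1 \<subseteq> Omega" "\<omega>1 \<inter> \<omega> = {}"
    and "open \<omega>2" "\<omega>2 \<noteq> {}" "\<omega>2 \<subseteq> Omega" "\<omega>2 \<inter> \<omega> = {}"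
    and "open \<omega>d" "\<omega>d \<noteq> {}" "\<omega>d \<subseteq> Omega" "\<omega>d \<inter> \<omega> \<noteq> {}"
    and "\<alpha>1 > 0" "\<alpha>2 > 0"
    and "carleman_parameters a \<tau> (\<omega>d \<inter> \<omega>) O0 O1 \<sigma> r d lam"
  shows "\<exists>C :: real \<Rightarrow> real \<Rightarrow> real \<Rightarrow> real \<Rightarrow> real \<Rightarrow> real \<Rightarrow> real \<Rightarrow> real \<Rightarrow> real.
    \<forall>C2 T \<mu>1 \<mu>2 :: real. \<forall>a1 a2 b1 b2 :: real \<Rightarrow> real \<Rightarrow> real.
      let A1 = Linf_norm (cyl T) (case_prod a1); A2 = Linf_norm (cyl T) (case_prod a2);
          B1 = Linf_norm (cyl T) (case_prod b1); B2 = Linf_norm (cyl T) (case_prod b2)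
      in
      C2 > 0 \<longrightarrow> T > 0 \<longrightarrow> \<mu>1 > 0 \<longrightarrow> \<mu>2 > 0 \<longrightarrow>
      Linf_on (cyl T) (case_prod a1) \<longrightarrow> Linf_on (cyl T) (case_prod a2) \<longrightarrow>
      Linf_on (cyl T) (case_prod b1) \<longrightarrow> Linf_on (cyl T) (case_prod b2) \<longrightarrow>
      carleman_estimate a \<beta> \<omega> \<omega>1 \<omega>2 \<omega>d \<alpha>1 \<alpha>2 d lam \<mu>1 \<mu>2 T a1 a2 b1 b2
        C2 (s0 C2 A1 A2 B1 B2 \<mu>1 \<mu>2 T) \<longrightarrow>
      C C2 A1 A2 B1 B2 \<mu>1 \<mu>2 T > 0 \<and>
      (\<exists>\<kappa> \<in> borel_measurable (lebesgue_on {0<..<T}).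
        (\<forall>t\<in>{0<..<T}. \<kappa> t > 0) \<and>
        (\<forall>\<rho>T \<rho> \<psi>1 \<psi>2.
          L2_on Omega \<rho>T \<longrightarrow>
          coupled_solution a \<beta> \<omega>1 \<omega>2 \<omega>d \<alpha>1 \<alpha>2 \<mu>1 \<mu>2 T a1 a2 b1 b2 \<rho>T \<rho> \<psi>1 \<psi>2 \<longrightarrow>
          (\<forall>\<psi>\<in>{\<psi>1, \<psi>2}. integrable (lebesgue_on (cyl T)) (\<lambda>(t, x). (\<kappa> t)\<^sup>2 * (\<psi> t x)\<^sup>2)) \<and>
          (LINT x|lebesgue_on Omega. (\<rho> 0 x)\<^sup>2)
          + ((LINT p|lebesgue_on (cyl T). (case p of (t, x) \<Rightarrow> (\<kappa> t)\<^sup>2 * (\<psi>1 t x)\<^sup>2))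
             + (LINT p|lebesgue_on (cyl T). (case p of (t, x) \<Rightarrow> (\<kappa> t)\<^sup>2 * (\<psi>2 t x)\<^sup>2)))
          \<le> C C2 A1 A2 B1 B2 \<mu>1 \<mu>2 T
             * (LINT p|lebesgue_on ({0<..<T} \<times> \<omega>). (case p of (t, x) \<Rightarrow> (\<rho> t x)\<^sup>2))))"
proof -
  note A = assms(1) and \<beta> = assms(2) and \<omega>i = assms(6) assms(10) assms(14) and par = assms(20)
  note lam = carleman_parameters_bounds(1)[OF A par] and d = carleman_parameters_bounds(2,3)[OF A par]
  have ld: "0 < lam * d" using lam d by simp
  define cp where "cp = poincare_constant a \<tau>"
  have "0 < a 1" "\<tau> < 1" using A by (simp_all add: hypothesis_A_def)
  then have cp: "0 \<le> cp" by (simp add: cp_def poincare_constant_def)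
  \<comment> \<open>The threshold may be negative; the maximum with 1 keeps \<open>s\<close>
    positive and leaves it a function of the permitted quantities.\<close>
  define sf where "sf C2 A1 A2 B1 B2 \<mu>1 \<mu>2 T = max 1 (s0 C2 A1 A2 B1 B2 \<mu>1 \<mu>2 T)" for C2 A1 A2 B1 B2 \<mu>1 \<mu>2 T
  define df where "df A1 A2 B1 B2 \<mu>1 \<mu>2 T = absorption_time T (coupling_rate (growth_rate a \<beta> B1 B2) (growth_rate a \<beta> A1 A2) \<alpha>1 \<alpha>2 \<mu>1 \<mu>2 T)"
    for A1 A2 B1 B2 \<mu>1 \<mu>2 T
  \<comment> \<open>\<open>C\<close> has to be named before the coefficients are given, so every
    ingredient is a function of \<open>C2\<close>, the norms, \<mu>1, \<mu>2 and \<open>T\<close>;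
    \<open>a\<close>, \<beta>, \<alpha>1, \<alpha>2 and the Carleman parameters are fixed
    beforehand.\<close>
  define C where "C C2 A1 A2 B1 B2 \<mu>1 \<mu>2 T = observability_constant C2 (sf C2 A1 A2 B1 B2 \<mu>1 \<mu>2 T) cp (lam * d)
     (df A1 A2 B1 B2 \<mu>1 \<mu>2 T) (growth_rate a \<beta> B1 B2) (1 / \<mu>1\<^sup>2) (1 / \<mu>2\<^sup>2) T
     (time_weight (sf C2 A1 A2 B1 B2 \<mu>1 \<mu>2 T) (lam * d) (df A1 A2 B1 B2 \<mu>1 \<mu>2 T) T (2 * df A1 A2 B1 B2 \<mu>1 \<mu>2 T))"
    for C2 A1 A2 B1 B2 \<mu>1 \<mu>2 T
  show ?thesis
    unfolding Let_def
  proof (intro exI[of _ C] allI impI)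
    fix C2 T \<mu>1 \<mu>2 :: real and a1 a2 b1 b2 :: "real \<Rightarrow> real \<Rightarrow> real"
    let ?A1 = "Linf_norm (cyl T) (case_prod a1)" and ?A2 = "Linf_norm (cyl T) (case_prod a2)"
      and ?B1 = "Linf_norm (cyl T) (case_prod b1)" and ?B2 = "Linf_norm (cyl T) (case_prod b2)"
    assume C2: "0 < C2" and T: "0 < T" and \<mu>: "0 < \<mu>1" "0 < \<mu>2"
      and a12: "Linf_on (cyl T) (case_prod a1)" "Linf_on (cyl T) (case_prod a2)"
      and b12: "Linf_on (cyl T) (case_prod b1)" "Linf_on (cyl T) (case_prod b2)"
      and carl: "carleman_estimate a \<beta> \<omega> \<omega>1 \<omega>2 \<omega>d \<alpha>1 \<alpha>2 d lam \<mu>1 \<mu>2 T a1 a2 b1 b2 C2 (s0 C2 ?A1 ?A2 ?B1 ?B2 \<mu>1 \<mu>2 T)"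
    define s where "s = sf C2 ?A1 ?A2 ?B1 ?B2 \<mu>1 \<mu>2 T"
    have s: "1 \<le> s" "s0 C2 ?A1 ?A2 ?B1 ?B2 \<mu>1 \<mu>2 T \<le> s" by (simp_all add: s_def sf_def)
    have s0: "0 < s" using s by simp
    define K where "K = growth_rate a \<beta> ?B1 ?B2"
    define K' where "K' = growth_rate a \<beta> ?A1 ?A2"
    have K: "0 \<le> K" "0 \<le> K'" by (simp_all add: K_def K'_def growth_rate_def)
    define L where "L = coupling_rate K K' \<alpha>1 \<alpha>2 \<mu>1 \<mu>2 T"
    define \<delta> where "\<delta> = absorption_time T L"
    have L: "0 \<le> L" using K T \<mu> by (simp add: L_def coupling_rate_def)
    have \<delta>: "0 < \<delta>" using L T by (simp add: \<delta>_def absorption_time_def add_pos_nonneg)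
    define m where "m = time_weight s (lam * d) \<delta> T"
    have mpos: "0 < m t" for t using time_weight_pos[OF s0 T] by (simp add: m_def)
    have manti: "m t2 \<le> m t1" if "t1 \<le> t2" "t2 < T" for t1 t2
      using time_weight_antimono[OF s0 ld \<delta> T that] by (simp add: m_def)
    have mm: "m \<in> borel_measurable borel" unfolding m_def time_weight_def by measurable
    define Y where "Y = 2 / (\<delta> * m (2 * \<delta>)) + T * (exp (K * T) * (1 / \<mu>1\<^sup>2) * (3 * m 0 / m (2 * \<delta>)))
        + T * (exp (K * T) * (1 / \<mu>2\<^sup>2) * (3 * m 0 / m (2 * \<delta>)))"
    have Ceq: "C C2 ?A1 ?A2 ?B1 ?B2 \<mu>1 \<mu>2 T = Y * (cp * (C2 * s ^ 7)) + 1"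
      by (simp add: C_def observability_constant_def Y_def df_def m_def L_def \<delta>_def s_def K_def K'_def)
    have Y: "0 \<le> Y" using \<delta> mpos T by (auto simp: Y_def less_imp_le intro!: add_nonneg_nonneg mult_nonneg_nonneg divide_nonneg_nonneg)
    have "0 \<le> Y * (cp * (C2 * s ^ 7))" using Y cp C2 s0 by simp
    then have Cpos: "0 < C C2 ?A1 ?A2 ?B1 ?B2 \<mu>1 \<mu>2 T" unfolding Ceq by linarith
    have \<kappa>m: "(\<lambda>t. sqrt (m t)) \<in> borel_measurable (lebesgue_on {0<..<T})"
      using mm by (intro measurable_restrict_space1 measurable_completion) auto
    have main: "(\<forall>\<psi>\<in>{\<psi>1, \<psi>2}. integrable (lebesgue_on (cyl T)) (\<lambda>(t, x). (sqrt (m t))\<^sup>2 * (\<psi> t x)\<^sup>2)) \<and>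
          (LINT x|lebesgue_on Omega. (\<rho> 0 x)\<^sup>2)
          + ((LINT p|lebesgue_on (cyl T). (case p of (t, x) \<Rightarrow> (sqrt (m t))\<^sup>2 * (\<psi>1 t x)\<^sup>2))
             + (LINT p|lebesgue_on (cyl T). (case p of (t, x) \<Rightarrow> (sqrt (m t))\<^sup>2 * (\<psi>2 t x)\<^sup>2)))
          \<le> C C2 ?A1 ?A2 ?B1 ?B2 \<mu>1 \<mu>2 T
             * (LINT p|lebesgue_on ({0<..<T} \<times> \<omega>). (case p of (t, x) \<Rightarrow> (\<rho> t x)\<^sup>2))"
      if \<rho>T: "L2_on Omega \<rho>T" and sol: "coupled_solution a \<beta> \<omega>1 \<omega>2 \<omega>d \<alpha>1 \<alpha>2 \<mu>1 \<mu>2 T a1 a2 b1 b2 \<rho>T \<rho> \<psi>1 \<psi>2"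
      for \<rho>T \<rho> \<psi>1 \<psi>2
    proof -
      have sol\<rho>: "weak_sol_backward a T a1 (\<lambda>t x. \<beta> x * a2 t x)
          (\<lambda>t x. \<alpha>1 * \<psi>1 t x * indicator \<omega>d x + \<alpha>2 * \<psi>2 t x * indicator \<omega>d x) \<rho>T \<rho>"
        and sol1: "weak_sol_forward a T b1 (\<lambda>t x. \<beta> x * b2 t x) (\<lambda>t x. - (1 / \<mu>1) * \<rho> t x * indicator \<omega>1 x) (\<lambda>x. 0) \<psi>1"
        and sol2: "weak_sol_forward a T b1 (\<lambda>t x. \<beta> x * b2 t x) (\<lambda>t x. - (1 / \<mu>2) * \<rho> t x * indicator \<omega>2 x) (\<lambda>x. 0) \<psi>2"
        using sol by (simp_all add: coupled_solution_def)
      have sp: "\<rho> \<in> solution_space a T" "\<psi>1 \<in> solution_space a T" "\<psi>2 \<in> solution_space a T"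
        using sol\<rho> sol1 sol2 by (simp_all add: weak_sol_backward_def weak_sol_forward_def)
      define N where "N = (\<lambda>(u :: real \<Rightarrow> real \<Rightarrow> real) t. LINT x|lebesgue_on Omega. (u t x)\<^sup>2)"
      have N0: "0 \<le> N u t" for u t by (simp add: N_def)
      have cont: "continuous_on {0..T} (N \<rho>)" "continuous_on {0..T} (N \<psi>1)" "continuous_on {0..T} (N \<psi>2)"
        unfolding N_def by (rule solution_slice_norm, rule sp)+
      define J where "J = (LINT p|lebesgue_on ({0<..<T} \<times> \<omega>). (case p of (t, x) \<Rightarrow> (\<rho> t x)\<^sup>2))"
      have J: "0 \<le> J" unfolding J_def by (rule Bochner_Integration.integral_nonneg) (simp add: split_def)
      let ?X = "cp * (C2 * s ^ 7) * J"
      have "carleman_I a d lam T s \<rho> + carleman_I a d lam T s (\<lambda>t x. \<alpha>1 * \<psi>1 t x + \<alpha>2 * \<psi>2 t x) \<le> C2 * s ^ 7 * J"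
        using carl \<rho>T sol s(2) unfolding carleman_estimate_def J_def by blast
      \<comment> \<open>The summand of the combined state is nonnegative, so the right side bounds
        that of \<rho> alone.\<close>
      then have I: "carleman_I a d lam T s \<rho> \<le> C2 * s ^ 7 * J"
        using carleman_I_nonneg[OF A lam d(1) s0, of T "\<lambda>t x. \<alpha>1 * \<psi>1 t x + \<alpha>2 * \<psi>2 t x"] by linarith
      have L\<rho>: "L2_on (cyl T) (case_prod \<rho>)" and L1: "L2_on (cyl T) (case_prod \<psi>1)" and L2: "L2_on (cyl T) (case_prod \<psi>2)"
        using sp by (auto simp: solution_space_def)
      \<comment> \<open>The Poincare inequality passes from \<open>N \<rho>\<close> to the gradient,
        and on \<open>{\<delta><..<t}\<close> the number \<open>m t\<close> is a lower bound for the
        Carleman weight of the gradient.\<close>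
      have ce: "m t * integral {\<delta>..t} (N \<rho>) \<le> ?X" if t: "\<delta> < t" "t < T" for t
      proof -
        let ?V = "LINT z|lebesgue_on ({\<delta><..<t} \<times> Omega). (case z of (s, x) \<Rightarrow> (sqrt (a x) * deriv (\<rho> s) x)\<^sup>2)"
        have "integral {\<delta>..t} (N \<rho>) = (LINT z|lebesgue_on ({\<delta><..<t} \<times> Omega). (case z of (s, x) \<Rightarrow> (\<rho> s x)\<^sup>2))"
          using slab_time_integral[OF L\<rho> _ cont(1), of \<delta> t] \<delta> t by (simp add: N_def)
        also have "\<dots> \<le> cp * ?V" unfolding cp_def by (rule slab_poincare[OF A sp(1)]) (use \<delta> t in auto)
        finally have "m t * integral {\<delta>..t} (N \<rho>) \<le> m t * (cp * ?V)" using mpos[of t] by (intro mult_left_mono) auto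
        also have "\<dots> = cp * (m t * ?V)" by simp
        also have "\<dots> \<le> cp * carleman_I a d lam T s \<rho>"
        proof (intro mult_left_mono cp carleman_lower_bound[OF A lam d(1) s0 sp(1)])
          fix r assume "r \<in> {\<delta><..<t}"
          then show "m t \<le> s * Theta T r * exp (- (2 * s * Theta T r * lam * d))"
            using time_weight_le[OF s0 ld \<delta>, of r t T] t by (simp add: m_def mult.assoc)
        qed (use \<delta> t in auto)
        also have "\<dots> \<le> cp * (C2 * s ^ 7 * J)" by (rule mult_left_mono[OF I cp])
        finally show ?thesis by (simp add: mult.assoc)
      qed
      \<comment> \<open>The formula for \<delta> in the shape produced by
        \<open>coupled_energy_estimate\<close>, so that \<open>folded\<close> recognises it.\<close>
      have \<delta>_eq: "\<delta> = T / (4 * (1 + T * (K' + (2 * \<alpha>1\<^sup>2 * (1 / \<mu>1\<^sup>2) + 2 * \<alpha>2\<^sup>2 * (1 / \<mu>2\<^sup>2)) * exp (K * T) * T)))"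
        by (simp add: \<delta>_def absorption_time_def L_def coupling_rate_def)
      note est = coupled_energy_estimate[where N = "N \<rho>" and ?n1.0 = "N \<psi>1" and ?n2.0 = "N \<psi>2" and m = m and X = ?X
          and K = K and K' = K' and ?c1.0 = "1 / \<mu>1\<^sup>2" and ?c2.0 = "1 / \<mu>2\<^sup>2" and ?A1.0 = "2 * \<alpha>1\<^sup>2" and ?A2.0 = "2 * \<alpha>2\<^sup>2",
          OF T K _ _ _ _ cont(1) N0 cont(2) N0 cont(3) N0, folded \<delta>_eq]
      have fwd: "N \<psi>1 t \<le> integral {0..t} (\<lambda>s. K * N \<psi>1 s + 1 / \<mu>1\<^sup>2 * N \<rho> s)"
        "N \<psi>2 t \<le> integral {0..t} (\<lambda>s. K * N \<psi>2 s + 1 / \<mu>2\<^sup>2 * N \<rho> s)" if "0 < t" "t \<le> T" for t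
        using forward_growth[OF A \<beta> b12 sp(1) \<omega>i(1) sol1 that] forward_growth[OF A \<beta> b12 sp(1) \<omega>i(2) sol2 that]
        by (simp_all add: N_def K_def)
      have bwd: "N \<rho> t1 \<le> N \<rho> t2 + integral {t1..t2} (\<lambda>s. K' * N \<rho> s + (2 * \<alpha>1\<^sup>2 * N \<psi>1 s + 2 * \<alpha>2\<^sup>2 * N \<psi>2 s))"
        if "0 \<le> t1" "t1 < t2" "t2 \<le> T" for t1 t2
        using backward_growth[OF A \<beta> a12 sp(2,3) \<omega>i(3) sol\<rho> that] by (simp add: N_def K'_def)
      have 0: "N \<rho> 0 \<le> 2 / (\<delta> * m (2 * \<delta>)) * ?X"
        by (rule est(1)) (use fwd bwd mpos manti ce in auto)
      have 1: "m t * N \<psi>1 t \<le> exp (K * T) * (1 / \<mu>1\<^sup>2) * (3 * m 0 / m (2 * \<delta>)) * ?X" if "t \<in> {0<..<T}" for t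
        by (rule est(2)) (use fwd bwd mpos manti ce that in auto)
      have 2: "m t * N \<psi>2 t \<le> exp (K * T) * (1 / \<mu>2\<^sup>2) * (3 * m 0 / m (2 * \<delta>)) * ?X" if "t \<in> {0<..<T}" for t
        by (rule est(3)) (use fwd bwd mpos manti ce that in auto)
      have mb: "0 \<le> m t" "m t \<le> m 0" if "t \<in> {0<..<T}" for t using mpos[of t] manti[of 0 t] that by auto
      note w1 = weighted_integral_le[OF L1 T mm mb 1[unfolded N_def]] and w2 = weighted_integral_le[OF L2 T mm mb 2[unfolded N_def]]
      have "N \<rho> 0 + ((LINT p|lebesgue_on (cyl T). (case p of (t, x) \<Rightarrow> (sqrt (m t))\<^sup>2 * (\<psi>1 t x)\<^sup>2))
             + (LINT p|lebesgue_on (cyl T). (case p of (t, x) \<Rightarrow> (sqrt (m t))\<^sup>2 * (\<psi>2 t x)\<^sup>2)))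
          \<le> 2 / (\<delta> * m (2 * \<delta>)) * ?X + (T * (exp (K * T) * (1 / \<mu>1\<^sup>2) * (3 * m 0 / m (2 * \<delta>)) * ?X)
             + T * (exp (K * T) * (1 / \<mu>2\<^sup>2) * (3 * m 0 / m (2 * \<delta>)) * ?X))"
        by (intro add_mono 0 w1(2) w2(2))
      also have "\<dots> = Y * (cp * (C2 * s ^ 7)) * J" unfolding Y_def by (simp only: distrib_right distrib_left mult.assoc add.assoc)
      also have "\<dots> \<le> C C2 ?A1 ?A2 ?B1 ?B2 \<mu>1 \<mu>2 T * J" unfolding Ceq using J by (intro mult_right_mono) auto
      finally show ?thesis using w1(1) w2(1) by (simp add: N_def J_def)
    qed
    show "0 < C C2 ?A1 ?A2 ?B1 ?B2 \<mu>1 \<mu>2 T \<and>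
      (\<exists>\<kappa> \<in> borel_measurable (lebesgue_on {0<..<T}).
        (\<forall>t\<in>{0<..<T}. \<kappa> t > 0) \<and>
        (\<forall>\<rho>T \<rho> \<psi>1 \<psi>2.
          L2_on Omega \<rho>T \<longrightarrow>
          coupled_solution a \<beta> \<omega>1 \<omega>2 \<omega>d \<alpha>1 \<alpha>2 \<mu>1 \<mu>2 T a1 a2 b1 b2 \<rho>T \<rho> \<psi>1 \<psi>2 \<longrightarrow>
          (\<forall>\<psi>\<in>{\<psi>1, \<psi>2}. integrable (lebesgue_on (cyl T)) (\<lambda>(t, x). (\<kappa> t)\<^sup>2 * (\<psi> t x)\<^sup>2)) \<and>
          (LINT x|lebesgue_on Omega. (\<rho> 0 x)\<^sup>2)
          + ((LINT p|lebesgue_on (cyl T). (case p of (t, x) \<Rightarrow> (\<kappa> t)\<^sup>2 * (\<psi>1 t x)\<^sup>2))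
             + (LINT p|lebesgue_on (cyl T). (case p of (t, x) \<Rightarrow> (\<kappa> t)\<^sup>2 * (\<psi>2 t x)\<^sup>2)))
          \<le> C C2 ?A1 ?A2 ?B1 ?B2 \<mu>1 \<mu>2 T
             * (LINT p|lebesgue_on ({0<..<T} \<times> \<omega>). (case p of (t, x) \<Rightarrow> (\<rho> t x)\<^sup>2))))"
    \<comment> \<open>One weight serves all solutions: \<open>m\<close> is built from
      \<open>s\<close>, \<open>lam * d\<close>, \<delta> and \<open>T\<close> alone.\<close>
    proof (intro conjI Cpos bexI[of _ "\<lambda>t. sqrt (m t)"] \<kappa>m ballI allI impI)
      show "0 < sqrt (m t)" for t using mpos by simp
    qed (use main in blast)+
  qed
qed

end
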